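(* Let $a$ be a positive integer. Then the following are true. (i) As formal power series, $$q^{-\frac{a(a+1)}{2}}\cdot \mathcal{U}_a(q)=\prod_{n\geq1}\frac{1}{(1-q^n)^3}+O(q^{a+1}).$$ (ii) If $n\leq a+\binom{a+1}{2}$, then, writing $N:=n-\binom{a+1}{2}$, $$MO(a;n)=\sum_{\lambda\vdash N}\ \prod_{h\in\mathcal{H}(\lambda)}\left(\frac{2}{h^2}+1\right)=\sum_{\lambda\vdash N}\ \prod_{s=1}^{N}\binom{2+m_s}{2}.$$
   Context: For a positive integer $a$, the formal power series $\mathcal{U}_a(q)$ and its coefficients $MO(a;n)$ are defined by $$\mathcal{U}_a(q)=\sum_{n\geq0}MO(a;n)\,q^n:=\sum_{0< k_1<k_2<\cdots<k_a} \frac{q^{k_1+k_2+\cdots+k_a}}{(1-q^{k_1})^2(1-q^{k_2})^2\cdots(1-q^{k_a})^2}.$$ $O(q^{a+1})$ denotes a formal power series in $q$ all of whose terms have exponent at least $a+1$. A partition $\lambda=(\lambda_1,\dots,\lambda_\ell)\vdash N$ is a non-increasing sequence of positive integers with sum $N$; $m_s$ denotes the multiplicity of the part $s$ in $\lambda$. The Young diagram of $\lambda$ is the left-justified array of boxes with row lengths $\lambda_1,\lambda_2,\dots$. The hook length of the box $(i,j)$ is $(\lambda_i-i)+(\lambda_j'-j)+1$, where $\lambda_j'$ is the number of boxes in column $j$. $\mathcal{H}(\lambda)$ is the multiset of the hook lengths of all boxes of $\lambda$. The number $0$ has exactly one partition (the empty one, with empty product $1$), and a negative integer has no partitions (empty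 sum $0$). *)

theory Defs
  imports "HOL-Analysis.Analysis" "HOL-Computational_Algebra.Computational_Algebra"
begin

text \<open>
  Infinite sums and products of formal power series are taken with respect to the library topology
  on \<open>fps\<close>, i.e. the \<open>q\<close>-adic one, so that \<open>infsum\<close> and \<open>prodinf\<close> are formal sums and products.
\<close>

definition MO_indices :: "nat \<Rightarrow> nat list set" where
  "MO_indices a = {ks. length ks = a \<and> sorted_wrt (<) ks \<and> (\<forall>k\<in>set ks. 0 < k)}"

definition MO_series :: "nat \<Rightarrow> rat fps" where
  "MO_series a =
     (\<Sum>\<^sub>\<infinity>ks\<in>MO_indices a. fps_X ^ sum_list ks / (\<Prod>k\<leftarrow>ks. (1 - fps_X ^ k)\<^sup>2))"

definition MO :: "nat \<Rightarrow> nat \<Rightarrow> rat" where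
  "MO a n = fps_nth (MO_series a) n"

definition fps_big_O :: "nat \<Rightarrow> 'a::zero fps set" where
  "fps_big_O m = {R. \<forall>k<m. fps_nth R k = 0}"

text \<open>The argument is an integer because \<open>n - (a+1 choose 2)\<close> may be negative.\<close>

definition partitions_of :: "int \<Rightarrow> nat list set" where
  "partitions_of N =
     {xs. sorted_wrt (\<ge>) xs \<and> (\<forall>s\<in>set xs. 0 < s) \<and> int (sum_list xs) = N}"

text \<open>Boxes \<open>(i, j)\<close> are numbered from \<open>1\<close>, whereas \<open>xs ! 0\<close> is the first part.\<close>

definition young_diagram :: "nat list \<Rightarrow> (nat \<times> nat) set" where
  "young_diagram xs = {(i, j). 1 \<le> i \<and> i \<le> length xs \<and> 1 \<le> j \<and> j \<le> xs ! (i - 1)}"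

definition column_length :: "nat list \<Rightarrow> nat \<Rightarrow> nat" where
  "column_length xs j = card {i. (i, j) \<in> young_diagram xs}"

text \<open>Integer-valued, since \<open>xs ! (i - 1) - i\<close> and \<open>column_length xs j - j\<close> may be negative.\<close>

definition hook_length :: "nat list \<Rightarrow> nat \<times> nat \<Rightarrow> int" where
  "hook_length xs = (\<lambda>(i, j).
     (int (xs ! (i - 1)) - int i) + (int (column_length xs j) - int j) + 1)"

definition hook_lengths :: "nat list \<Rightarrow> int multiset" where
  "hook_lengths xs = image_mset (hook_length xs) (mset_set (young_diagram xs))"

end

theory Submission
  imports Defs "Jordan_Normal_Form.Determinant"
begin

text \<open>
  Part (i). Write \<open>x\<^sub>k = q\<^sup>k / (1 - q\<^sup>k)\<^sup>2\<close>. With \<open>x = 2 - \<zeta> - 1/\<zeta>\<close> the numerator of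
  \<open>\<Prod>k\<le>m. (1 + x x\<^sub>k)\<close> is \<open>\<Prod>k\<le>m. (1 - \<zeta> q\<^sup>k) (1 - q\<^sup>k / \<zeta>)\<close>, which the finite Jacobi triple product
  expands as \<open>\<Sum>n. (-1)\<^sup>n q\<^bsup>n(n+1)/2\<^esup> [2m+1, m-n]\<^sub>q (\<zeta>\<^bsup>-n\<^esup> + \<dots> + \<zeta>\<^sup>n)\<close>. Only the terms \<open>n \<ge> a\<close> contribute
  to \<open>x\<^sup>a\<close>, and the term \<open>n = a + 1\<close> starts \<open>a + 1\<close> powers of \<open>q\<close> after the term \<open>n = a\<close>.

  Part (ii) is then the Nekrasov-Okounkov formula
  \<open>\<Sum>\<^sub>\<lambda> q\<^bsup>|\<lambda>|\<^esup> \<Prod>\<^sub>h (1 - t\<^sup>2/h\<^sup>2) = \<Prod>\<^sub>k (1 - q\<^sup>k)\<^bsup>t\<^sup>2 - 1\<^esup>\<close> at \<open>t\<^sup>2 = -2\<close>. For beta numbers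
  \<open>\<beta>\<^sub>1 > \<dots> > \<beta>\<^sub>n\<close> of \<open>\<lambda>\<close>, a Cauchy determinant identifies the hook product with the diagonal matrix entry
  \<open>det (A(\<beta>\<^sub>i, \<beta>\<^sub>j))\<close> of the vertex operator \<open>W\<close> built from \<open>A = (1 - S)\<^bsup>-t\<^esup> (1 - S\<^sup>*)\<^sup>t\<close>, where \<open>S\<close> is the
  unilateral shift. With \<open>\<alpha>\<^bsub>-k\<^esub>\<close> and \<open>\<alpha>\<^sub>k\<close> the operators raising and lowering one entry by \<open>k\<close>, one has
  \<open>W \<alpha>\<^bsub>-k\<^esub> = \<alpha>\<^bsub>-k\<^esub> W - t W\<close>, \<open>\<alpha>\<^sub>k W = W \<alpha>\<^sub>k + t W\<close>, \<open>[\<alpha>\<^sub>k, \<alpha>\<^bsub>-k\<^esub>] = k\<close>, and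
  \<open>\<Sum>\<^sub>k \<alpha>\<^bsub>-k\<^esub> \<alpha>\<^sub>k = |\<lambda>|\<close>, as long as \<open>n\<close> is at least the degree. Moving \<open>\<alpha>\<^sub>k\<close> around the trace of
  \<open>W \<alpha>\<^bsub>-k\<^esub> \<alpha>\<^sub>k\<close> gives \<open>N F\<^sub>N = (1 - t\<^sup>2) \<Sum>k m. k F\<^bsub>N-km\<^esub>\<close> for the hook sums \<open>F\<^sub>N\<close>, the recursion
  satisfied by the coefficients of the Euler product.
\<close>

section \<open>Binomial coefficients and the vertex kernel\<close>

text \<open>The coefficient of \<open>x^m\<close> in \<open>(1 - x)^(-t)\<close>. Convolution
  multiplies these series, so exponents add.\<close>

definition rising_coeff :: "'a::field_char_0 \<Rightarrow> nat \<Rightarrow> 'a" where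
  "rising_coeff t m = pochhammer t m / fact m"

lemma rising_coeff_0 [simp]: "rising_coeff t 0 = 1"
  by (simp add: rising_coeff_def)

lemma rising_coeff_one: "rising_coeff 1 m = 1"
  by (simp add: rising_coeff_def pochhammer_fact[symmetric])

lemma rising_coeff_zero: "rising_coeff 0 m = (if m = 0 then 1 else 0)"
  by (simp add: rising_coeff_def pochhammer_0_left)

lemma rising_coeff_convolution: "(\<Sum>k\<le>n. rising_coeff s k * rising_coeff t (n - k)) = rising_coeff (s + t) n"
proof -
  have "rising_coeff (s + t) n = (\<Sum>k\<le>n. of_nat (n choose k) * pochhammer s k * pochhammer t (n - k)) / fact n"
    by (simp add: rising_coeff_def pochhammer_binomial_sum)
  also have "\<dots> = (\<Sum>k\<le>n. rising_coeff s k * rising_coeff t (n - k))"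
    by (simp add: sum_divide_distrib rising_coeff_def binomial_fact field_simps)
  finally show ?thesis by simp
qed

lemma rising_coeff_convolution_shifted:
  assumes "e \<le> c"
  shows "(\<Sum>b\<in>{e..c}. rising_coeff s (c - b) * rising_coeff t (b - e)) = rising_coeff (s + t) (c - e)"
proof -
  have "(\<Sum>b\<in>{e..c}. rising_coeff s (c - b) * rising_coeff t (b - e)) = (\<Sum>k\<le>c - e. rising_coeff s k * rising_coeff t (c - e - k))"
    by (rule sum.reindex_bij_witness[of _ "\<lambda>k. c - k" "\<lambda>b. c - b"]) (use assms in auto)
  then show ?thesis using rising_coeff_convolution[of s t "c - e"] by simp
qed

lemma of_nat_mult_rising_coeff: "of_nat (Suc m) * rising_coeff t (Suc m) = t * rising_coeff (t + 1) m"
  by (simp add: rising_coeff_def pochhammer_rec del: of_nat_Suc)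

text \<open>The matrix of \<open>(1 - S)\<^bsup>-t\<^esup> (1 - S\<^sup>*)\<^sup>t\<close> for the unilateral shift \<open>S\<close>; note that
  \<open>S\<^sup>* S = 1 \<noteq> S S\<^sup>*\<close>.\<close>

definition vertex_kernel :: "'a::field_char_0 \<Rightarrow> nat \<Rightarrow> nat \<Rightarrow> 'a" where
  "vertex_kernel t a b = (\<Sum>c\<le>min a b. rising_coeff t (a - c) * rising_coeff (- t) (b - c))"

text \<open>Transposition amounts to negating \<open>t\<close>, so identities for columns also serve
  for rows.\<close>

lemma vertex_kernel_flip: "vertex_kernel (- t) b a = vertex_kernel t a b"
  by (simp add: vertex_kernel_def min.commute mult.commute)

lemma vertex_kernel_Suc_Suc: "vertex_kernel t (Suc a) (Suc b) = rising_coeff t (Suc a) * rising_coeff (- t) (Suc b) + vertex_kernel t a b"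
proof -
  have "vertex_kernel t (Suc a) (Suc b) = (\<Sum>c\<le>Suc (min a b). rising_coeff t (Suc a - c) * rising_coeff (- t) (Suc b - c))"
    by (simp add: vertex_kernel_def)
  also have "\<dots> = rising_coeff t (Suc a) * rising_coeff (- t) (Suc b) + vertex_kernel t a b"
    by (simp add: vertex_kernel_def sum.atMost_Suc_shift del: sum.atMost_Suc)
  finally show ?thesis .
qed

lemma nonint_neq:
  assumes "t \<notin> \<int>"
  shows "of_nat a - of_nat b + t \<noteq> 0" "t - of_nat b \<noteq> 0" "t + of_nat b \<noteq> 0" "t \<noteq> 0"
proof -
  have *: "t + of_int z \<noteq> 0" for z
    using assms by (metis Ints_minus Ints_of_int add_eq_0_iff2)
  show "of_nat a - of_nat b + t \<noteq> 0" using *[of "int a - int b"] by (simp add: add.commute)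
  show "t - of_nat b \<noteq> 0" using *[of "- int b"] by simp
  show "t + of_nat b \<noteq> 0" using *[of "int b"] by simp
  show "t \<noteq> 0" using assms by auto
qed

text \<open>Induction along diagonals, starting from row and column \<open>0\<close>. Up to scaling
  of rows and columns this is a Cauchy matrix; a non-integral \<open>t\<close> keeps its
  denominators nonzero.\<close>

lemma vertex_kernel_closed:
  assumes "t \<notin> \<int>"
  shows "vertex_kernel t a b = t * pochhammer (1 + t) a * pochhammer (1 - t) b /
           (fact a * fact b * (of_nat a - of_nat b + t))"
proof -
  note nz = nonint_neq[OF assms]
  have p1: "pochhammer t (Suc a) = t * pochhammer (1 + t) a" for a
    by (simp add: pochhammer_rec add.commute)
  have p2: "pochhammer (- t) (Suc a) = - t * pochhammer (1 - t) a" for a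
    by (simp add: pochhammer_rec add.commute)
  have a0: "vertex_kernel t a 0 = t * pochhammer (1 + t) a / (fact a * (of_nat a + t))" for a
  proof -
    have "pochhammer t a * (t + of_nat a) = t * pochhammer (1 + t) a"
      by (metis p1 pochhammer_Suc)
    then have "pochhammer t a = t * pochhammer (1 + t) a / (of_nat a + t)"
      using nz(3)[of a] by (simp add: eq_divide_eq add.commute)
    then show ?thesis by (simp add: vertex_kernel_def rising_coeff_def)
  qed
  have b0: "vertex_kernel t 0 b = t * pochhammer (1 - t) b / (fact b * (t - of_nat b))" for b
  proof -
    have "pochhammer (- t) b * (- t + of_nat b) = - t * pochhammer (1 - t) b"
      by (metis p2 pochhammer_Suc)
    then have "pochhammer (- t) b * (t - of_nat b) = t * pochhammer (1 - t) b"
      by (simp add: algebra_simps)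
    then have "pochhammer (- t) b = t * pochhammer (1 - t) b / (t - of_nat b)"
      using nz(2)[of b] by (simp add: eq_divide_eq)
    then show ?thesis by (simp add: vertex_kernel_def rising_coeff_def)
  qed
  show ?thesis
  proof (induction a arbitrary: b)
    case 0
    then show ?case using b0[of b] by (simp add: algebra_simps)
  next
    case (Suc a)
    show ?case
    proof (cases b)
      case 0
      then show ?thesis using a0[of "Suc a"] by simp
    next
      case (Suc b')
      have d: "of_nat a - of_nat b' + t \<noteq> 0" using nz(1) .
      have s: "(1 + of_nat a :: 'a) \<noteq> 0" "(1 + of_nat b' :: 'a) \<noteq> 0"
        by (metis of_nat_Suc of_nat_neq_0)+
      have "vertex_kernel t (Suc a) (Suc b') = t * pochhammer (1 + t) a / fact (Suc a) *
          (- t * pochhammer (1 - t) b' / fact (Suc b')) +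
          t * pochhammer (1 + t) a * pochhammer (1 - t) b' /
           (fact a * fact b' * (of_nat a - of_nat b' + t))"
        by (simp only: vertex_kernel_Suc_Suc Suc.IH rising_coeff_def p1 p2)
      also have "\<dots> = t * pochhammer (1 + t) a * pochhammer (1 - t) b' / (fact (Suc a) * fact (Suc b')) *
          (- t + of_nat (Suc a) * of_nat (Suc b') / (of_nat a - of_nat b' + t))"
        using d s by (simp add: divide_simps) (simp add: algebra_simps)
      \<comment> \<open>After clearing the denominator this is \<open>(a + 1) * (b' + 1) - t * (a -
        b' + t) = (a + 1 + t) * (b' + 1 - t)\<close>.\<close>
      also have "- t + of_nat (Suc a) * of_nat (Suc b') / (of_nat a - of_nat b' + t)
         = (1 + t + of_nat a) * (1 - t + of_nat b') / (of_nat a - of_nat b' + t)"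
        using d by (simp add: divide_simps) (simp add: algebra_simps)
      finally show ?thesis
        by (simp add: Suc pochhammer_Suc)
    qed
  qed
qed

text \<open>The defining sum is cut at \<open>c = k\<close>. The upper part, reindexed by
  \<open>c - k\<close>, is the kernel with its row lowered; the lower part is the boundary defect of
  the unilateral shift.\<close>

lemma vertex_kernel_column_shift:
  "vertex_kernel t a (v + k) = (if k \<le> a then vertex_kernel t (a - k) v else 0) +
     (\<Sum>c<k. if c \<le> a then rising_coeff t (a - c) * rising_coeff (- t) (v + k - c) else 0)"
proof (cases "k \<le> a")
  case True
  then have m: "min a (v + k) = min (a - k) v + k" by auto
  have "{..min (a - k) v + k} = {..<k} \<union> {k..min (a - k) v + k}" by auto
  then have "vertex_kernel t a (v + k) = (\<Sum>c<k. rising_coeff t (a - c) * rising_coeff (- t) (v + k - c)) +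
      (\<Sum>c\<in>{k..min (a - k) v + k}. rising_coeff t (a - c) * rising_coeff (- t) (v + k - c))"
    unfolding vertex_kernel_def m by (simp add: sum.union_disjoint ivl_disj_int)
  also have "(\<Sum>c\<in>{k..min (a - k) v + k}. rising_coeff t (a - c) * rising_coeff (- t) (v + k - c)) = vertex_kernel t (a - k) v"
    unfolding vertex_kernel_def
    by (rule sum.reindex_bij_witness[of _ "\<lambda>c. c + k" "\<lambda>c. c - k"]) auto
  also have "(\<Sum>c<k. rising_coeff t (a - c) * rising_coeff (- t) (v + k - c)) =
     (\<Sum>c<k. if c \<le> a then rising_coeff t (a - c) * rising_coeff (- t) (v + k - c) else 0)"
    using True by (intro sum.cong) auto
  finally show ?thesis using True by simp
next
  case False
  have "(\<Sum>c<k. if c \<le> a then rising_coeff t (a - c) * rising_coeff (- t) (v + k - c) else 0)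
      = (\<Sum>c\<in>{..<k} \<inter> {c. c \<le> a}. rising_coeff t (a - c) * rising_coeff (- t) (v + k - c))"
    by (simp add: sum.If_cases)
  also have "{..<k} \<inter> {c. c \<le> a} = {..min a (v + k)}" using False by auto
  finally show ?thesis using False by (simp add: vertex_kernel_def)
qed

text \<open>The kernel is a lower times an upper triangular Toeplitz matrix. Multiplying on the
  right by the inverse of the upper factor, with entries \<open>rising_coeff t (c - b)\<close>,
  recovers the columns of the lower factor.\<close>

lemma rising_coeff_column_in_span:
  "(if c \<le> a then rising_coeff t (a - c) else 0) = (\<Sum>b\<le>c. rising_coeff t (c - b) * vertex_kernel t a b)"
proof -
  have "(\<Sum>b\<le>c. rising_coeff t (c - b) * vertex_kernel t a b) =
     (\<Sum>b\<le>c. \<Sum>e\<le>c. if e \<le> a \<and> e \<le> b then rising_coeff t (a - e) * (rising_coeff t (c - b) * rising_coeff (- t) (b - e)) else 0)"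
  proof (rule sum.cong)
    fix b assume b: "b \<in> {..c}"
    have "(\<Sum>e\<le>c. if e \<le> a \<and> e \<le> b then rising_coeff t (a - e) * (rising_coeff t (c - b) * rising_coeff (- t) (b - e)) else 0) =
      (\<Sum>e\<in>{..c} \<inter> {e. e \<le> a \<and> e \<le> b}. rising_coeff t (a - e) * (rising_coeff t (c - b) * rising_coeff (- t) (b - e)))"
      by (simp add: sum.If_cases)
    also have "{..c} \<inter> {e. e \<le> a \<and> e \<le> b} = {..min a b}" using b by auto
    finally show "rising_coeff t (c - b) * vertex_kernel t a b = (\<Sum>e\<le>c. if e \<le> a \<and> e \<le> b then rising_coeff t (a - e) * (rising_coeff t (c - b) * rising_coeff (- t) (b - e)) else 0)"
      by (simp add: vertex_kernel_def sum_distrib_left mult_ac)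
  qed simp
  also have "\<dots> = (\<Sum>e\<le>c. \<Sum>b\<le>c. if e \<le> a \<and> e \<le> b then rising_coeff t (a - e) * (rising_coeff t (c - b) * rising_coeff (- t) (b - e)) else 0)"
    by (rule sum.swap)
  also have "\<dots> = (\<Sum>e\<le>c. if e = c then (if c \<le> a then rising_coeff t (a - c) else 0) else 0)"
  proof (rule sum.cong)
    fix e assume e: "e \<in> {..c}"
    show "(\<Sum>b\<le>c. if e \<le> a \<and> e \<le> b then rising_coeff t (a - e) * (rising_coeff t (c - b) * rising_coeff (- t) (b - e)) else 0) =
       (if e = c then (if c \<le> a then rising_coeff t (a - c) else 0) else 0)"
    proof (cases "e \<le> a")
      case True
      have "(\<Sum>b\<le>c. if e \<le> a \<and> e \<le> b then rising_coeff t (a - e) * (rising_coeff t (c - b) * rising_coeff (- t) (b - e)) else 0) =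
        (\<Sum>b\<in>{..c} \<inter> {b. e \<le> b}. rising_coeff t (a - e) * (rising_coeff t (c - b) * rising_coeff (- t) (b - e)))"
        using True by (simp add: sum.If_cases)
      also have "{..c} \<inter> {b. e \<le> b} = {e..c}" by auto
      also have "(\<Sum>b\<in>{e..c}. rising_coeff t (a - e) * (rising_coeff t (c - b) * rising_coeff (- t) (b - e))) =
         rising_coeff t (a - e) * rising_coeff 0 (c - e)"
        using rising_coeff_convolution_shifted[of e c t "- t"] e by (simp flip: sum_distrib_left)
      finally show ?thesis using True e by (auto simp: rising_coeff_zero)
    qed auto
  qed simp
  also have "\<dots> = (if c \<le> a then rising_coeff t (a - c) else 0)" by simp
  finally show ?thesis by simp
qed

text \<open>The coordinates of the boundary defect in the kernel columns
  \<open>0, ..., k - 1\<close>.\<close>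

definition span_coeff :: "'a::field_char_0 \<Rightarrow> nat \<Rightarrow> nat \<Rightarrow> nat \<Rightarrow> 'a" where
  "span_coeff t k v b = (\<Sum>c\<in>{b..<k}. rising_coeff (- t) (v + k - c) * rising_coeff t (c - b))"

lemma vertex_kernel_column_shift':
  "vertex_kernel t a (v + k) = (if k \<le> a then vertex_kernel t (a - k) v else 0) + (\<Sum>b<k. span_coeff t k v b * vertex_kernel t a b)"
proof -
  have "(\<Sum>c<k. if c \<le> a then rising_coeff t (a - c) * rising_coeff (- t) (v + k - c) else 0) =
     (\<Sum>c<k. rising_coeff (- t) (v + k - c) * (\<Sum>b\<le>c. rising_coeff t (c - b) * vertex_kernel t a b))"
    by (intro sum.cong) (auto simp: rising_coeff_column_in_span[symmetric] simp del: rising_coeff_0)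
  also have "\<dots> = (\<Sum>c<k. \<Sum>b<k. if b \<le> c then rising_coeff (- t) (v + k - c) * rising_coeff t (c - b) * vertex_kernel t a b else 0)"
  proof (rule sum.cong)
    fix c assume c: "c \<in> {..<k}"
    then have "{..<k} \<inter> {b. b \<le> c} = {..c}" by auto
    then show "rising_coeff (- t) (v + k - c) * (\<Sum>b\<le>c. rising_coeff t (c - b) * vertex_kernel t a b) =
      (\<Sum>b<k. if b \<le> c then rising_coeff (- t) (v + k - c) * rising_coeff t (c - b) * vertex_kernel t a b else 0)"
      by (simp add: sum.If_cases sum_distrib_left mult_ac)
  qed simp
  also have "\<dots> = (\<Sum>b<k. \<Sum>c<k. if b \<le> c then rising_coeff (- t) (v + k - c) * rising_coeff t (c - b) * vertex_kernel t a b else 0)"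
    by (rule sum.swap)
  also have "\<dots> = (\<Sum>b<k. span_coeff t k v b * vertex_kernel t a b)"
  proof (rule sum.cong)
    fix b
    have "{..<k} \<inter> {c. b \<le> c} = {b..<k}" by auto
    then show "(\<Sum>c<k. if b \<le> c then rising_coeff (- t) (v + k - c) * rising_coeff t (c - b) * vertex_kernel t a b else 0) = span_coeff t k v b * vertex_kernel t a b"
      by (simp add: sum.If_cases span_coeff_def sum_distrib_right)
  qed simp
  finally show ?thesis by (simp add: vertex_kernel_column_shift)
qed

text \<open>This is the coefficient of \<open>x\<^sup>k\<close> in \<open>x f'(x) / f(x) = - t x / (1 - x)\<close> for \<open>f(x) = (1 - x)\<^sup>t\<close>.\<close>

lemma span_coeff_trace:
  assumes "k > 0"
  shows "(\<Sum>b<k. span_coeff t k b b) = - t"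
proof -
  have "(\<Sum>b<k. span_coeff t k b b) = (\<Sum>(b,c)\<in>(SIGMA b:{..<k}. {b..<k}). rising_coeff (- t) (b + k - c) * rising_coeff t (c - b))"
    by (simp add: span_coeff_def sum.Sigma)
  \<comment> \<open>The summand depends only on \<open>d = c - b\<close>, and each \<open>d\<close>
    occurs for \<open>k - d\<close> values of \<open>b\<close>.\<close>
  also have "\<dots> = (\<Sum>(d,b)\<in>(SIGMA d:{..<k}. {..<k-d}). rising_coeff (- t) (k - d) * rising_coeff t d)"
    by (rule sum.reindex_bij_witness[of _ "\<lambda>(d,b). (b, b + d)" "\<lambda>(b,c). (c - b, b)"]) (auto simp: add.commute)
  also have "\<dots> = (\<Sum>d<k. of_nat (k - d) * rising_coeff (- t) (k - d) * rising_coeff t d)"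
    by (simp add: sum.Sigma[symmetric] mult_ac)
  also have "\<dots> = (\<Sum>d<k. - t * (rising_coeff (1 - t) (k - 1 - d) * rising_coeff t d))"
  proof (rule sum.cong)
    fix d assume "d \<in> {..<k}"
    then have "k - d = Suc (k - 1 - d)" by auto
    then have "of_nat (k - d) * rising_coeff (- t) (k - d) = - t * rising_coeff (1 - t) (k - 1 - d)"
      by (metis of_nat_mult_rising_coeff uminus_add_conv_diff)
    then show "of_nat (k - d) * rising_coeff (- t) (k - d) * rising_coeff t d = - t * (rising_coeff (1 - t) (k - 1 - d) * rising_coeff t d)"
      by simp
  qed simp
  also have "\<dots> = - t * (\<Sum>d\<le>k - 1. rising_coeff t d * rising_coeff (1 - t) (k - 1 - d))"
    using assms by (simp add: sum_distrib_left lessThan_Suc_atMost[symmetric] mult_ac)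
  \<comment> \<open>The exponents \<open>t\<close> and \<open>1 - t\<close> add up to
    \<open>1\<close>, and every coefficient of \<open>1 / (1 - x)\<close> is
    \<open>1\<close>.\<close>
  also have "\<dots> = - t"
    using rising_coeff_convolution[of t "1 - t" "k - 1"] by (simp add: rising_coeff_one)
  finally show ?thesis .
qed

section \<open>Determinants of finite arrays\<close>

definition det_fun :: "nat \<Rightarrow> (nat \<Rightarrow> nat \<Rightarrow> 'a::field_char_0) \<Rightarrow> 'a" where
  "det_fun n M = det (mat n n (\<lambda>(i, j). M i j))"

lemma det_fun_cong: "(\<And>i j. i < n \<Longrightarrow> j < n \<Longrightarrow> M i j = M' i j) \<Longrightarrow> det_fun n M = det_fun n M'"
  unfolding det_fun_def by (rule arg_cong[where f = det], rule eq_matI) auto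

lemma permutes_less:
  assumes "p permutes {0..<n}" "i < n"
  shows "p i < (n::nat)"
  using assms permutes_in_image[of p "{0..<n}" i] by simp

lemma det_fun_perm: "det_fun n M = (\<Sum>p | p permutes {0..<n}. signof p * (\<Prod>i = 0..<n. M i (p i)))"
proof -
  have "det_fun n M = (\<Sum>p | p permutes {0..<n}. signof p *
      (\<Prod>i = 0..<n. mat n n (\<lambda>(i, j). M i j) $$ (i, p i)))"
    unfolding det_fun_def by (rule det_def') auto
  also have "\<dots> = (\<Sum>p | p permutes {0..<n}. signof p * (\<Prod>i = 0..<n. M i (p i)))"
    by (intro sum.cong prod.cong refl arg_cong2[of _ _ _ _ "(*)"]) (auto simp: permutes_less)
  finally show ?thesis .
qed

lemma det_fun_transpose: "det_fun n (\<lambda>i j. M j i) = det_fun n M"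
proof -
  have "mat n n (\<lambda>(i, j). M j i) = transpose_mat (mat n n (\<lambda>(i, j). M i j))"
    by (rule eq_matI) auto
  then show ?thesis unfolding det_fun_def by (metis det_transpose mat_carrier)
qed

lemma prod_replace:
  assumes "finite A" "i \<in> A"
  shows "(\<Prod>j\<in>A. if j = i then P j else M j) = (P i :: 'a::comm_ring_1) * (\<Prod>j\<in>A - {i}. M j)"
proof -
  have "(\<Prod>j\<in>A. if j = i then P j else M j) = P i * (\<Prod>j\<in>A - {i}. if j = i then P j else M j)"
    using assms by (subst prod.remove[of _ i]) auto
  also have "(\<Prod>j\<in>A - {i}. if j = i then P j else M j) = (\<Prod>j\<in>A - {i}. M j)"
    by (rule prod.cong) auto
  finally show ?thesis .
qed

lemma det_fun_replace_row:
  assumes "i < n"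
  shows "det_fun n (\<lambda>i' j. if i' = i then P i' j else M i' j) =
     (\<Sum>p | p permutes {0..<n}. signof p * (P i (p i) * (\<Prod>i'\<in>{0..<n} - {i}. M i' (p i'))))"
  unfolding det_fun_perm
proof (rule sum.cong[OF refl])
  fix p
  have "(\<Prod>i'\<in>{0..<n}. if i' = i then P i' (p i') else M i' (p i')) =
      P i (p i) * (\<Prod>i'\<in>{0..<n} - {i}. M i' (p i'))"
    using assms by (intro prod_replace) auto
  then show "signof p * (\<Prod>i'\<in>{0..<n}. if i' = i then P i' (p i') else M i' (p i')) =
      signof p * (P i (p i) * (\<Prod>i'\<in>{0..<n} - {i}. M i' (p i')))"
    by simp
qed

text \<open>In the Leibniz expansion the permutation \<open>p\<close> meets column \<open>j\<close>
  in row \<open>inv_into UNIV p j\<close>, so that is where the replaced entry sits.\<close>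

lemma det_fun_replace_column:
  assumes "j < n"
  shows "det_fun n (\<lambda>i j'. if j' = j then P i j' else M i j') =
     (\<Sum>p | p permutes {0..<n}. signof p *
        (P (inv_into UNIV p j) j * (\<Prod>i\<in>{0..<n} - {inv_into UNIV p j}. M i (p i))))"
  unfolding det_fun_perm
proof (intro sum.cong refl arg_cong2[of _ _ _ _ "(*)"])
  fix p assume "p \<in> {p. p permutes {0..<n}}"
  then have p: "p permutes {0..<n}" by simp
  have eq: "p i = j \<longleftrightarrow> i = inv_into UNIV p j" for i
    using p by (metis permutes_inverses(1) permutes_inverses(2))
  have "inv_into UNIV p j \<in> {0..<n}" using assms p by (simp add: permutes_less permutes_inv)
  then have "(\<Prod>i = 0..<n. if i = inv_into UNIV p j then P i (p i) else M i (p i)) =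
     P (inv_into UNIV p j) (p (inv_into UNIV p j)) * (\<Prod>i\<in>{0..<n} - {inv_into UNIV p j}. M i (p i))"
    by (intro prod_replace) auto
  then show "(\<Prod>i = 0..<n. if p i = j then P i (p i) else M i (p i)) =
     P (inv_into UNIV p j) j * (\<Prod>i\<in>{0..<n} - {inv_into UNIV p j}. M i (p i))"
    using p by (simp add: eq permutes_inverses(1))
qed

text \<open>Both sides are \<open>tr (adj M \<cdot> P)\<close>.\<close>

lemma sum_replace_column_eq_row:
  "(\<Sum>j<n. det_fun n (\<lambda>i j'. if j' = j then P i j' else M i j')) =
   (\<Sum>i<n. det_fun n (\<lambda>i' j. if i' = i then P i' j else M i' j))"
proof -
  have "(\<Sum>j<n. det_fun n (\<lambda>i j'. if j' = j then P i j' else M i j')) =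
     (\<Sum>j<n. \<Sum>p | p permutes {0..<n}. signof p *
        (P (inv_into UNIV p j) j * (\<Prod>i\<in>{0..<n} - {inv_into UNIV p j}. M i (p i))))"
    by (intro sum.cong refl det_fun_replace_column) auto
  also have "\<dots> = (\<Sum>p | p permutes {0..<n}. \<Sum>j<n. signof p *
        (P (inv_into UNIV p j) j * (\<Prod>i\<in>{0..<n} - {inv_into UNIV p j}. M i (p i))))"
    by (rule sum.swap)
  also have "\<dots> = (\<Sum>p | p permutes {0..<n}. \<Sum>i<n. signof p * (P i (p i) * (\<Prod>i'\<in>{0..<n} - {i}. M i' (p i'))))"
  proof (rule sum.cong[OF refl])
    fix p assume "p \<in> {p. p permutes {0..<n}}"
    then have p: "p permutes {..<n}" by (simp add: lessThan_atLeast0)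
    \<comment> \<open>For fixed \<open>p\<close> the substitution \<open>j = p i\<close> turns the
      column sum into the row sum.\<close>
    show "(\<Sum>j<n. signof p * (P (inv_into UNIV p j) j * (\<Prod>i\<in>{0..<n} - {inv_into UNIV p j}. M i (p i)))) =
       (\<Sum>i<n. signof p * (P i (p i) * (\<Prod>i'\<in>{0..<n} - {i}. M i' (p i'))))"
      by (rule sum.reindex_bij_betw[OF permutes_imp_bij[OF p], symmetric, THEN trans])
         (simp add: permutes_inverses[OF p])
  qed
  also have "\<dots> = (\<Sum>i<n. \<Sum>p | p permutes {0..<n}. signof p * (P i (p i) * (\<Prod>i'\<in>{0..<n} - {i}. M i' (p i'))))"
    by (rule sum.swap)
  also have "\<dots> = (\<Sum>i<n. det_fun n (\<lambda>i' j. if i' = i then P i' j else M i' j))"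
    by (intro sum.cong refl det_fun_replace_row[symmetric]) auto
  finally show ?thesis .
qed

lemma det_fun_replace_column_add:
  assumes "j < n"
  shows "det_fun n (\<lambda>i j'. if j' = j then P i j' + Q i j' else M i j') =
     det_fun n (\<lambda>i j'. if j' = j then P i j' else M i j') + det_fun n (\<lambda>i j'. if j' = j then Q i j' else M i j')"
  by (simp add: det_fun_replace_column[OF assms] distrib_left distrib_right sum.distrib)

lemma det_fun_replace_column_sum:
  assumes "j < n"
  shows "det_fun n (\<lambda>i j'. if j' = j then (\<Sum>b\<in>B. c j' b * P b i) else M i j') =
     (\<Sum>b\<in>B. c j b * det_fun n (\<lambda>i j'. if j' = j then P b i else M i j'))"
proof -
  have "(\<Sum>b\<in>B. c j b * det_fun n (\<lambda>i j'. if j' = j then P b i else M i j')) =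
     (\<Sum>b\<in>B. \<Sum>p | p permutes {0..<n}. signof p *
        (c j b * P b (inv_into UNIV p j) * (\<Prod>i\<in>{0..<n} - {inv_into UNIV p j}. M i (p i))))"
    by (simp add: det_fun_replace_column[OF assms] sum_distrib_left mult_ac)
  also have "\<dots> = (\<Sum>p | p permutes {0..<n}. \<Sum>b\<in>B. signof p *
        (c j b * P b (inv_into UNIV p j) * (\<Prod>i\<in>{0..<n} - {inv_into UNIV p j}. M i (p i))))"
    by (rule sum.swap)
  also have "\<dots> = det_fun n (\<lambda>i j'. if j' = j then (\<Sum>b\<in>B. c j' b * P b i) else M i j')"
    by (simp add: det_fun_replace_column[OF assms] sum_distrib_left sum_distrib_right)
  finally show ?thesis by simp
qed

lemma det_fun_identical_columns:
  assumes "a < n" "b < n" "a \<noteq> b" "\<And>i. i < n \<Longrightarrow> M i a = M i b"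
  shows "det_fun n M = 0"
  unfolding det_fun_def
  by (rule det_identical_columns[of _ n a b]) (use assms in \<open>auto intro!: eq_vecI\<close>)

lemma det_fun_permute_rows:
  assumes "p permutes {0..<n}"
  shows "det_fun n (\<lambda>i j. M (p i) j) = signof p * det_fun n M"
proof -
  have "mat n n (\<lambda>(i, j). M (p i) j) = mat n n (\<lambda>(i, j). mat n n (\<lambda>(i, j). M i j) $$ (p i, j))"
    using assms by (intro eq_matI) (auto simp: permutes_less)
  then show ?thesis
    unfolding det_fun_def by (metis assms det_permute_rows mat_carrier)
qed

lemma det_fun_permute_columns:
  assumes "p permutes {0..<n}"
  shows "det_fun n (\<lambda>i j. M i (p j)) = signof p * det_fun n M"
  using det_fun_permute_rows[OF assms, of "\<lambda>i j. M j i"]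
  unfolding det_fun_transpose[of n M] det_fun_transpose[of n "\<lambda>i j. M i (p j)"] .

lemma det_fun_permute_both:
  assumes "p permutes {0..<n}"
  shows "det_fun n (\<lambda>i j. M (p i) (p j)) = det_fun n M"
  using det_fun_permute_rows[OF assms, of "\<lambda>i j. M i (p j)"] det_fun_permute_columns[OF assms, of M]
  by (simp add: sign_def)

lemma det_fun_swap_columns:
  assumes "a < n" "b < n" "a \<noteq> b"
  shows "det_fun n (\<lambda>i j. M i (Transposition.transpose a b j)) = - det_fun n M"
  using det_fun_permute_columns[of "Transposition.transpose a b" n M] assms
  by (simp add: permutes_swap_id sign_swap_id)

section \<open>Shift operators acting on determinants\<close>

text \<open>The operator induced by the kernel on the \<open>n\<close>-th exterior power has these
  entries between wedge products of basis vectors. The tuples need not be sorted.\<close>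

definition vertex_det :: "'a::field_char_0 \<Rightarrow> nat \<Rightarrow> (nat \<Rightarrow> nat) \<Rightarrow> (nat \<Rightarrow> nat) \<Rightarrow> 'a" where
  "vertex_det t n \<beta> \<gamma> = det_fun n (\<lambda>i j. vertex_kernel t (\<beta> i) (\<gamma> j))"

lemma vertex_det_flip: "vertex_det (- t) n \<gamma> \<beta> = vertex_det t n \<beta> \<gamma>"
  unfolding vertex_det_def by (subst det_fun_transpose[symmetric]) (simp add: vertex_kernel_flip)

lemma vertex_det_cong:
  "(\<And>i. i < n \<Longrightarrow> \<beta> i = \<beta>' i) \<Longrightarrow> (\<And>i. i < n \<Longrightarrow> \<gamma> i = \<gamma>' i) \<Longrightarrow> vertex_det t n \<beta> \<gamma> = vertex_det t n \<beta>' \<gamma>'"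
  unfolding vertex_det_def by (intro det_fun_cong) auto

lemma vertex_det_permute:
  assumes "p permutes {0..<n}"
  shows "vertex_det t n (\<beta> \<circ> p) (\<gamma> \<circ> p) = vertex_det t n \<beta> \<gamma>"
  unfolding vertex_det_def using det_fun_permute_both[OF assms, of "\<lambda>i j. vertex_kernel t (\<beta> i) (\<gamma> j)"] by simp

lemma vertex_det_swap:
  assumes "a < n" "b < n" "a \<noteq> b"
  shows "vertex_det t n \<beta> (\<gamma> \<circ> Transposition.transpose a b) = - vertex_det t n \<beta> \<gamma>"
  unfolding vertex_det_def using det_fun_swap_columns[OF assms, of "\<lambda>i j. vertex_kernel t (\<beta> i) (\<gamma> j)"] by simp

lemma vertex_det_repeated:
  assumes "a < n" "b < n" "a \<noteq> b" "\<gamma> a = \<gamma> b"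
  shows "vertex_det t n \<beta> \<gamma> = 0"
  unfolding vertex_det_def using assms by (intro det_fun_identical_columns[of a n b]) auto

lemma vertex_det_not_inj: "\<not> inj_on \<gamma> {..<n} \<Longrightarrow> vertex_det t n \<beta> \<gamma> = 0"
  by (auto simp: inj_on_def intro: vertex_det_repeated)

text \<open>Multilinearity separates shifted rows from boundary terms. Summed over all columns,
  replacement by the array \<open>S\<close> becomes replacement of rows, and a row of
  \<open>S\<close> is a kernel row at a lowered index.\<close>

lemma vertex_det_shift_expansion:
  "(\<Sum>j<n. vertex_det t n \<beta> (\<gamma>(j := \<gamma> j + k))) =
     (\<Sum>i<n. if k \<le> \<beta> i then vertex_det t n (\<beta>(i := \<beta> i - k)) \<gamma> else 0) +
     (\<Sum>j<n. \<Sum>b<k. span_coeff t k (\<gamma> j) b * vertex_det t n \<beta> (\<gamma>(j := b)))"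
proof -
  define S where "S i j = (if k \<le> \<beta> i then vertex_kernel t (\<beta> i - k) (\<gamma> j) else 0)" for i j
  define M where "M i j = vertex_kernel t (\<beta> i) (\<gamma> j)" for i j
  have 1: "vertex_det t n \<beta> (\<gamma>(j := \<gamma> j + k)) = det_fun n (\<lambda>i j'. if j' = j then S i j' else M i j')
     + (\<Sum>b<k. span_coeff t k (\<gamma> j) b * vertex_det t n \<beta> (\<gamma>(j := b)))" if "j < n" for j
  proof -
    have "vertex_det t n \<beta> (\<gamma>(j := \<gamma> j + k)) =
      det_fun n (\<lambda>i j'. if j' = j then S i j' + (\<Sum>b<k. span_coeff t k (\<gamma> j') b * vertex_kernel t (\<beta> i) b) else M i j')"
      unfolding vertex_det_def by (intro det_fun_cong) (auto simp: vertex_kernel_column_shift' S_def M_def)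
    also have "\<dots> = det_fun n (\<lambda>i j'. if j' = j then S i j' else M i j') +
      det_fun n (\<lambda>i j'. if j' = j then (\<Sum>b<k. span_coeff t k (\<gamma> j') b * vertex_kernel t (\<beta> i) b) else M i j')"
      by (rule det_fun_replace_column_add[OF that])
    also have "det_fun n (\<lambda>i j'. if j' = j then (\<Sum>b<k. span_coeff t k (\<gamma> j') b * vertex_kernel t (\<beta> i) b) else M i j') =
      (\<Sum>b<k. span_coeff t k (\<gamma> j) b * det_fun n (\<lambda>i j'. if j' = j then vertex_kernel t (\<beta> i) b else M i j'))"
      by (rule det_fun_replace_column_sum[OF that])
    also have "\<dots> = (\<Sum>b<k. span_coeff t k (\<gamma> j) b * vertex_det t n \<beta> (\<gamma>(j := b)))"
      unfolding vertex_det_def M_def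
      by (intro sum.cong refl arg_cong2[of _ _ _ _ "(*)"] det_fun_cong) auto
    finally show ?thesis .
  qed
  have 2: "det_fun n (\<lambda>i' j. if i' = i then S i' j else M i' j) =
     (if k \<le> \<beta> i then vertex_det t n (\<beta>(i := \<beta> i - k)) \<gamma> else 0)" if "i < n" for i
  proof (cases "k \<le> \<beta> i")
    case True
    then show ?thesis unfolding vertex_det_def by (simp, intro det_fun_cong) (auto simp: S_def M_def)
  next
    case False
    then show ?thesis by (simp add: det_fun_replace_row[OF that] S_def)
  qed
  have "(\<Sum>j<n. vertex_det t n \<beta> (\<gamma>(j := \<gamma> j + k))) =
    (\<Sum>j<n. det_fun n (\<lambda>i j'. if j' = j then S i j' else M i j')) +
    (\<Sum>j<n. \<Sum>b<k. span_coeff t k (\<gamma> j) b * vertex_det t n \<beta> (\<gamma>(j := b)))"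
    by (simp add: 1 sum.distrib)
  also have "(\<Sum>j<n. det_fun n (\<lambda>i j'. if j' = j then S i j' else M i j')) =
    (\<Sum>i<n. det_fun n (\<lambda>i' j. if i' = i then S i' j else M i' j))"
    by (rule sum_replace_column_eq_row)
  also have "\<dots> = (\<Sum>i<n. if k \<le> \<beta> i then vertex_det t n (\<beta>(i := \<beta> i - k)) \<gamma> else 0)"
    by (simp add: 2)
  finally show ?thesis .
qed

text \<open>All values below \<open>k\<close> already occur in \<open>\<gamma>\<close>, so setting
  entry \<open>j\<close> to \<open>b < k\<close> repeats a column unless
  \<open>\<gamma> j = b\<close>. Only diagonal boundary coefficients survive, and they add up to
  \<open>- t\<close>.\<close>

lemma vertex_det_shift_inj:
  assumes "k > 0" "inj_on \<gamma> {..<n}" "{..<k} \<subseteq> \<gamma> ` {..<n}"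
  shows "(\<Sum>j<n. vertex_det t n \<beta> (\<gamma>(j := \<gamma> j + k))) =
     (\<Sum>i<n. if k \<le> \<beta> i then vertex_det t n (\<beta>(i := \<beta> i - k)) \<gamma> else 0) - t * vertex_det t n \<beta> \<gamma>"
proof -
  have "vertex_det t n \<beta> (\<gamma>(j := b)) = (if \<gamma> j = b then vertex_det t n \<beta> \<gamma> else 0)" if "j < n" "b < k" for j b
  proof (cases "\<gamma> j = b")
    case True
    then show ?thesis by (metis fun_upd_triv)
  next
    case False
    have "b \<in> \<gamma> ` {..<n}" using assms(3) that(2) by blast
    then obtain j0 where "j0 < n" "\<gamma> j0 = b" by auto
    then have "vertex_det t n \<beta> (\<gamma>(j := b)) = 0"
      using False that by (intro vertex_det_repeated[of j n j0]) auto
    then show ?thesis using False by simp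
  qed
  then have "(\<Sum>j<n. \<Sum>b<k. span_coeff t k (\<gamma> j) b * vertex_det t n \<beta> (\<gamma>(j := b))) =
     (\<Sum>j<n. \<Sum>b<k. if \<gamma> j = b then span_coeff t k b b * vertex_det t n \<beta> \<gamma> else 0)"
    by (intro sum.cong) auto
  also have "\<dots> = (\<Sum>j<n. if \<gamma> j \<in> {..<k} then span_coeff t k (\<gamma> j) (\<gamma> j) * vertex_det t n \<beta> \<gamma> else 0)"
    by (intro sum.cong) auto
  also have "\<dots> = (\<Sum>b\<in>\<gamma> ` {..<n}. if b \<in> {..<k} then span_coeff t k b b * vertex_det t n \<beta> \<gamma> else 0)"
    by (subst sum.reindex[OF assms(2)]) simp
  also have "\<dots> = (\<Sum>b\<in>\<gamma> ` {..<n} \<inter> {..<k}. span_coeff t k b b * vertex_det t n \<beta> \<gamma>)"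
    by (simp add: sum.If_cases lessThan_def)
  also have "\<gamma> ` {..<n} \<inter> {..<k} = {..<k}" using assms(3) by auto
  also have "(\<Sum>b<k. span_coeff t k b b * vertex_det t n \<beta> \<gamma>) = - t * vertex_det t n \<beta> \<gamma>"
    using span_coeff_trace[OF assms(1), of t] by (simp flip: sum_distrib_right)
  finally show ?thesis unfolding vertex_det_shift_expansion by (simp del: fun_upd_apply)
qed

text \<open>Shifting an entry outside a coinciding pair leaves two equal columns. Shifting one or
  the other member of the pair gives tuples that differ by a transposition, so these two terms
  cancel.\<close>

lemma vertex_det_shift_not_inj:
  assumes "\<not> inj_on \<gamma> {..<n}"
  shows "(\<Sum>j<n. vertex_det t n \<beta> (\<gamma>(j := \<gamma> j + k))) = 0"
proof -
  obtain a b where ab: "a < n" "b < n" "a \<noteq> b" "\<gamma> a = \<gamma> b"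
    using assms by (auto simp: inj_on_def)
  have other: "vertex_det t n \<beta> (\<gamma>(j := \<gamma> j + k)) = 0" if "j \<notin> {a, b}" for j
    using that ab by (intro vertex_det_repeated[of a n b]) auto
  have "(\<gamma>(b := \<gamma> b + k)) = (\<gamma>(a := \<gamma> a + k)) \<circ> Transposition.transpose a b"
    using ab by (auto simp: fun_eq_iff Transposition.transpose_def)
  then have "vertex_det t n \<beta> (\<gamma>(b := \<gamma> b + k)) = - vertex_det t n \<beta> (\<gamma>(a := \<gamma> a + k))"
    using vertex_det_swap[OF ab(1-3), of t \<beta> "\<gamma>(a := \<gamma> a + k)"] by simp
  moreover have "(\<Sum>j<n. vertex_det t n \<beta> (\<gamma>(j := \<gamma> j + k))) = (\<Sum>j\<in>{a, b}. vertex_det t n \<beta> (\<gamma>(j := \<gamma> j + k)))"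
    using ab other by (intro sum.mono_neutral_right) auto
  ultimately show ?thesis using ab(3) by simp
qed

text \<open>Tuples with repeated entries need no condition, since every \<open>vertex_det\<close> term vanishes or
  cancels for them.\<close>

definition stable :: "nat \<Rightarrow> nat \<Rightarrow> (nat \<Rightarrow> nat) \<Rightarrow> bool" where
  "stable n k \<gamma> \<longleftrightarrow> (inj_on \<gamma> {..<n} \<longrightarrow> {..<k} \<subseteq> \<gamma> ` {..<n})"

lemma vertex_det_shift_right:
  assumes "k > 0" "stable n k \<gamma>"
  shows "(\<Sum>j<n. vertex_det t n \<beta> (\<gamma>(j := \<gamma> j + k))) =
     (\<Sum>i<n. if k \<le> \<beta> i then vertex_det t n (\<beta>(i := \<beta> i - k)) \<gamma> else 0) - t * vertex_det t n \<beta> \<gamma>"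
proof (cases "inj_on \<gamma> {..<n}")
  case True
  then show ?thesis using assms vertex_det_shift_inj by (simp add: stable_def)
next
  case False
  then have "vertex_det t n \<beta>' \<gamma> = 0" for \<beta>' by (rule vertex_det_not_inj)
  then show ?thesis using vertex_det_shift_not_inj[OF False] by (simp cong: if_cong)
qed

text \<open>Obtained by transposition, which negates \<open>t\<close>; hence the opposite sign of
  the last term.\<close>

lemma vertex_det_shift_left:
  assumes "k > 0" "stable n k \<beta>"
  shows "(\<Sum>i<n. vertex_det t n (\<beta>(i := \<beta> i + k)) \<gamma>) =
     (\<Sum>j<n. if k \<le> \<gamma> j then vertex_det t n \<beta> (\<gamma>(j := \<gamma> j - k)) else 0) + t * vertex_det t n \<beta> \<gamma>"
  using vertex_det_shift_right[OF assms, of "- t" \<gamma>] by (simp add: vertex_det_flip cong: if_cong)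

text \<open>The reflection \<open>c \<mapsto> s - c\<close> swaps the entries \<open>i\<close> and
  \<open>j\<close>, so the sum equals its own negative.\<close>

lemma vertex_det_pair_antisym:
  assumes "i < n" "j < n" "i \<noteq> j"
  shows "(\<Sum>c\<le>s. vertex_det t n \<beta> (\<gamma>(i := c, j := s - c))) = 0"
proof -
  have "(\<Sum>c\<le>s. vertex_det t n \<beta> (\<gamma>(i := c, j := s - c))) = (\<Sum>c\<le>s. vertex_det t n \<beta> (\<gamma>(i := s - c, j := c)))"
    by (rule sum.reindex_bij_witness[of _ "\<lambda>c. s - c" "\<lambda>c. s - c"]) auto
  also have "\<dots> = (\<Sum>c\<le>s. - vertex_det t n \<beta> (\<gamma>(i := c, j := s - c)))"
  proof (rule sum.cong[OF refl])
    fix c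
    have "(\<gamma>(i := s - c, j := c)) = (\<gamma>(i := c, j := s - c)) \<circ> Transposition.transpose i j"
      using assms by (auto simp: fun_eq_iff Transposition.transpose_def)
    then show "vertex_det t n \<beta> (\<gamma>(i := s - c, j := c)) = - vertex_det t n \<beta> (\<gamma>(i := c, j := s - c))"
      using vertex_det_swap[OF assms, of t \<beta> "\<gamma>(i := c, j := s - c)"] by simp
  qed
  also have "\<dots> = - (\<Sum>c\<le>s. vertex_det t n \<beta> (\<gamma>(i := c, j := s - c)))"
    by (simp add: sum_negf)
  finally show ?thesis by simp
qed

section \<open>The trace recursion\<close>

lemma sum_lessThan_card_le:
  fixes A :: "nat set"
  assumes "finite A"
  shows "\<Sum>{..<card A} \<le> \<Sum>A"
  using assms
proof (induction "card A" arbitrary: A)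
  case 0
  then show ?case by simp
next
  case (Suc m)
  then have "A \<noteq> {}" by auto
  let ?x = "Max A"
  have x: "?x \<in> A" using Suc.prems \<open>A \<noteq> {}\<close> by simp
  have "A \<subseteq> {..?x}" using Suc.prems by auto
  then have "Suc m \<le> Suc ?x" using card_mono[of "{..?x}" A] Suc.hyps(2) by simp
  moreover have "m = card (A - {?x})" using Suc x by simp
  then have "\<Sum>{..<m} \<le> \<Sum>(A - {?x})" using Suc.hyps(1)[of "A - {?x}"] Suc.prems by simp
  moreover have "\<Sum>A = ?x + \<Sum>(A - {?x})" using x Suc.prems by (simp add: sum.remove)
  ultimately show ?case unfolding Suc.hyps(2)[symmetric] by simp
qed

text \<open>Tuples are neither sorted nor required to be injective, so a sum over \<open>levels n (N + \<Sum>{..<n})\<close>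
  counts each partition of \<open>N\<close> into at most \<open>n\<close> parts \<open>n!\<close> times.\<close>

definition levels :: "nat \<Rightarrow> nat \<Rightarrow> (nat \<Rightarrow> nat) set" where
  "levels n S = {\<beta> \<in> {..<n} \<rightarrow>\<^sub>E UNIV. (\<Sum>i<n. \<beta> i) = S}"

lemma finite_levels [simp]: "finite (levels n S)"
proof (rule finite_subset)
  show "levels n S \<subseteq> {..<n} \<rightarrow>\<^sub>E {..S}"
    unfolding levels_def by (auto simp: PiE_def intro!: member_le_sum)
qed (auto intro: finite_PiE)

text \<open>If an injective tuple missed some \<open>v < k\<close>, adjoining \<open>v\<close> would
  give \<open>n + 1\<close> distinct numbers with sum below \<open>\<Sum>{..n}\<close>, the least
  possible.\<close>

lemma stable_levels:
  assumes "\<gamma> \<in> levels n M" "M + k \<le> n + \<Sum>{..<n}"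
  shows "stable n k \<gamma>"
  unfolding stable_def
proof (intro impI subsetI, rule ccontr)
  fix v assume inj: "inj_on \<gamma> {..<n}" and v: "v \<in> {..<k}" "v \<notin> \<gamma> ` {..<n}"
  have "card (insert v (\<gamma> ` {..<n})) = Suc n" using v inj by (simp add: card_image)
  then have "\<Sum>{..<Suc n} \<le> \<Sum>(insert v (\<gamma> ` {..<n}))"
    using sum_lessThan_card_le[of "insert v (\<gamma> ` {..<n})"] by simp
  also have "\<dots> = v + (\<Sum>i<n. \<gamma> i)" using v inj by (simp add: sum.reindex)
  also have "\<dots> = v + M" using assms(1) by (simp add: levels_def)
  finally show False using assms(2) v(1) by simp
qed

lemma sum_levels_shift:
  assumes "i < n"
  shows "(\<Sum>\<beta>\<in>levels n (M + k). if k \<le> \<beta> i then f \<beta> else 0) = (\<Sum>\<gamma>\<in>levels n M. f (\<gamma>(i := \<gamma> i + k)))"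
proof -
  have upd: "(\<Sum>l<n. (\<beta>(i := x)) l) + \<beta> i = (\<Sum>l<n. \<beta> l) + x" for \<beta> :: "nat \<Rightarrow> nat" and x
  proof -
    have "(\<Sum>l<n. (\<beta>(i := x)) l) = x + (\<Sum>l\<in>{..<n} - {i}. \<beta> l)"
      using assms by (subst sum.remove[of _ i]) auto
    moreover have "(\<Sum>l<n. \<beta> l) = \<beta> i + (\<Sum>l\<in>{..<n} - {i}. \<beta> l)"
      using assms by (subst sum.remove[of _ i]) auto
    ultimately show ?thesis by simp
  qed
  have "(\<Sum>\<beta>\<in>levels n (M + k). if k \<le> \<beta> i then f \<beta> else 0) = (\<Sum>\<beta>\<in>levels n (M + k) \<inter> {\<beta>. k \<le> \<beta> i}. f \<beta>)"
    by (simp add: sum.If_cases)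
  also have "\<dots> = (\<Sum>\<gamma>\<in>levels n M. f (\<gamma>(i := \<gamma> i + k)))"
  proof (rule sum.reindex_bij_witness[of _ "\<lambda>\<gamma>. \<gamma>(i := \<gamma> i + k)" "\<lambda>\<beta>. \<beta>(i := \<beta> i - k)"], goal_cases)
    case (2 \<beta>)
    then show ?case using upd[of \<beta> "\<beta> i - k"] assms by (auto simp: levels_def PiE_def extensional_def)
  next
    case (4 \<gamma>)
    then show ?case using upd[of \<gamma> "\<gamma> i + k"] assms by (auto simp: levels_def PiE_def extensional_def)
  qed auto
  finally show ?thesis .
qed

lemma levels_component_le:
  assumes "\<beta> \<in> levels n S" "i < n"
  shows "\<beta> i \<le> S"
  using assms member_le_sum[of i "{..<n}" \<beta>] by (auto simp: levels_def)

text \<open>The trace of the degree \<open>S\<close> block of \<open>W\<close>, each basis vector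
  being counted \<open>n!\<close> times.\<close>

definition trace_level :: "'a::field_char_0 \<Rightarrow> nat \<Rightarrow> nat \<Rightarrow> 'a" where
  "trace_level t n S = (\<Sum>\<beta>\<in>levels n S. vertex_det t n \<beta> \<beta>)"

text \<open>The corresponding trace of \<open>W \<alpha>\<^sub>k\<close>.\<close>

definition trace_lower :: "'a::field_char_0 \<Rightarrow> nat \<Rightarrow> nat \<Rightarrow> nat \<Rightarrow> 'a" where
  "trace_lower t n k S = (\<Sum>\<beta>\<in>levels n S. \<Sum>i<n. if k \<le> \<beta> i then vertex_det t n \<beta> (\<beta>(i := \<beta> i - k)) else 0)"

definition raise_entry :: "nat \<Rightarrow> nat \<Rightarrow> (nat \<Rightarrow> nat) \<Rightarrow> nat \<Rightarrow> nat" where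
  "raise_entry k j \<gamma> = \<gamma>(j := \<gamma> j + k)"

text \<open>The corresponding trace of \<open>W\<close> after lowering by \<open>k\<close> and then
  raising by \<open>k\<close>.\<close>

definition trace_energy :: "'a::field_char_0 \<Rightarrow> nat \<Rightarrow> nat \<Rightarrow> nat \<Rightarrow> 'a" where
  "trace_energy t n k S = (\<Sum>\<beta>\<in>levels n S. \<Sum>i<n. if k \<le> \<beta> i then
      (\<Sum>j<n. vertex_det t n \<beta> (raise_entry k j (\<beta>(i := \<beta> i - k)))) else 0)"

lemma trace_lower_small: "S < k \<Longrightarrow> trace_lower t n k S = 0"
  unfolding trace_lower_def by (intro sum.neutral ballI) (auto dest: levels_component_le)

lemma trace_energy_small: "S < k \<Longrightarrow> trace_energy t n k S = 0"
  unfolding trace_energy_def by (intro sum.neutral ballI) (auto dest: levels_component_le)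

lemma trace_level_small:
  assumes "S < \<Sum>{..<n}"
  shows "trace_level t n S = 0"
  unfolding trace_level_def
proof (intro sum.neutral ballI vertex_det_not_inj notI)
  fix \<beta> assume \<beta>: "\<beta> \<in> levels n S" "inj_on \<beta> {..<n}"
  then have "\<Sum>{..<n} \<le> \<Sum>(\<beta> ` {..<n})"
    using sum_lessThan_card_le[of "\<beta> ` {..<n}"] by (simp add: card_image)
  then show False using \<beta> assms by (simp add: sum.reindex levels_def)
qed

lemma sum_raised_levels:
  "(\<Sum>\<beta>\<in>levels n (M + k). \<Sum>i<n. if k \<le> \<beta> i then f i \<beta> (\<beta>(i := \<beta> i - k)) else 0) =
     (\<Sum>\<gamma>\<in>levels n M. \<Sum>i<n. f i (raise_entry k i \<gamma>) \<gamma>)"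
proof -
  have "(\<Sum>\<beta>\<in>levels n (M + k). \<Sum>i<n. if k \<le> \<beta> i then f i \<beta> (\<beta>(i := \<beta> i - k)) else 0) =
    (\<Sum>i<n. \<Sum>\<beta>\<in>levels n (M + k). if k \<le> \<beta> i then f i \<beta> (\<beta>(i := \<beta> i - k)) else 0)"
    by (rule sum.swap)
  also have "\<dots> = (\<Sum>i<n. \<Sum>\<gamma>\<in>levels n M. f i (raise_entry k i \<gamma>) \<gamma>)"
  proof (rule sum.cong[OF refl])
    fix i assume "i \<in> {..<n}"
    then show "(\<Sum>\<beta>\<in>levels n (M + k). if k \<le> \<beta> i then f i \<beta> (\<beta>(i := \<beta> i - k)) else 0) =
       (\<Sum>\<gamma>\<in>levels n M. f i (raise_entry k i \<gamma>) \<gamma>)"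
      using sum_levels_shift[of i n k "\<lambda>\<beta>. f i \<beta> (\<beta>(i := \<beta> i - k))" M]
      by (simp add: raise_entry_def)
  qed
  also have "\<dots> = (\<Sum>\<gamma>\<in>levels n M. \<Sum>i<n. f i (raise_entry k i \<gamma>) \<gamma>)"
    by (rule sum.swap)
  finally show ?thesis .
qed

text \<open>Cyclicity of the trace: reindexing by the lowered tuple makes the operation a raising of
  the left argument, and \<open>vertex_det_shift_left\<close> carries it back across
  \<open>W\<close> at the price of \<open>t\<close>. The bound on \<open>M + k\<close> provides
  stability.\<close>

lemma trace_lower_rec:
  assumes "k > 0" "M + k \<le> n + \<Sum>{..<n}"
  shows "trace_lower t n k (M + k) = trace_lower t n k M + t * trace_level t n M"
proof -
  have "trace_lower t n k (M + k) = (\<Sum>\<gamma>\<in>levels n M. \<Sum>i<n. vertex_det t n (raise_entry k i \<gamma>) \<gamma>)"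
    unfolding trace_lower_def by (rule sum_raised_levels)
  also have "\<dots> = (\<Sum>\<gamma>\<in>levels n M.
      (\<Sum>j<n. if k \<le> \<gamma> j then vertex_det t n \<gamma> (\<gamma>(j := \<gamma> j - k)) else 0) + t * vertex_det t n \<gamma> \<gamma>)"
    unfolding raise_entry_def
    by (intro sum.cong refl vertex_det_shift_left assms) (use assms in \<open>auto intro: stable_levels\<close>)
  also have "\<dots> = trace_lower t n k M + t * trace_level t n M"
    by (simp add: sum.distrib trace_lower_def trace_level_def sum_distrib_left)
  finally show ?thesis .
qed

text \<open>A stable injective tuple takes each of the values \<open>0, ..., k - 1\<close> exactly
  once. This count is the commutator of lowering and raising by \<open>k\<close>.\<close>

lemma vertex_det_count_small:
  assumes "stable n k \<gamma>"
  shows "(\<Sum>i<n. if \<gamma> i < k then vertex_det t n \<gamma> \<gamma> else 0) = of_nat k * vertex_det t n \<gamma> \<gamma>"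
proof (cases "inj_on \<gamma> {..<n}")
  case True
  have "(\<Sum>i<n. if \<gamma> i < k then vertex_det t n \<gamma> \<gamma> else 0) = (\<Sum>b\<in>\<gamma> ` {..<n}. if b < k then vertex_det t n \<gamma> \<gamma> else 0)"
    by (subst sum.reindex[OF True]) simp
  also have "\<dots> = (\<Sum>b\<in>\<gamma> ` {..<n} \<inter> {..<k}. vertex_det t n \<gamma> \<gamma>)"
    by (simp add: sum.If_cases lessThan_def)
  also have "\<gamma> ` {..<n} \<inter> {..<k} = {..<k}" using assms True by (auto simp: stable_def)
  finally show ?thesis by simp
next
  case False
  then show ?thesis by (simp add: vertex_det_not_inj cong: if_cong)
qed

text \<open>Raising is carried across \<open>W\<close>, which costs the \<open>trace_lower\<close>
  term. After cyclic rotation raising comes before lowering, and restoring the order contributes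
  \<open>k\<close>.\<close>

lemma trace_energy_rec:
  assumes "k > 0" "M + k \<le> n + \<Sum>{..<n}"
  shows "trace_energy t n k (M + k) = trace_energy t n k M + of_nat k * trace_level t n M - t * trace_lower t n k (M + k)"
proof -
  let ?f = "\<lambda>\<beta> i j. if k \<le> \<beta> j then vertex_det t n (\<beta>(j := \<beta> j - k)) (\<beta>(i := \<beta> i - k)) else 0"
  have "trace_energy t n k (M + k) = (\<Sum>\<gamma>\<in>levels n M. \<Sum>i<n. \<Sum>j<n. vertex_det t n (raise_entry k i \<gamma>) (raise_entry k j \<gamma>))"
    unfolding trace_energy_def by (rule sum_raised_levels)
  also have "\<dots> = (\<Sum>\<gamma>\<in>levels n M. \<Sum>i<n.
     (\<Sum>j<n. if k \<le> raise_entry k i \<gamma> j then vertex_det t n ((raise_entry k i \<gamma>)(j := raise_entry k i \<gamma> j - k)) \<gamma> else 0)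
       - t * vertex_det t n (raise_entry k i \<gamma>) \<gamma>)"
    unfolding raise_entry_def[of k _ _]
    by (intro sum.cong refl vertex_det_shift_right assms) (use assms in \<open>auto intro: stable_levels\<close>)
  also have "\<dots> = (\<Sum>\<gamma>\<in>levels n M. \<Sum>i<n.
     (\<Sum>j<n. if k \<le> raise_entry k i \<gamma> j then vertex_det t n ((raise_entry k i \<gamma>)(j := raise_entry k i \<gamma> j - k)) \<gamma> else 0))
       - t * (\<Sum>\<gamma>\<in>levels n M. \<Sum>i<n. vertex_det t n (raise_entry k i \<gamma>) \<gamma>)"
    by (simp add: sum_subtractf sum_distrib_left)
  also have "(\<Sum>\<gamma>\<in>levels n M. \<Sum>i<n. vertex_det t n (raise_entry k i \<gamma>) \<gamma>) = trace_lower t n k (M + k)"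
    unfolding trace_lower_def by (rule sum_raised_levels[symmetric])
  also have "(\<Sum>\<gamma>\<in>levels n M. \<Sum>i<n.
     (\<Sum>j<n. if k \<le> raise_entry k i \<gamma> j then vertex_det t n ((raise_entry k i \<gamma>)(j := raise_entry k i \<gamma> j - k)) \<gamma> else 0)) =
     (\<Sum>\<beta>\<in>levels n (M + k). \<Sum>i<n. if k \<le> \<beta> i then
       (\<Sum>j<n. if k \<le> \<beta> j then vertex_det t n (\<beta>(j := \<beta> j - k)) (\<beta>(i := \<beta> i - k)) else 0) else 0)"
    by (rule sum_raised_levels[symmetric])
  also have "\<dots> = (\<Sum>\<beta>\<in>levels n (M + k). \<Sum>i<n. \<Sum>j<n. if k \<le> \<beta> i then ?f \<beta> i j else 0)"
    by (intro sum.cong refl) simp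
  also have "\<dots> = (\<Sum>\<beta>\<in>levels n (M + k). \<Sum>j<n. \<Sum>i<n. if k \<le> \<beta> i then ?f \<beta> i j else 0)"
    by (intro sum.cong refl sum.swap)
  also have "\<dots> = (\<Sum>\<beta>\<in>levels n (M + k). \<Sum>j<n. if k \<le> \<beta> j then
       (\<Sum>i<n. if k \<le> \<beta> i then vertex_det t n (\<beta>(j := \<beta> j - k)) (\<beta>(i := \<beta> i - k)) else 0) else 0)"
    by (intro sum.cong refl) (auto intro!: sum.cong sum.neutral)
  also have "\<dots> = (\<Sum>\<gamma>\<in>levels n M. \<Sum>j<n.
     (\<Sum>i<n. if k \<le> raise_entry k j \<gamma> i then vertex_det t n \<gamma> ((raise_entry k j \<gamma>)(i := raise_entry k j \<gamma> i - k)) else 0))"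
    by (rule sum_raised_levels)
  \<comment> \<open>At distinct entries raising and lowering commute. At \<open>i = j\<close>
    raising and then lowering is always possible, while lowering first requires
    \<open>k \<le> \<gamma> j\<close>; the difference is counted separately.\<close>
  also have "\<dots> = (\<Sum>\<gamma>\<in>levels n M. \<Sum>j<n. \<Sum>i<n.
     (if k \<le> \<gamma> i then vertex_det t n \<gamma> (raise_entry k j (\<gamma>(i := \<gamma> i - k))) else 0) +
     (if i = j then if \<gamma> j < k then vertex_det t n \<gamma> \<gamma> else 0 else 0))"
  proof (intro sum.cong refl)
    fix \<gamma> i j assume "\<gamma> \<in> levels n M" "i \<in> {..<n}" "j \<in> {..<n}"
    show "(if k \<le> raise_entry k j \<gamma> i then vertex_det t n \<gamma> ((raise_entry k j \<gamma>)(i := raise_entry k j \<gamma> i - k)) else 0) =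
     (if k \<le> \<gamma> i then vertex_det t n \<gamma> (raise_entry k j (\<gamma>(i := \<gamma> i - k))) else 0) +
     (if i = j then if \<gamma> j < k then vertex_det t n \<gamma> \<gamma> else 0 else 0)"
      by (cases "i = j") (auto simp: raise_entry_def fun_upd_twist)
  qed
  also have "\<dots> = (\<Sum>\<gamma>\<in>levels n M. (\<Sum>j<n. \<Sum>i<n.
     (if k \<le> \<gamma> i then vertex_det t n \<gamma> (raise_entry k j (\<gamma>(i := \<gamma> i - k))) else 0)) +
     (\<Sum>j<n. if \<gamma> j < k then vertex_det t n \<gamma> \<gamma> else 0))"
    by (simp add: sum.distrib)
  also have "\<dots> = (\<Sum>\<gamma>\<in>levels n M. (\<Sum>i<n. if k \<le> \<gamma> i then
     (\<Sum>j<n. vertex_det t n \<gamma> (raise_entry k j (\<gamma>(i := \<gamma> i - k)))) else 0) + of_nat k * vertex_det t n \<gamma> \<gamma>)"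
  proof (rule sum.cong[OF refl], rule arg_cong2[of _ _ _ _ "(+)"])
    fix \<gamma> assume g: "\<gamma> \<in> levels n M"
    show "(\<Sum>j<n. if \<gamma> j < k then vertex_det t n \<gamma> \<gamma> else 0) = of_nat k * vertex_det t n \<gamma> \<gamma>"
      by (rule vertex_det_count_small) (rule stable_levels[OF g assms(2)])
    show "(\<Sum>j<n. \<Sum>i<n. (if k \<le> \<gamma> i then vertex_det t n \<gamma> (raise_entry k j (\<gamma>(i := \<gamma> i - k))) else 0)) =
       (\<Sum>i<n. if k \<le> \<gamma> i then (\<Sum>j<n. vertex_det t n \<gamma> (raise_entry k j (\<gamma>(i := \<gamma> i - k)))) else 0)"
      by (subst sum.swap) (auto intro!: sum.cong)
  qed
  also have "\<dots> = trace_energy t n k M + of_nat k * trace_level t n M"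
    by (simp add: sum.distrib trace_energy_def trace_level_def sum_distrib_left)
  finally show ?thesis .
qed

text \<open>The operator \<open>\<Sum>k>0. \<alpha>\<^sub>-\<^sub>k \<alpha>\<^sub>k\<close> is the energy: on a tuple with entries \<open>a\<close>, \<open>b\<close>
  the terms moving an amount between the two run over all \<open>(c, a + b - c)\<close> except \<open>(a, b)\<close> itself,
  and the sum over all of them vanishes by antisymmetry.\<close>

lemma energy_pointwise:
  assumes "\<And>i. i < n \<Longrightarrow> \<beta> i \<le> K"
  shows "(\<Sum>k=1..K. \<Sum>i<n. if k \<le> \<beta> i then (\<Sum>j<n. vertex_det t n \<beta> (raise_entry k j (\<beta>(i := \<beta> i - k)))) else 0) =
     (of_nat (\<Sum>i<n. \<beta> i) - of_nat (\<Sum>{..<n})) * vertex_det t n \<beta> \<beta>"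
proof -
  define G where "G i j = (\<Sum>k=1..K. if k \<le> \<beta> i then vertex_det t n \<beta> (raise_entry k j (\<beta>(i := \<beta> i - k))) else 0)" for i j
  have G: "G i j = (\<Sum>k=1..\<beta> i. vertex_det t n \<beta> (raise_entry k j (\<beta>(i := \<beta> i - k))))" if "i < n" for i j
  proof -
    have "{1..K} \<inter> {k. k \<le> \<beta> i} = {1..\<beta> i}" using assms[OF that] by auto
    then show ?thesis unfolding G_def by (simp add: sum.If_cases)
  qed
  have diag: "G i i = of_nat (\<beta> i) * vertex_det t n \<beta> \<beta>" if "i < n" for i
  proof -
    have "G i i = (\<Sum>k=1..\<beta> i. vertex_det t n \<beta> \<beta>)"
      unfolding G[OF that] by (intro sum.cong refl) (auto simp: raise_entry_def)
    then show ?thesis by simp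
  qed
  have off: "G i j + G j i = - vertex_det t n \<beta> \<beta>" if "i < n" "j < n" "i \<noteq> j" for i j
  proof -
    define s where "s = \<beta> i + \<beta> j"
    let ?h = "\<lambda>c. vertex_det t n \<beta> (\<beta>(i := c, j := s - c))"
    have 1: "G i j = (\<Sum>c\<in>{..<\<beta> i}. ?h c)"
      unfolding G[OF that(1)]
      by (rule sum.reindex_bij_witness[of _ "\<lambda>c. \<beta> i - c" "\<lambda>k. \<beta> i - k"])
         (use that in \<open>auto simp: raise_entry_def s_def fun_upd_twist intro!: arg_cong[where f = "vertex_det t n \<beta>"]\<close>)
    have 2: "G j i = (\<Sum>c\<in>{\<beta> i<..s}. ?h c)"
      unfolding G[OF that(2)]
      by (rule sum.reindex_bij_witness[of _ "\<lambda>c. c - \<beta> i" "\<lambda>k. \<beta> i + k"])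
         (use that in \<open>auto simp: raise_entry_def s_def fun_upd_twist intro!: arg_cong[where f = "vertex_det t n \<beta>"]\<close>)
    have "{..<\<beta> i} \<inter> {\<beta> i<..s} = {}" by auto
    moreover have "{..s} = insert (\<beta> i) ({..<\<beta> i} \<union> {\<beta> i<..s})" by (auto simp: s_def)
    ultimately have "(\<Sum>c\<le>s. ?h c) = ?h (\<beta> i) + (G i j + G j i)"
      unfolding 1 2 by (simp add: sum.union_disjoint)
    moreover have "?h (\<beta> i) = vertex_det t n \<beta> \<beta>" by (simp add: s_def)
    ultimately show ?thesis
      using vertex_det_pair_antisym[OF that, of t \<beta> \<beta> s] by (simp add: eq_neg_iff_add_eq_0 add.commute)
  qed
  have "(\<Sum>k=1..K. \<Sum>i<n. if k \<le> \<beta> i then (\<Sum>j<n. vertex_det t n \<beta> (raise_entry k j (\<beta>(i := \<beta> i - k)))) else 0) =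
     (\<Sum>k=1..K. \<Sum>i<n. \<Sum>j<n. if k \<le> \<beta> i then vertex_det t n \<beta> (raise_entry k j (\<beta>(i := \<beta> i - k))) else 0)"
    by (intro sum.cong refl) simp
  also have "\<dots> = (\<Sum>i<n. \<Sum>j<n. G i j)"
    unfolding G_def by (rule trans[OF sum.swap], rule sum.cong[OF refl], rule sum.swap)
  also have "\<dots> = (\<Sum>i<n. G i i) + (\<Sum>i<n. \<Sum>j<i. G i j + G j i)"
    by (induction n) (simp_all add: sum.distrib algebra_simps)
  also have "(\<Sum>i<n. G i i) = of_nat (\<Sum>i<n. \<beta> i) * vertex_det t n \<beta> \<beta>"
    by (simp add: diag sum_distrib_right)
  \<comment> \<open>There are \<open>\<Sum>{..<n}\<close> pairs \<open>j < i\<close>, so the degree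
    of the ground state \<open>0, ..., n - 1\<close> is what gets subtracted.\<close>
  also have "(\<Sum>i<n. \<Sum>j<i. G i j + G j i) = (\<Sum>i<n. \<Sum>j<i. - vertex_det t n \<beta> \<beta>)"
    by (intro sum.cong refl off) auto
  also have "\<dots> = - of_nat (\<Sum>{..<n}) * vertex_det t n \<beta> \<beta>"
    by (simp add: sum_negf sum_distrib_right)
  finally show ?thesis by (simp add: algebra_simps)
qed

lemma energy_trace:
  assumes "S \<le> K"
  shows "(\<Sum>k=1..K. trace_energy t n k S) = (of_nat S - of_nat (\<Sum>{..<n})) * trace_level t n S"
proof -
  have "(\<Sum>k=1..K. trace_energy t n k S) = (\<Sum>\<beta>\<in>levels n S. \<Sum>k=1..K. \<Sum>i<n. if k \<le> \<beta> i then
      (\<Sum>j<n. vertex_det t n \<beta> (raise_entry k j (\<beta>(i := \<beta> i - k)))) else 0)"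
    unfolding trace_energy_def by (rule sum.swap)
  also have "\<dots> = (\<Sum>\<beta>\<in>levels n S. (of_nat (\<Sum>i<n. \<beta> i) - of_nat (\<Sum>{..<n})) * vertex_det t n \<beta> \<beta>)"
    by (intro sum.cong refl energy_pointwise) (use assms levels_component_le le_trans in blast)
  also have "\<dots> = (of_nat S - of_nat (\<Sum>{..<n})) * trace_level t n S"
    unfolding trace_level_def sum_distrib_left by (intro sum.cong refl) (simp add: levels_def)
  finally show ?thesis .
qed

lemma trace_lower_closed:
  assumes "k > 0" "S \<le> n + \<Sum>{..<n}"
  shows "trace_lower t n k S = t * (\<Sum>m=1..S div k. trace_level t n (S - m * k))"
  using assms(2)
proof (induction S rule: less_induct)
  case (less S)
  show ?case
  proof (cases "S < k")
    case True
    then show ?thesis by (simp add: trace_lower_small)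
  next
    case False
    define M where "M = S - k"
    have S: "S = M + k" using False by (simp add: M_def)
    have d: "S div k = Suc (M div k)" using assms(1) by (simp add: S)
    have "(\<Sum>m=1..S div k. trace_level t n (S - m * k)) = trace_level t n M + (\<Sum>m=1..M div k. trace_level t n (M - m * k))"
      unfolding d
      by (subst sum.atLeast_Suc_atMost, simp, subst sum.shift_bounds_cl_Suc_ivl) (simp add: S)
    moreover have "trace_lower t n k S = trace_lower t n k M + t * trace_level t n M"
      using trace_lower_rec[OF assms(1)] less.prems by (simp add: S)
    moreover have "trace_lower t n k M = t * (\<Sum>m=1..M div k. trace_level t n (M - m * k))"
      using less.prems assms(1) by (intro less.IH) (auto simp: S)
    ultimately show ?thesis by (simp add: algebra_simps)
  qed
qed

text \<open>Unrolling \<open>trace_energy_rec\<close>: the term at \<open>S - m * k\<close> receives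
  \<open>k\<close> once from the commutator, and \<open>- t^2\<close> from each of the
  \<open>m\<close> traces \<open>trace_lower\<close> taken at higher degrees.\<close>

lemma trace_energy_closed:
  assumes "k > 0" "S \<le> n + \<Sum>{..<n}"
  shows "trace_energy t n k S = (\<Sum>m=1..S div k. (of_nat k - t\<^sup>2 * of_nat m) * trace_level t n (S - m * k))"
  using assms(2)
proof (induction S rule: less_induct)
  case (less S)
  show ?case
  proof (cases "S < k")
    case True
    then show ?thesis by (simp add: trace_energy_small)
  next
    case False
    define M where "M = S - k"
    have S: "S = M + k" using False by (simp add: M_def)
    have d: "S div k = Suc (M div k)" using assms(1) by (simp add: S)
    have split: "(\<Sum>m=1..S div k. f m * trace_level t n (S - m * k)) =
        f 1 * trace_level t n M + (\<Sum>m=1..M div k. f (Suc m) * trace_level t n (M - m * k))" for f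
      unfolding d
      by (subst sum.atLeast_Suc_atMost, simp, subst sum.shift_bounds_cl_Suc_ivl) (simp add: S)
    have Y: "trace_lower t n k S = t * (trace_level t n M + (\<Sum>m=1..M div k. trace_level t n (M - m * k)))"
      using trace_lower_closed[OF assms(1) less.prems, of t] split[of "\<lambda>_. 1"] by simp
    have "trace_energy t n k S = trace_energy t n k M + of_nat k * trace_level t n M - t * trace_lower t n k S"
      using trace_energy_rec[OF assms(1)] less.prems by (simp add: S)
    also have "trace_energy t n k M = (\<Sum>m=1..M div k. (of_nat k - t\<^sup>2 * of_nat m) * trace_level t n (M - m * k))"
      using less.prems assms(1) by (intro less.IH) (auto simp: S)
    also have "\<dots> + of_nat k * trace_level t n M - t * trace_lower t n k S =
       (of_nat k - t\<^sup>2) * trace_level t n M +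
       (\<Sum>m=1..M div k. (of_nat k - t\<^sup>2 * of_nat (Suc m)) * trace_level t n (M - m * k))"
      unfolding Y by (simp add: algebra_simps power2_eq_square sum.distrib sum_subtractf sum_distrib_left)
    also have "\<dots> = (\<Sum>m=1..S div k. (of_nat k - t\<^sup>2 * of_nat m) * trace_level t n (S - m * k))"
      unfolding split by simp
    finally show ?thesis .
  qed
qed

text \<open>The total energy acts as the scalar \<open>N\<close> in this degree, so summing the
  closed forms over \<open>k\<close> expresses the trace through lower degrees.\<close>

lemma trace_level_recursion:
  assumes "N \<le> n"
  shows "of_nat N * trace_level t n (N + \<Sum>{..<n}) =
     (1 - t\<^sup>2) * (\<Sum>k=1..N. \<Sum>m=1..N. if k * m \<le> N then of_nat k * trace_level t n (N - k * m + \<Sum>{..<n}) else 0)"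
proof -
  let ?T = "\<Sum>{..<n}"
  define F where "F k m = trace_level t n (N - k * m + ?T)" for k m
  have X: "trace_energy t n k (N + ?T) =
      (\<Sum>m=1..N. if k * m \<le> N then (of_nat k - t\<^sup>2 * of_nat m) * F k m else 0)" if "k > 0" for k
  proof -
    have "trace_energy t n k (N + ?T) = (\<Sum>m=1..(N + ?T) div k. (of_nat k - t\<^sup>2 * of_nat m) * trace_level t n (N + ?T - m * k))"
      by (rule trace_energy_closed) (use that assms in auto)
    also have "\<dots> = (\<Sum>m=1..N + ?T. if k * m \<le> N then (of_nat k - t\<^sup>2 * of_nat m) * F k m else 0)"
    proof (rule sum.mono_neutral_cong_left)
      show "{1..(N + ?T) div k} \<subseteq> {1..N + ?T}" using div_le_dividend le_trans by fastforce
      show "\<forall>i\<in>{1..N + ?T} - {1..(N + ?T) div k}. (if k * i \<le> N then (of_nat k - t\<^sup>2 * of_nat i) * F k i else 0) = 0"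
      proof
        fix i assume "i \<in> {1..N + ?T} - {1..(N + ?T) div k}"
        then have "\<not> i \<le> (N + ?T) div k" by auto
        then have "\<not> i * k \<le> N + ?T" using that by (simp add: less_eq_div_iff_mult_less_eq)
        then show "(if k * i \<le> N then (of_nat k - t\<^sup>2 * of_nat i) * F k i else 0) = 0"
          by (simp add: mult.commute)
      qed
      fix m assume "m \<in> {1..(N + ?T) div k}"
      then have le: "m * k \<le> N + ?T" using that by (auto simp: less_eq_div_iff_mult_less_eq)
      show "(of_nat k - t\<^sup>2 * of_nat m) * trace_level t n (N + ?T - m * k) =
         (if k * m \<le> N then (of_nat k - t\<^sup>2 * of_nat m) * F k m else 0)"
      proof (cases "k * m \<le> N")
        case True
        then show ?thesis by (simp add: F_def mult.commute)
      next
        case False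
        \<comment> \<open>Below the degree of the ground state there are no injective
          tuples.\<close>
        then have "N + ?T - m * k < ?T" using le by (simp add: mult.commute)
        then show ?thesis using False by (simp add: trace_level_small)
      qed
    qed simp
    also have "\<dots> = (\<Sum>m=1..N. if k * m \<le> N then (of_nat k - t\<^sup>2 * of_nat m) * F k m else 0)"
    proof (rule sum.mono_neutral_right)
      show "\<forall>i\<in>{1..N + ?T} - {1..N}. (if k * i \<le> N then (of_nat k - t\<^sup>2 * of_nat i) * F k i else 0) = 0"
      proof
        fix i assume "i \<in> {1..N + ?T} - {1..N}"
        then have "N < i" by auto
        also have "i \<le> k * i" using that by simp
        finally show "(if k * i \<le> N then (of_nat k - t\<^sup>2 * of_nat i) * F k i else 0) = 0" by simp
      qed
    qed auto
    finally show ?thesis .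
  qed
  have "of_nat N * trace_level t n (N + ?T) = (\<Sum>k=1..N + ?T. trace_energy t n k (N + ?T))"
    by (subst energy_trace) auto
  also have "\<dots> = (\<Sum>k=1..N + ?T. \<Sum>m=1..N. if k * m \<le> N then (of_nat k - t\<^sup>2 * of_nat m) * F k m else 0)"
    by (intro sum.cong refl X) auto
  also have "\<dots> = (\<Sum>k=1..N. \<Sum>m=1..N. if k * m \<le> N then (of_nat k - t\<^sup>2 * of_nat m) * F k m else 0)"
  proof (rule sum.mono_neutral_right)
    show "\<forall>k\<in>{1..N + ?T} - {1..N}. (\<Sum>m=1..N. if k * m \<le> N then (of_nat k - t\<^sup>2 * of_nat m) * F k m else 0) = 0"
    proof
      fix k assume "k \<in> {1..N + ?T} - {1..N}"
      then have k: "N < k" by auto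
      have "\<not> k * m \<le> N" if "m \<in> {1..N}" for m
      proof -
        have "k \<le> k * m" using that by simp
        then show ?thesis using k by linarith
      qed
      then show "(\<Sum>m=1..N. if k * m \<le> N then (of_nat k - t\<^sup>2 * of_nat m) * F k m else 0) = 0"
        by (intro sum.neutral) auto
    qed
  qed auto
  also have "\<dots> = (\<Sum>k=1..N. \<Sum>m=1..N. if k * m \<le> N then of_nat k * F k m else 0)
     - t\<^sup>2 * (\<Sum>k=1..N. \<Sum>m=1..N. if k * m \<le> N then of_nat m * F k m else 0)"
    unfolding sum_distrib_left sum_subtractf[symmetric]
    by (intro sum.cong refl) (simp add: algebra_simps)
  \<comment> \<open>Interchanging \<open>k\<close> and \<open>m\<close> preserves
    \<open>k * m\<close>; this turns the weight \<open>k - t^2 * m\<close> into the common factor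
    \<open>1 - t^2\<close>.\<close>
  also have "(\<Sum>k=1..N. \<Sum>m=1..N. if k * m \<le> N then of_nat m * F k m else 0) =
     (\<Sum>k=1..N. \<Sum>m=1..N. if k * m \<le> N then of_nat k * F k m else 0)"
    by (subst sum.swap, intro sum.cong refl) (simp add: F_def mult.commute)
  finally show ?thesis unfolding F_def by (simp add: left_diff_distrib)
qed

section \<open>Cauchy determinants and hook lengths\<close>

lemma det_fun_mult: "det_fun n (\<lambda>i j. \<Sum>k<n. P i k * Q k j) = det_fun n P * det_fun n Q"
proof -
  have "mat n n (\<lambda>(i, j). \<Sum>k<n. P i k * Q k j) = mat n n (\<lambda>(i, j). P i j) * mat n n (\<lambda>(i, j). Q i j)"
    by (rule eq_matI) (auto simp: scalar_prod_def lessThan_atLeast0)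
  then show ?thesis unfolding det_fun_def by (simp add: det_mult[of _ n])
qed

lemma det_fun_upper_triangular:
  assumes "\<And>i j. j < i \<Longrightarrow> i < n \<Longrightarrow> L i j = 0"
  shows "det_fun n L = (\<Prod>i<n. L i i)"
proof -
  have "det (mat n n (\<lambda>(i, j). L i j)) = prod_list (diag_mat (mat n n (\<lambda>(i, j). L i j)))"
    by (rule det_upper_triangular) (use assms in \<open>auto simp: upper_triangular_def\<close>)
  also have "\<dots> = (\<Prod>i<n. L i i)"
    by (simp add: prod_list_diag_prod lessThan_atLeast0)
  finally show ?thesis by (simp add: det_fun_def)
qed

lemma det_fun_last_column:
  assumes "\<And>i. i < n \<Longrightarrow> M i n = 0"
  shows "det_fun (Suc n) M = M n n * det_fun n M"
proof -
  let ?A = "mat (Suc n) (Suc n) (\<lambda>(i, j). M i j)"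
  have "mat_delete ?A n n = mat n n (\<lambda>(i, j). M i j)"
    unfolding mat_delete_def by (rule eq_matI) auto
  then have cof: "cofactor ?A n n = det_fun n M" by (simp add: cofactor_def det_fun_def)
  have "det_fun (Suc n) M = (\<Sum>i<Suc n. ?A $$ (i, n) * cofactor ?A i n)"
    unfolding det_fun_def by (rule laplace_expansion_column) auto
  also have "\<dots> = M n n * det_fun n M" using assms by (simp add: cof)
  finally show ?thesis .
qed

text \<open>Left multiplication by the unipotent matrix \<open>L\<close> clears the last column
  above its bottom entry.\<close>

lemma det_fun_Schur_complement:
  assumes "M n n \<noteq> 0"
  shows "det_fun (Suc n) M = M n n * det_fun n (\<lambda>i j. M i j - M i n * M n j / M n n)"
proof -
  define L where "L i j = (if i = j then 1 else if j = n then - (M i n / M n n) else 0)" for i j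
  have "det_fun (Suc n) L = 1"
    by (subst det_fun_upper_triangular) (auto simp: L_def)
  then have "det_fun (Suc n) M = det_fun (Suc n) L * det_fun (Suc n) M" by simp
  also have "\<dots> = det_fun (Suc n) (\<lambda>i j. \<Sum>k<Suc n. L i k * M k j)" by (rule det_fun_mult[symmetric])
  also have "\<dots> = det_fun (Suc n) (\<lambda>i j. if i < n then M i j - M i n * M n j / M n n else M i j)"
  proof (rule det_fun_cong)
    fix i j assume "i < Suc n" "j < Suc n"
    show "(\<Sum>k<Suc n. L i k * M k j) = (if i < n then M i j - M i n * M n j / M n n else M i j)"
    proof (cases "i < n")
      case True
      have "(\<Sum>k<n. L i k * M k j) = (\<Sum>k<n. if i = k then M i j else 0)"
        using True by (intro sum.cong) (auto simp: L_def)
      then show ?thesis using True by (simp add: L_def)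
    next
      case False
      then have "i = n" using \<open>i < Suc n\<close> by simp
      moreover have "(\<Sum>k<n. L n k * M k j) = 0" by (intro sum.neutral) (auto simp: L_def)
      ultimately show ?thesis by (simp add: L_def)
    qed
  qed
  also have "\<dots> = M n n * det_fun n (\<lambda>i j. if i < n then M i j - M i n * M n j / M n n else M i j)"
    using assms by (subst det_fun_last_column) auto
  also have "det_fun n (\<lambda>i j. if i < n then M i j - M i n * M n j / M n n else M i j) =
      det_fun n (\<lambda>i j. M i j - M i n * M n j / M n n)"
    by (intro det_fun_cong) auto
  finally show ?thesis .
qed

lemma det_fun_scale: "det_fun n (\<lambda>i j. r i * M i j * s j) = (\<Prod>i<n. r i) * (\<Prod>j<n. s j) * det_fun n M"
proof -
  have "(\<Prod>i = 0..<n. r i * M i (p i) * s (p i)) =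
     (\<Prod>i<n. r i) * (\<Prod>j<n. s j) * (\<Prod>i = 0..<n. M i (p i))" if "p permutes {0..<n}" for p
  proof -
    have "(\<Prod>i = 0..<n. s (p i)) = (\<Prod>i = 0..<n. s i)"
      by (rule prod.reindex_bij_betw[OF permutes_imp_bij[OF that]])
    then show ?thesis by (simp add: prod.distrib lessThan_atLeast0)
  qed
  then show ?thesis
    unfolding det_fun_perm by (simp add: sum_distrib_left mult.left_commute cong: sum.cong_simp)
qed

text \<open>The Schur complement of the last entry is the smaller Cauchy matrix with rescaled rows
  and columns. The pivot \<open>1 / t\<close> cancels one factor \<open>t\<close>, and the scalings
  pair up to the new factors \<open>?f i n\<close>.\<close>

lemma Cauchy_determinant_diagonal:
  fixes b :: "nat \<Rightarrow> 'a::field_char_0"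
  assumes "\<And>i j. b i - b j + t \<noteq> 0"
  shows "t ^ n * det_fun n (\<lambda>i j. 1 / (b i - b j + t)) =
     (\<Prod>i<n. \<Prod>j\<in>{i<..<n}. (b i - b j)\<^sup>2 / ((b i - b j)\<^sup>2 - t\<^sup>2))"
proof (induction n)
  case 0
  then show ?case by (simp add: det_fun_def)
next
  case (Suc n)
  let ?C = "\<lambda>i j. 1 / (b i - b j + t)"
  let ?f = "\<lambda>i j. (b i - b j)\<^sup>2 / ((b i - b j)\<^sup>2 - t\<^sup>2)"
  let ?r = "\<lambda>i. (b i - b n) / (b i - b n + t)"
  let ?s = "\<lambda>j. (b n - b j) / (b n - b j + t)"
  have t: "t \<noteq> 0" using assms[of 0 0] by simp
  have rs: "?C i j - ?C i n * ?C n j / ?C n n = ?r i * ?C i j * ?s j" for i j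
  proof -
    have "(b i - b n + t) * (b n - b j + t) - t * (b i - b j + t) = (b i - b n) * (b n - b j)"
      by (simp add: algebra_simps)
    moreover have "?C i j - ?C i n * ?C n j / ?C n n =
      ((b i - b n + t) * (b n - b j + t) - t * (b i - b j + t)) /
         ((b i - b j + t) * (b i - b n + t) * (b n - b j + t))"
    proof -
      have "1 / u - 1 / v * (1 / w) / (1 / t) = (v * w - t * u) / (u * v * w)"
        if "u \<noteq> 0" "v \<noteq> 0" "w \<noteq> 0" for u v w :: 'a
        using that by (simp add: divide_simps)
      from this[OF assms[of i j] assms[of i n] assms[of n j]] show ?thesis by simp
    qed
    ultimately show ?thesis by (simp add: mult_ac)
  qed
  have f: "?r i * ?s i = ?f i n" for i
  proof -
    have "(b i - b n) * (b n - b i) = - ((b i - b n)\<^sup>2)"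
      "(b i - b n + t) * (b n - b i + t) = - ((b i - b n)\<^sup>2 - t\<^sup>2)"
      by (simp_all add: algebra_simps power2_eq_square)
    then show ?thesis by (simp only: times_divide_times_eq minus_divide_divide)
  qed
  have "t ^ Suc n * det_fun (Suc n) ?C = t ^ n * det_fun n (\<lambda>i j. ?C i j - ?C i n * ?C n j / ?C n n)"
    using t by (subst det_fun_Schur_complement) auto
  also have "\<dots> = t ^ n * ((\<Prod>i<n. ?r i) * (\<Prod>i<n. ?s i) * det_fun n ?C)"
    unfolding rs det_fun_scale ..
  also have "\<dots> = (\<Prod>i<n. ?r i * ?s i) * (t ^ n * det_fun n ?C)"
    unfolding prod.distrib by (simp only: mult_ac)
  also have "\<dots> = (\<Prod>i<n. ?f i n) * (\<Prod>i<n. \<Prod>j\<in>{i<..<n}. ?f i j)"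
    unfolding f Suc.IH ..
  also have "\<dots> = (\<Prod>i<n. \<Prod>j\<in>{i<..<Suc n}. ?f i j)"
    unfolding prod.distrib[symmetric]
  proof (rule prod.cong[OF refl])
    fix i assume "i \<in> {..<n}"
    then have "{i<..<Suc n} = insert n {i<..<n}" by auto
    then show "?f i n * (\<Prod>j\<in>{i<..<n}. ?f i j) = (\<Prod>j\<in>{i<..<Suc n}. ?f i j)" by simp
  qed
  also have "\<dots> = (\<Prod>i<Suc n. \<Prod>j\<in>{i<..<Suc n}. ?f i j)"
  proof -
    have "{n<..<Suc n} = {}" by auto
    then show ?thesis by simp
  qed
  finally show ?case .
qed

definition hook_weight :: "'a::field_char_0 \<Rightarrow> int \<Rightarrow> 'a" where
  "hook_weight t h = 1 - t\<^sup>2 / (of_int h)\<^sup>2"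

lemma pochhammer_mult_pochhammer:
  "pochhammer (1 + t) a * pochhammer (1 - t) a / (fact a)\<^sup>2 = (\<Prod>k=1..a. hook_weight t (int k))"
proof (induction a)
  case 0
  then show ?case by simp
next
  case (Suc a)
  have nz: "(of_nat (Suc a) :: 'a) \<noteq> 0" by (simp del: of_nat_Suc)
  have "pochhammer (1 + t) (Suc a) * pochhammer (1 - t) (Suc a) / (fact (Suc a))\<^sup>2 =
     (pochhammer (1 + t) a * pochhammer (1 - t) a / (fact a)\<^sup>2) *
     ((of_nat (Suc a) + t) * (of_nat (Suc a) - t) / (of_nat (Suc a))\<^sup>2)"
  proof -
    have eqs: "1 + t + of_nat a = of_nat (Suc a) + t" "1 - t + of_nat a = of_nat (Suc a) - t"
      by simp_all
    show ?thesis
      by (simp add: pochhammer_Suc power_mult_distrib eqs mult_ac del: of_nat_Suc)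
  qed
  also have "(of_nat (Suc a) + t) * (of_nat (Suc a) - t) / (of_nat (Suc a))\<^sup>2 = hook_weight t (int (Suc a))"
    using nz by (simp add: hook_weight_def divide_simps del: of_nat_Suc) (simp add: algebra_simps power2_eq_square)
  finally show ?case by (simp add: Suc.IH)
qed

text \<open>The row and column factors of the closed kernel give the weights over
  \<open>{1..\<beta> i}\<close>. What remains is a Cauchy determinant, whose factors are the inverse
  weights at the differences of the entries.\<close>

lemma vertex_det_diagonal:
  fixes t :: "'a::field_char_0"
  assumes "t \<notin> \<int>" "inj_on \<beta> {..<n}"
  shows "vertex_det t n \<beta> \<beta> * (\<Prod>i<n. \<Prod>j\<in>{i<..<n}. hook_weight t (int (\<beta> i) - int (\<beta> j))) =
     (\<Prod>i<n. \<Prod>k=1..\<beta> i. hook_weight t (int k))"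
proof -
  note nz = nonint_neq[OF assms(1)]
  define b where "b i = (of_nat (\<beta> i) :: 'a)" for i
  let ?r = "\<lambda>i. t * pochhammer (1 + t) (\<beta> i) / fact (\<beta> i)"
  let ?s = "\<lambda>j. pochhammer (1 - t) (\<beta> j) / fact (\<beta> j)"
  let ?C = "\<lambda>i j. 1 / (b i - b j + t)"
  let ?f = "\<lambda>i j. (b i - b j)\<^sup>2 / ((b i - b j)\<^sup>2 - t\<^sup>2)"
  have inv: "?f i j * hook_weight t (int (\<beta> i) - int (\<beta> j)) = 1" if "i < n" "j \<in> {i<..<n}" for i j
  proof -
    have "\<beta> i \<noteq> \<beta> j" using inj_onD[OF assms(2), of i j] that by auto
    then have "b i - b j \<noteq> 0" by (simp add: b_def)
    moreover have "(b i - b j)\<^sup>2 - t\<^sup>2 \<noteq> 0"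
    proof -
      have "(b i - b j)\<^sup>2 - t\<^sup>2 = - ((b i - b j + t) * (b j - b i + t))"
        by (simp add: algebra_simps power2_eq_square)
      then show ?thesis using nz(1) by (simp add: b_def)
    qed
    ultimately show ?thesis by (simp add: hook_weight_def b_def divide_simps)
  qed
  have "vertex_det t n \<beta> \<beta> = det_fun n (\<lambda>i j. ?r i * ?C i j * ?s j)"
    unfolding vertex_det_def vertex_kernel_closed[OF assms(1)] b_def by (simp add: mult_ac)
  also have "\<dots> = (\<Prod>i<n. ?r i) * (\<Prod>j<n. ?s j) * det_fun n ?C"
    by (rule det_fun_scale)
  also have "\<dots> = (\<Prod>i<n. pochhammer (1 + t) (\<beta> i) * pochhammer (1 - t) (\<beta> i) / (fact (\<beta> i))\<^sup>2) * (t ^ n * det_fun n ?C)"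
    by (simp add: prod.distrib prod_dividef power2_eq_square)
  also have "\<dots> = (\<Prod>i<n. \<Prod>k=1..\<beta> i. hook_weight t (int k)) * (\<Prod>i<n. \<Prod>j\<in>{i<..<n}. ?f i j)"
    unfolding pochhammer_mult_pochhammer by (subst Cauchy_determinant_diagonal) (use nz(1) in \<open>auto simp: b_def\<close>)
  finally have "vertex_det t n \<beta> \<beta> * (\<Prod>i<n. \<Prod>j\<in>{i<..<n}. hook_weight t (int (\<beta> i) - int (\<beta> j))) =
     (\<Prod>i<n. \<Prod>k=1..\<beta> i. hook_weight t (int k)) * (\<Prod>i<n. \<Prod>j\<in>{i<..<n}. ?f i j * hook_weight t (int (\<beta> i) - int (\<beta> j)))"
    by (simp only: prod.distrib mult.assoc)
  also have "(\<Prod>i<n. \<Prod>j\<in>{i<..<n}. ?f i j * hook_weight t (int (\<beta> i) - int (\<beta> j))) = 1"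
    by (intro prod.neutral ballI, rule inv) auto
  finally show ?thesis by simp
qed

section \<open>Beta numbers and hook lengths of a partition\<close>

definition padded :: "nat list \<Rightarrow> nat \<Rightarrow> nat" where
  "padded xs i = (if i < length xs then xs ! i else 0)"

text \<open>When \<open>n\<close> is the number of parts these are the hook lengths of the first
  column. The subtraction is exact for \<open>i < n\<close>.\<close>

definition beta_number :: "nat \<Rightarrow> nat list \<Rightarrow> nat \<Rightarrow> nat" where
  "beta_number n xs i = padded xs i + (n - 1 - i)"

lemma padded_antimono:
  assumes "sorted_wrt (\<ge>) xs" "i \<le> j"
  shows "padded xs j \<le> padded xs i"
  using assms by (cases "i = j") (auto simp: padded_def sorted_wrt_iff_nth_less)

lemma beta_number_strict_antimono:
  assumes "sorted_wrt (\<ge>) xs" "i < j" "j < n"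
  shows "beta_number n xs j < beta_number n xs i"
  using padded_antimono[OF assms(1), of i j] assms(2,3) by (auto simp: beta_number_def)

lemma inj_beta_number:
  assumes "sorted_wrt (\<ge>) xs"
  shows "inj_on (beta_number n xs) {..<n}"
  by (rule inj_onI, rule ccontr)
     (metis beta_number_strict_antimono[OF assms] lessThan_iff less_irrefl linorder_neqE_nat)

lemma young_diagram_eq: "young_diagram xs = {(i, j). 1 \<le> i \<and> 1 \<le> j \<and> j \<le> padded xs (i - 1)}"
  by (auto simp: young_diagram_def padded_def split: if_splits)

lemma down_closed_eq_lessThan:
  fixes A :: "nat set"
  assumes "finite A" "\<And>i j. i \<le> j \<Longrightarrow> j \<in> A \<Longrightarrow> i \<in> A"
  shows "A = {..<card A}"
proof (cases "A = {}")
  case False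
  then have "Max A \<in> A" using assms(1) by simp
  then have "A = {..Max A}" using assms by auto
  then have "A = {..<Suc (Max A)}" by (simp add: lessThan_Suc_atMost)
  then show ?thesis by (metis card_lessThan)
qed auto

text \<open>As the parts decrease weakly, column \<open>j\<close> occupies an initial segment of the
  rows. Here \<open>i\<close> starts at \<open>0\<close>, hence the strict inequality.\<close>

lemma column_length_iff:
  assumes "sorted_wrt (\<ge>) xs" "1 \<le> j"
  shows "j \<le> padded xs i \<longleftrightarrow> i < column_length xs j"
proof -
  let ?A = "{i. j \<le> padded xs i}"
  have "?A \<subseteq> {..<length xs}" using assms(2) by (auto simp: padded_def split: if_splits)
  then have "finite ?A" by (rule finite_subset) simp
  then have eq: "?A = {..<card ?A}"
    by (rule down_closed_eq_lessThan) (use padded_antimono[OF assms(1)] le_trans in blast)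
  have "{i. (i, j) \<in> young_diagram xs} = Suc ` ?A"
  proof (intro Set.set_eqI iffI)
    fix i assume "i \<in> {i. (i, j) \<in> young_diagram xs}"
    then have "1 \<le> i" "j \<le> padded xs (i - 1)" by (auto simp: young_diagram_eq)
    then show "i \<in> Suc ` ?A" by (intro image_eqI[of _ _ "i - 1"]) auto
  qed (use assms(2) in \<open>auto simp: young_diagram_eq\<close>)
  then have "column_length xs j = card ?A" by (simp add: column_length_def card_image)
  then show ?thesis using eq by auto
qed

lemma column_length_antimono:
  assumes "sorted_wrt (\<ge>) xs" "1 \<le> j" "j \<le> j'"
  shows "column_length xs j' \<le> column_length xs j"
proof (rule ccontr)
  assume "\<not> ?thesis"
  then have "j' \<le> padded xs (column_length xs j)"
    using column_length_iff[OF assms(1), of j'] assms by simp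
  then have "j \<le> padded xs (column_length xs j)" using assms by simp
  then show False using column_length_iff[OF assms(1,2)] by blast
qed

lemma column_length_le:
  assumes "sorted_wrt (\<ge>) xs" "1 \<le> j"
  shows "column_length xs j \<le> length xs"
proof (rule ccontr)
  assume "\<not> ?thesis"
  then have "j \<le> padded xs (length xs)" using column_length_iff[OF assms] by simp
  then show False using assms(2) by (simp add: padded_def)
qed

text \<open>The hook lengths of row \<open>i\<close> and the differences \<open>\<beta> i - \<beta> j\<close> for \<open>j > i\<close>
  partition \<open>{1..\<beta> i}\<close>.\<close>

lemma row_hooks_beta_number:
  assumes xs: "sorted_wrt (\<ge>) xs" and len: "length xs \<le> n" and i: "i < n"
  shows "(\<Prod>j=1..padded xs i. f (hook_length xs (Suc i, j))) *
      (\<Prod>j\<in>{i<..<n}. f (int (beta_number n xs i) - int (beta_number n xs j))) =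
     (\<Prod>k=1..beta_number n xs i. (f (int k) :: 'a::comm_monoid_mult))"
proof -
  let ?h = "\<lambda>j. hook_length xs (Suc i, j)"
  let ?d = "\<lambda>j. int (beta_number n xs i) - int (beta_number n xs j)"
  have h: "?h j = int (padded xs i) - int i + int (column_length xs j) - int j"
    if "1 \<le> j" "j \<le> padded xs i" for j
  proof -
    have "i < length xs" using that by (auto simp: padded_def split: if_splits)
    then show ?thesis by (simp add: hook_length_def padded_def)
  qed
  have b: "int (beta_number n xs l) = int (padded xs l) + int n - 1 - int l" if "l < n" for l
    using that by (simp add: beta_number_def)
  have A: "?h ` {1..padded xs i} \<subseteq> {1..int (beta_number n xs i)}"
  proof clarify
    fix j assume "j \<in> {1..padded xs i}"
    then have j: "1 \<le> j" "j \<le> padded xs i" by auto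
    then have "i < column_length xs j" using column_length_iff[OF xs] by simp
    moreover have "column_length xs j \<le> n" using column_length_le[OF xs j(1)] len by simp
    ultimately show "?h j \<in> {1..int (beta_number n xs i)}" using j b[OF i] by (simp add: h)
  qed
  have B: "?d ` {i<..<n} \<subseteq> {1..int (beta_number n xs i)}"
    using beta_number_strict_antimono[OF xs] by fastforce
  have injA: "inj_on ?h {1..padded xs i}"
  proof (rule inj_onI, rule ccontr)
    fix j j' assume j: "j \<in> {1..padded xs i}" "j' \<in> {1..padded xs i}" "?h j = ?h j'" "j \<noteq> j'"
    have False if "j < j'" "j \<in> {1..padded xs i}" "j' \<in> {1..padded xs i}" "?h j = ?h j'" for j j'
      using column_length_antimono[OF xs, of j j'] that by (simp add: h)
    then show False using j by (metis linorder_neqE_nat)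
  qed
  have injB: "inj_on ?d {i<..<n}"
  proof (rule inj_onI, rule ccontr)
    fix j j' assume "j \<in> {i<..<n}" "j' \<in> {i<..<n}" "?d j = ?d j'" "j \<noteq> j'"
    then show False
      using beta_number_strict_antimono[OF xs, of j j' n] beta_number_strict_antimono[OF xs, of j' j n]
      by (cases j j' rule: linorder_cases) auto
  qed
  have disj: "?h ` {1..padded xs i} \<inter> ?d ` {i<..<n} = {}"
  proof (rule ccontr)
    assume "?h ` {1..padded xs i} \<inter> ?d ` {i<..<n} \<noteq> {}"
    then obtain j l where j: "1 \<le> j" "j \<le> padded xs i" and l: "i < l" "l < n" and eq: "?h j = ?d l"
      by auto
    \<comment> \<open>Impossible in both cases: if \<open>j \<le> padded xs l\<close>, then column
      \<open>j\<close> is longer than \<open>l\<close> and the left side is larger; otherwise it is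
      smaller.\<close>
    from eq have eq': "int (column_length xs j) - int j = int l - int (padded xs l)"
      using j b[OF i] b[OF l(2)] by (simp add: h)
    show False
      using column_length_iff[OF xs j(1), of l] eq' by (cases "j \<le> padded xs l") auto
  qed
  \<comment> \<open>Two disjoint subsets of \<open>{1..\<beta> i}\<close> whose sizes add up to
    \<open>\<beta> i\<close> must fill it.\<close>
  have "card (?h ` {1..padded xs i} \<union> ?d ` {i<..<n}) = padded xs i + (n - 1 - i)"
    using disj card_image[OF injA] card_image[OF injB] by (simp add: card_Un_disjoint)
  then have un: "?h ` {1..padded xs i} \<union> ?d ` {i<..<n} = {1..int (beta_number n xs i)}"
    using A B by (intro card_subset_eq) (auto simp: beta_number_def)
  have "(\<Prod>k=1..beta_number n xs i. f (int k)) = prod f {1..int (beta_number n xs i)}"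
    by (rule prod.reindex_bij_witness[of _ nat int]) auto
  also have "\<dots> = prod f (?h ` {1..padded xs i}) * prod f (?d ` {i<..<n})"
    unfolding un[symmetric] by (rule prod.union_disjoint) (use disj in auto)
  also have "prod f (?h ` {1..padded xs i}) = (\<Prod>j=1..padded xs i. f (?h j))"
    by (rule prod.reindex[OF injA, unfolded comp_def])
  also have "prod f (?d ` {i<..<n}) = (\<Prod>j\<in>{i<..<n}. f (?d j))"
    by (rule prod.reindex[OF injB, unfolded comp_def])
  finally show ?thesis by simp
qed

lemma prod_hook_lengths:
  assumes "length xs \<le> n"
  shows "(\<Prod>h\<in>#hook_lengths xs. f h) = (\<Prod>i<n. \<Prod>j=1..padded xs i. (f (hook_length xs (Suc i, j)) :: 'a::comm_monoid_mult))"
proof -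
  have eq: "young_diagram xs = (\<lambda>(i, j). (Suc i, j)) ` (SIGMA i:{..<n}. {1..padded xs i})"
  proof (intro Set.set_eqI iffI; clarify?)
    fix i j assume "(i, j) \<in> young_diagram xs"
    then have "1 \<le> i" "1 \<le> j" "j \<le> padded xs (i - 1)" by (auto simp: young_diagram_eq)
    moreover have "i - 1 < n" using calculation assms by (auto simp: padded_def split: if_splits)
    ultimately show "(i, j) \<in> (\<lambda>(i, j). (Suc i, j)) ` (SIGMA i:{..<n}. {1..padded xs i})"
      by (intro image_eqI[of _ _ "(i - 1, j)"]) auto
  qed (auto simp: young_diagram_eq)
  have "(\<Prod>h\<in>#hook_lengths xs. f h) = (\<Prod>b\<in>young_diagram xs. f (hook_length xs b))"
    by (simp add: hook_lengths_def prod_unfold_prod_mset image_mset.compositionality comp_def)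
  also have "\<dots> = (\<Prod>(i,j)\<in>(SIGMA i:{..<n}. {1..padded xs i}). f (hook_length xs (Suc i, j)))"
    unfolding eq by (subst prod.reindex) (auto simp: inj_on_def case_prod_unfold)
  also have "\<dots> = (\<Prod>i<n. \<Prod>j=1..padded xs i. f (hook_length xs (Suc i, j)))"
    by (simp add: prod.Sigma)
  finally show ?thesis .
qed

text \<open>Splitting \<open>{1..\<beta> i}\<close> in every row into hooks and differences exhibits
  the factor \<open>?D\<close> on both sides; it cancels because no weight vanishes for a
  non-integral \<open>t\<close>.\<close>

lemma vertex_det_eq_hook_product:
  fixes t :: "'a::field_char_0"
  assumes t: "t \<notin> \<int>" and xs: "sorted_wrt (\<ge>) xs" and len: "length xs \<le> n"
  shows "vertex_det t n (beta_number n xs) (beta_number n xs) = (\<Prod>h\<in>#hook_lengths xs. hook_weight t h)"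
proof -
  let ?D = "\<Prod>i<n. \<Prod>j\<in>{i<..<n}. hook_weight t (int (beta_number n xs i) - int (beta_number n xs j))"
  have nz: "hook_weight t h \<noteq> 0" for h
  proof
    assume "hook_weight t h = 0"
    \<comment> \<open>At \<open>h = 0\<close> division by zero makes the weight
      \<open>1\<close>.\<close>
    then have "h \<noteq> 0" by (auto simp: hook_weight_def)
    then have "t\<^sup>2 = (of_int h)\<^sup>2" using \<open>hook_weight t h = 0\<close> by (simp add: hook_weight_def field_simps)
    then have "t = of_int h \<or> t = of_int (- h)" by (simp add: power2_eq_iff)
    then show False using t Ints_of_int by blast
  qed
  have "vertex_det t n (beta_number n xs) (beta_number n xs) * ?D = (\<Prod>i<n. \<Prod>k=1..beta_number n xs i. hook_weight t (int k))"
    by (rule vertex_det_diagonal[OF t inj_beta_number[OF xs]])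
  also have "\<dots> = (\<Prod>i<n. (\<Prod>j=1..padded xs i. hook_weight t (hook_length xs (Suc i, j))) *
      (\<Prod>j\<in>{i<..<n}. hook_weight t (int (beta_number n xs i) - int (beta_number n xs j))))"
    by (intro prod.cong refl row_hooks_beta_number[OF xs len, symmetric]) auto
  also have "\<dots> = (\<Prod>h\<in>#hook_lengths xs. hook_weight t h) * ?D"
    by (simp add: prod.distrib prod_hook_lengths[OF len])
  finally show ?thesis by (simp add: nz)
qed

section \<open>Summation over partitions\<close>

definition hook_sum :: "'a::field_char_0 \<Rightarrow> nat \<Rightarrow> 'a" where
  "hook_sum t N = (\<Sum>xs\<in>partitions_of (int N). \<Prod>h\<in>#hook_lengths xs. hook_weight t h)"

lemma partitions_of_length_le:
  assumes "xs \<in> partitions_of (int N)"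
  shows "length xs \<le> N"
proof -
  have "sum_list (map (\<lambda>_. 1) xs) \<le> sum_list (map (\<lambda>x. x) xs)"
    using assms by (intro sum_list_mono) (auto simp: partitions_of_def Suc_le_eq)
  then show ?thesis using assms by (simp add: partitions_of_def sum_list_triv)
qed

lemma finite_partitions_of [simp]: "finite (partitions_of z)"
proof (cases "z < 0")
  case True
  then have "partitions_of z = {}" by (auto simp: partitions_of_def)
  then show ?thesis by simp
next
  case False
  then obtain N where z: "z = int N" by (metis nonneg_int_cases not_less)
  have "partitions_of z \<subseteq> {xs. set xs \<subseteq> {..N} \<and> length xs \<le> N}"
  proof
    fix xs assume xs: "xs \<in> partitions_of z"
    then have "x \<le> N" if "x \<in> set xs" for x
      using member_le_sum_list[OF that] by (simp add: z partitions_of_def)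
    then show "xs \<in> {xs. set xs \<subseteq> {..N} \<and> length xs \<le> N}"
      using partitions_of_length_le xs z by auto
  qed
  then show ?thesis by (rule finite_subset) (simp add: finite_lists_length_le)
qed

lemma sum_beta_number:
  assumes "xs \<in> partitions_of (int N)" "length xs \<le> n"
  shows "(\<Sum>i<n. beta_number n xs i) = N + \<Sum>{..<n}"
proof -
  have "(\<Sum>i<n. padded xs i) = (\<Sum>i<length xs. xs ! i)"
    by (rule sum.mono_neutral_cong_right) (use assms(2) in \<open>auto simp: padded_def\<close>)
  moreover have "sum_list xs = N" using assms(1) by (simp add: partitions_of_def)
  ultimately have "(\<Sum>i<n. padded xs i) = N"
    by (simp add: sum_list_sum_nth lessThan_atLeast0)
  moreover have "(\<Sum>i<n. n - 1 - i) = \<Sum>{..<n}"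
    using sum.nat_diff_reindex[of "\<lambda>i. i" n] by simp
  ultimately show ?thesis unfolding beta_number_def sum.distrib by simp
qed

text \<open>The increasing enumeration of a finite set is unique, and reversal carries this over to
  decreasing ones.\<close>

lemma strict_antimono_unique:
  fixes f g :: "nat \<Rightarrow> nat"
  assumes "\<And>i j. i < j \<Longrightarrow> j < n \<Longrightarrow> f j < f i" "\<And>i j. i < j \<Longrightarrow> j < n \<Longrightarrow> g j < g i"
    and "f ` {..<n} = g ` {..<n}" "i < n"
  shows "f i = g i"
proof -
  have srt: "sorted (rev (map h [0..<n])) \<and> distinct (rev (map h [0..<n]))"
    if "\<And>i j. i < j \<Longrightarrow> j < n \<Longrightarrow> h j < h i" for h :: "nat \<Rightarrow> nat"
  proof -
    have "sorted_wrt (<) (rev (map h [0..<n]))"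
      unfolding sorted_wrt_rev using that by (simp add: sorted_wrt_iff_nth_less)
    then show ?thesis by (simp add: strict_sorted_iff)
  qed
  have "rev (map f [0..<n]) = rev (map g [0..<n])"
    using srt[of f] srt[of g] assms
    by (intro sorted_distinct_set_unique) (auto simp: lessThan_atLeast0)
  then show ?thesis using assms(4) by (simp add: map_eq_conv)
qed

lemma partition_eq_if_padded_eq:
  assumes "\<And>i. padded xs i = padded ys i" "\<forall>s\<in>set xs. 0 < s" "\<forall>s\<in>set ys. 0 < s"
  shows "xs = ys"
proof -
  have pos: "i < length zs \<longleftrightarrow> padded zs i > 0" if "\<forall>s\<in>set zs. 0 < s" for i zs
    using that by (auto simp: padded_def split: if_splits)
  have "length xs = length ys"
    using pos[OF assms(2)] pos[OF assms(3)] assms(1) by (metis linorder_neqE_nat less_irrefl)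
  then show ?thesis
  proof (rule nth_equalityI)
    fix i assume "i < length xs"
    then show "xs ! i = ys ! i" using assms(1)[of i] \<open>length xs = length ys\<close> by (simp add: padded_def)
  qed
qed

text \<open>Sorting the values decreasingly and subtracting the staircase
  \<open>n - 1, ..., 0\<close> gives the partition; \<open>p\<close> records the sorting.\<close>

lemma inj_tuple_decomposition:
  assumes \<beta>: "\<beta> \<in> levels n (N + \<Sum>{..<n})" "inj_on \<beta> {..<n}"
  obtains xs p where "xs \<in> partitions_of (int N)" "p permutes {..<n}" "length xs \<le> n"
    "\<And>i. i < n \<Longrightarrow> \<beta> i = beta_number n xs (p i)"
proof -
  define A where "A = \<beta> ` {..<n}"
  define L where "L = sorted_list_of_set A"
  have cA: "card A = n" "finite A" using \<beta>(2) by (simp_all add: A_def card_image)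
  have L: "length L = n" "set L = A" "sorted_wrt (<) L"
    using cA by (auto simp: L_def)
  define b where "b i = L ! (n - 1 - i)" for i
  have bdec: "b j < b i" if "i < j" "j < n" for i j
    using L that by (auto simp: b_def sorted_wrt_iff_nth_less)
  have bimg: "b ` {..<n} = A"
  proof -
    have "b ` {..<n} = (!) L ` {..<n}"
    proof (intro Set.set_eqI iffI)
      fix y assume "y \<in> (!) L ` {..<n}"
      then obtain i where "i < n" "y = L ! i" by auto
      then show "y \<in> b ` {..<n}" by (intro image_eqI[of _ _ "n - 1 - i"]) (auto simp: b_def)
    qed (auto simp: b_def)
    also have "\<dots> = set L" using L(1) by (auto simp: set_conv_nth)
    finally show ?thesis using L(2) by simp
  qed
  have binj: "inj_on b {..<n}"
    by (rule inj_onI, rule ccontr) (metis bdec lessThan_iff less_irrefl linorder_neqE_nat)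
  define p where "p i = (if i < n then inv_into {..<n} b (\<beta> i) else i)" for i
  have pb: "p i < n \<and> b (p i) = \<beta> i" if "i < n" for i
  proof -
    have "\<beta> i \<in> b ` {..<n}" using that unfolding bimg A_def by auto
    then show ?thesis using f_inv_into_f[of "\<beta> i" b "{..<n}"] inv_into_into[of "\<beta> i" b "{..<n}"] that
      by (simp add: p_def)
  qed
  have p: "p permutes {..<n}"
  proof (rule bij_imp_permutes)
    have "inj_on p {..<n}"
      by (rule inj_onI) (metis \<beta>(2) inj_onD pb lessThan_iff)
    then show "bij_betw p {..<n} {..<n}"
      using pb endo_inj_surj[of "{..<n}" p] by (auto simp: bij_betw_def)
  qed (simp add: p_def)
  define x where "x i = b i - (n - 1 - i)" for i
  \<comment> \<open>Counted from \<open>0\<close>, the \<open>m\<close>-th smallest of distinct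
    natural numbers is at least \<open>m\<close>; hence the truncated subtraction in
    \<open>x\<close> is exact.\<close>
  have low: "n - 1 - i \<le> b i" if "i < n" for i
  proof -
    have "m \<le> L ! m" if "m < n" for m
      using that
    proof (induction m)
      case (Suc m)
      then have "L ! m < L ! Suc m" using L by (auto simp: sorted_wrt_iff_nth_less)
      then show ?case using Suc by simp
    qed simp
    then show ?thesis using that by (simp add: b_def)
  qed
  have xb: "b i = x i + (n - 1 - i)" if "i < n" for i using low[OF that] by (simp add: x_def)
  have xdec: "x j \<le> x i" if "i \<le> j" "j < n" for i j
    using that
  proof (induction j)
    case (Suc j)
    show ?case
    proof (cases "i = Suc j")
      case False
      then have "x j \<le> x i" using Suc by simp
      moreover have "b (Suc j) < b j" using bdec Suc.prems by simp
      then have "x (Suc j) \<le> x j" using xb[of j] xb[of "Suc j"] Suc.prems by simp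
      ultimately show ?thesis by simp
    qed simp
  qed simp
  \<comment> \<open>The positive values of the weakly decreasing \<open>x\<close> sit on an initial
    segment; cutting there drops the trailing zeros.\<close>
  define P where "P = {i. i < n \<and> 0 < x i}"
  have "P = {..<card P}"
    by (rule down_closed_eq_lessThan) (auto simp: P_def intro: less_le_trans[OF _ xdec])
  then obtain l where l: "P = {..<l}" by blast
  have ln: "l \<le> n"
  proof (rule ccontr)
    assume "\<not> l \<le> n"
    then have "n \<in> P" using l by simp
    then show False by (simp add: P_def)
  qed
  define xs where "xs = map x [0..<l]"
  have pad: "padded xs i = x i" if "i < n" for i
  proof (cases "i < l")
    case True
    then show ?thesis by (simp add: padded_def xs_def)
  next
    case False
    then have "i \<notin> P" using l by simp
    then show ?thesis using False that by (simp add: padded_def xs_def P_def)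
  qed
  have xsl: "length xs \<le> n" using ln by (simp add: xs_def)
  have beta_number: "beta_number n xs i = b i" if "i < n" for i
    using pad[OF that] xb[OF that] by (simp add: beta_number_def)
  have srt: "sorted_wrt (\<ge>) xs"
    using xdec ln by (auto simp: xs_def sorted_wrt_iff_nth_less)
  have pos: "\<forall>s\<in>set xs. 0 < s"
  proof
    fix s assume "s \<in> set xs"
    then obtain i where "i < l" "s = x i" by (auto simp: xs_def)
    moreover from this have "i \<in> P" using l by simp
    ultimately show "0 < s" by (simp add: P_def)
  qed
  have "xs \<in> partitions_of (int (sum_list xs))" using srt pos by (simp add: partitions_of_def)
  then have "(\<Sum>i<n. beta_number n xs i) = sum_list xs + \<Sum>{..<n}" using xsl by (rule sum_beta_number)
  also have "(\<Sum>i<n. beta_number n xs i) = (\<Sum>i<n. b i)" by (simp add: beta_number)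
  also have "\<dots> = \<Sum>A" using binj bimg by (metis sum.reindex_cong)
  also have "\<dots> = (\<Sum>i<n. \<beta> i)" unfolding A_def using \<beta>(2) by (simp add: sum.reindex)
  also have "\<dots> = N + \<Sum>{..<n}" using \<beta>(1) by (simp add: levels_def)
  finally have "sum_list xs = N" by simp
  with srt pos have "xs \<in> partitions_of (int N)" by (simp add: partitions_of_def)
  then show ?thesis using p xsl
    by (rule that) (use pb beta_number in force)
qed

text \<open>Injective tuples correspond to pairs of a partition and a permutation, and the diagonal
  determinant does not depend on the permutation. By \<open>N \<le> n\<close> every partition of
  \<open>N\<close> has at most \<open>n\<close> parts.\<close>

lemma trace_level_eq_hook_sum:
  fixes t :: "'a::field_char_0"
  assumes t: "t \<notin> \<int>" and n: "N \<le> n"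
  shows "trace_level t n (N + \<Sum>{..<n}) = fact n * hook_sum t N"
proof -
  let ?S = "N + \<Sum>{..<n}"
  let ?P = "partitions_of (int N)"
  let ?Q = "{p. p permutes {..<n}}"
  let ?g = "\<lambda>(xs, p). restrict (beta_number n xs \<circ> p) {..<n}"
  have len: "length xs \<le> n" if "xs \<in> ?P" for xs
    using partitions_of_length_le[OF that] n by simp
  have srt: "sorted_wrt (\<ge>) xs" if "xs \<in> ?P" for xs
    using that by (simp add: partitions_of_def)
  have "trace_level t n ?S = (\<Sum>\<beta>\<in>{\<beta> \<in> levels n ?S. inj_on \<beta> {..<n}}. vertex_det t n \<beta> \<beta>)"
    unfolding trace_level_def by (rule sum.mono_neutral_right) (auto simp: vertex_det_not_inj)
  also have "\<dots> = (\<Sum>(xs, p)\<in>?P \<times> ?Q. vertex_det t n (beta_number n xs) (beta_number n xs))"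
  proof (rule sum.reindex_bij_betw[of ?g, symmetric, THEN trans])
    show "bij_betw ?g (?P \<times> ?Q) {\<beta> \<in> levels n ?S. inj_on \<beta> {..<n}}"
      unfolding bij_betw_def
    proof (intro conjI)
      show "inj_on ?g (?P \<times> ?Q)"
      proof (rule inj_onI, clarify)
        fix xs p ys q
        assume xs: "xs \<in> ?P" "ys \<in> ?P" and p: "p permutes {..<n}" "q permutes {..<n}"
          and eq: "restrict (beta_number n xs \<circ> p) {..<n} = restrict (beta_number n ys \<circ> q) {..<n}"
        have eq': "beta_number n xs (p i) = beta_number n ys (q i)" if "i < n" for i
          using fun_cong[OF eq, of i] that by simp
        have "beta_number n xs ` {..<n} = beta_number n ys ` {..<n}"
        proof -
          have "beta_number n xs ` {..<n} = beta_number n xs ` (p ` {..<n})" using permutes_image[OF p(1)] by simp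
          also have "\<dots> = beta_number n ys ` (q ` {..<n})" using eq' by (auto simp: image_image)
          finally show ?thesis using permutes_image[OF p(2)] by simp
        qed
        then have b: "beta_number n xs i = beta_number n ys i" if "i < n" for i
          using that beta_number_strict_antimono[OF srt] xs
          by (intro strict_antimono_unique[of n "beta_number n xs" "beta_number n ys"]) auto
        have "padded xs i = padded ys i" for i
        proof (cases "i < n")
          case True
          then show ?thesis using b[OF True] by (simp add: beta_number_def)
        next
          case False
          then show ?thesis using len[OF xs(1)] len[OF xs(2)] by (simp add: padded_def)
        qed
        then have "xs = ys"
          by (rule partition_eq_if_padded_eq) (use xs in \<open>auto simp: partitions_of_def\<close>)
        moreover have "p i = q i" for i
        proof (cases "i < n")
          case True
          then have "p i < n" "q i < n" using p by (simp_all add: permutes_less lessThan_atLeast0)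
          then show ?thesis
            using inj_onD[OF inj_beta_number[OF srt[OF xs(1)], of n], of "p i" "q i"] eq'[OF True] \<open>xs = ys\<close> by simp
        next
          case False
          then show ?thesis using p by (metis lessThan_iff permutes_not_in)
        qed
        ultimately show "xs = ys \<and> p = q" by auto
      qed
      show "?g ` (?P \<times> ?Q) = {\<beta> \<in> levels n ?S. inj_on \<beta> {..<n}}"
      proof (rule subset_antisym; rule subsetI)
        fix \<beta> assume "\<beta> \<in> ?g ` (?P \<times> ?Q)"
        then obtain xs p where xs: "xs \<in> ?P" and p: "p permutes {..<n}"
          and b: "\<beta> = restrict (beta_number n xs \<circ> p) {..<n}" by auto
        have "(\<Sum>i<n. beta_number n xs (p i)) = ?S"
          using sum.reindex_bij_betw[OF permutes_imp_bij[OF p], of "beta_number n xs"] sum_beta_number[OF xs len[OF xs]]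
          by simp
        moreover have "inj_on (beta_number n xs \<circ> p) {..<n}"
          using inj_beta_number[OF srt[OF xs], of n] p
          by (intro comp_inj_on) (auto simp: permutes_image intro: permutes_inj_on)
        ultimately show "\<beta> \<in> {\<beta> \<in> levels n ?S. inj_on \<beta> {..<n}}"
          unfolding b by (auto simp: levels_def inj_on_def)
      next
        fix \<beta> assume b: "\<beta> \<in> {\<beta> \<in> levels n ?S. inj_on \<beta> {..<n}}"
        then obtain xs p where xs: "xs \<in> ?P" "p permutes {..<n}"
          and eq: "\<And>i. i < n \<Longrightarrow> \<beta> i = beta_number n xs (p i)"
          using inj_tuple_decomposition[of \<beta> n N] by blast
        have "\<beta> = ?g (xs, p)"
        proof
          fix i
          show "\<beta> i = ?g (xs, p) i"
            using b eq by (cases "i < n") (auto simp: levels_def PiE_def extensional_def)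
        qed
        then show "\<beta> \<in> ?g ` (?P \<times> ?Q)" using xs by blast
      qed
    qed
    have "vertex_det t n (?g (xs, p)) (?g (xs, p)) = vertex_det t n (beta_number n xs) (beta_number n xs)" if "p permutes {..<n}" for xs p
    proof -
      have "vertex_det t n (?g (xs, p)) (?g (xs, p)) = vertex_det t n (beta_number n xs \<circ> p) (beta_number n xs \<circ> p)"
        by (rule vertex_det_cong) auto
      then show ?thesis using vertex_det_permute[of p n] that by (simp add: lessThan_atLeast0)
    qed
    then show "(\<Sum>x\<in>?P \<times> ?Q. vertex_det t n (?g x) (?g x)) = (\<Sum>(xs, p)\<in>?P \<times> ?Q. vertex_det t n (beta_number n xs) (beta_number n xs))"
      by (intro sum.cong) auto
  qed
  also have "\<dots> = (\<Sum>xs\<in>?P. \<Sum>p\<in>?Q. vertex_det t n (beta_number n xs) (beta_number n xs))"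
    by (rule sum.cartesian_product[symmetric])
  also have "\<dots> = (\<Sum>xs\<in>?P. fact n * (\<Prod>h\<in>#hook_lengths xs. hook_weight t h))"
  proof (rule sum.cong[OF refl])
    fix xs assume "xs \<in> ?P"
    then show "(\<Sum>p\<in>?Q. vertex_det t n (beta_number n xs) (beta_number n xs)) = fact n * (\<Prod>h\<in>#hook_lengths xs. hook_weight t h)"
      using vertex_det_eq_hook_product[OF t srt len] by (simp add: card_permutations)
  qed
  finally show ?thesis by (simp add: hook_sum_def sum_distrib_left)
qed

text \<open>The logarithmic derivative of the Nekrasov-Okounkov formula
  \<open>\<Sum>\<^sub>N hook_sum t N x\<^sup>N = \<Prod>\<^sub>k (1 - x\<^sup>k)\<^bsup>t\<^sup>2 - 1\<^esup>\<close>.\<close>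

lemma hook_sum_recursion:
  fixes t :: "'a::field_char_0"
  assumes "t \<notin> \<int>"
  shows "of_nat N * hook_sum t N =
    (1 - t\<^sup>2) * (\<Sum>k=1..N. \<Sum>m=1..N. if k * m \<le> N then of_nat k * hook_sum t (N - k * m) else 0)"
proof -
  \<comment> \<open>The tuples have \<open>N\<close> entries, enough for all partitions of numbers
    up to \<open>N\<close>.\<close>
  have "fact N * (of_nat N * hook_sum t N) = of_nat N * trace_level t N (N + \<Sum>{..<N})"
    by (simp add: trace_level_eq_hook_sum[OF assms])
  also have "\<dots> = (1 - t\<^sup>2) * (\<Sum>k=1..N. \<Sum>m=1..N. if k * m \<le> N then of_nat k * trace_level t N (N - k * m + \<Sum>{..<N}) else 0)"
    by (rule trace_level_recursion) simp
  also have "(\<Sum>k=1..N. \<Sum>m=1..N. if k * m \<le> N then of_nat k * trace_level t N (N - k * m + \<Sum>{..<N}) else 0) =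
    (\<Sum>k=1..N. \<Sum>m=1..N. fact N * (if k * m \<le> N then of_nat k * hook_sum t (N - k * m) else 0))"
  proof (intro sum.cong refl)
    fix k m
    have "trace_level t N (N - k * m + \<Sum>{..<N}) = fact N * hook_sum t (N - k * m)"
      by (rule trace_level_eq_hook_sum[OF assms]) simp
    then show "(if k * m \<le> N then of_nat k * trace_level t N (N - k * m + \<Sum>{..<N}) else 0) =
        fact N * (if k * m \<le> N then of_nat k * hook_sum t (N - k * m) else 0)"
      by (cases "k * m \<le> N") (simp_all only: if_True if_False mult_zero_right mult.left_commute)
  qed
  finally have "fact N * (of_nat N * hook_sum t N) = fact N *
     ((1 - t\<^sup>2) * (\<Sum>k=1..N. \<Sum>m=1..N. if k * m \<le> N then of_nat k * hook_sum t (N - k * m) else 0))"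
    by (simp add: sum_distrib_left mult.left_commute)
  then show ?thesis by simp
qed

section \<open>Powers of the Euler product\<close>

definition geometric :: "nat \<Rightarrow> 'a::field_char_0 fps" where
  "geometric k = inverse (1 - fps_X ^ k)"

lemma geometric_mult: "k > 0 \<Longrightarrow> (1 - fps_X ^ k) * geometric k = 1"
  unfolding geometric_def by (rule inverse_mult_eq_1') simp

lemma geometric_mult_eqI:
  assumes "k > 0" "(1 - fps_X ^ k) * f = g"
  shows "f = geometric k * g"
proof -
  have "geometric k * g = ((1 - fps_X ^ k) * geometric k) * f" by (simp add: assms(2)[symmetric] mult_ac)
  then show ?thesis by (simp add: geometric_mult[OF assms(1)])
qed

lemma one_minus_X_power_mult_nth:
  "fps_nth ((1 - fps_X ^ k) * f) i = fps_nth f i - (if i < k then 0 else fps_nth (f :: 'a::comm_ring_1 fps) (i - k))"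
  by (simp add: left_diff_distrib fps_X_power_mult_nth)

lemma dvd_cases_step:
  assumes "(k::nat) > 0"
  obtains "i < k" "k dvd i \<longleftrightarrow> i = 0" "i div k = 0"
  | "\<not> i < k" "k dvd i \<longleftrightarrow> k dvd (i - k)" "i div k = Suc ((i - k) div k)"
proof (cases "i < k")
  case True
  then have "k dvd i \<longleftrightarrow> i = 0" using nat_dvd_not_less[of i k] by auto
  then show ?thesis using True that(1) by simp
next
  case False
  then show ?thesis using assms that(2) by (simp add: dvd_minus_self le_div_geq)
qed

text \<open>Multiplication by \<open>1 - fps_X ^ k\<close> takes \<open>C\<close> to
  \<open>B\<close>, \<open>B\<close> to \<open>A\<close> and \<open>A\<close> to \<open>1\<close>,
  so these are the first three powers of the geometric series.\<close>

lemma geometric_power_nth: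
  assumes k: "k > 0"
  shows "fps_nth (geometric k :: 'a::field_char_0 fps) i = (if k dvd i then 1 else 0)"
    and "fps_nth (geometric k ^ 3 :: 'a fps) i = (if k dvd i then of_nat ((2 + i div k) choose 2) else 0)"
proof -
  define A where "A = (Abs_fps (\<lambda>i. if k dvd i then 1 else 0) :: 'a fps)"
  define B where "B = (Abs_fps (\<lambda>i. if k dvd i then of_nat (i div k + 1) else 0) :: 'a fps)"
  define C where "C = (Abs_fps (\<lambda>i. if k dvd i then of_nat ((2 + i div k) choose 2) else 0) :: 'a fps)"
  have "(1 - fps_X ^ k) * A = 1"
  proof (rule fps_ext)
    fix i
    show "fps_nth ((1 - fps_X ^ k) * A) i = fps_nth 1 i"
      unfolding one_minus_X_power_mult_nth
      by (rule dvd_cases_step[OF k, of i]) (use k in \<open>auto simp: A_def\<close>)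
  qed
  then have A: "A = geometric k" using geometric_mult_eqI[OF k, of A 1] by simp
  have "(1 - fps_X ^ k) * B = A"
  proof (rule fps_ext)
    fix i
    show "fps_nth ((1 - fps_X ^ k) * B) i = fps_nth A i"
      unfolding one_minus_X_power_mult_nth
      by (rule dvd_cases_step[OF k, of i]) (auto simp: A_def B_def)
  qed
  then have B: "B = (geometric k)\<^sup>2" using geometric_mult_eqI[OF k, of B A] A by (simp add: power2_eq_square)
  have "(1 - fps_X ^ k) * C = B"
  proof (rule fps_ext)
    fix i
    have step: "Suc (Suc (Suc j)) choose 2 = (Suc (Suc j) choose 2) + Suc (Suc j)" for j
      by (simp add: numeral_2_eq_2)
    show "fps_nth ((1 - fps_X ^ k) * C) i = fps_nth B i"
      unfolding one_minus_X_power_mult_nth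
      by (rule dvd_cases_step[OF k, of i]) (auto simp: B_def C_def step)
  qed
  then have C: "C = geometric k ^ 3" using geometric_mult_eqI[OF k, of C B] B by (simp add: power3_eq_cube power2_eq_square)
  show "fps_nth (geometric k :: 'a fps) i = (if k dvd i then 1 else 0)"
    unfolding A[symmetric] by (simp add: A_def)
  show "fps_nth (geometric k ^ 3 :: 'a fps) i = (if k dvd i then of_nat ((2 + i div k) choose 2) else 0)"
    unfolding C[symmetric] by (simp add: C_def)
qed

lemma sum_multiples:
  fixes k N :: nat
  assumes "k > 0"
  shows "(\<Sum>i=0..N. if k dvd i then f i else 0) = (\<Sum>m=0..N. if k * m \<le> N then f (k * m) else (0::'a::comm_monoid_add))"
proof -
  have "(\<Sum>i=0..N. if k dvd i then f i else 0) = (\<Sum>i\<in>{0..N} \<inter> {i. k dvd i}. f i)"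
    by (simp add: sum.If_cases)
  also have "\<dots> = (\<Sum>m\<in>{0..N} \<inter> {m. k * m \<le> N}. f (k * m))"
  proof (rule sum.reindex_bij_witness[of _ "\<lambda>m. k * m" "\<lambda>i. i div k"])
    fix m assume "m \<in> {0..N} \<inter> {m. k * m \<le> N}"
    then show "k * m div k = m" "k * m \<in> {0..N} \<inter> {i. k dvd i}" using assms by auto
  next
    fix i assume "i \<in> {0..N} \<inter> {i. k dvd i}"
    then show "i div k \<in> {0..N} \<inter> {m. k * m \<le> N}"
      by (auto intro: order_trans[OF div_le_dividend])
  qed auto
  also have "\<dots> = (\<Sum>m=0..N. if k * m \<le> N then f (k * m) else 0)"
    by (simp add: sum.If_cases)
  finally show ?thesis .
qed

text \<open>A partial product of the infinite product of \<open>(1 - q^k)^(-c)\<close>. Its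
  coefficients up to \<open>q^M\<close> are already final, so identities can be proved without
  limits.\<close>

definition eulerpow :: "nat \<Rightarrow> nat \<Rightarrow> 'a::field_char_0 fps" where
  "eulerpow c M = (\<Prod>k=1..M. geometric k ^ c)"

lemma eulerpow_Suc: "eulerpow c (Suc M) = eulerpow c M * geometric (Suc M) ^ c"
  by (simp add: eulerpow_def)

lemma eulerpow_nth_0 [simp]: "fps_nth (eulerpow c M) 0 = 1"
  by (induction M) (simp_all add: eulerpow_Suc eulerpow_def geometric_def fps_nth_power_0)

text \<open>A factor with \<open>k > j\<close> is \<open>1\<close> up to order
  \<open>q^j\<close>.\<close>

lemma eulerpow_nth_stable:
  assumes "j \<le> M" "M \<le> M'"
  shows "fps_nth (eulerpow c M') j = fps_nth (eulerpow c M) j"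
  using assms(2)
proof (induction M' rule: dec_induct)
  case base
  then show ?case by simp
next
  case (step m)
  have geometric: "fps_nth (geometric (Suc m) ^ c :: 'a fps) i = (if i = 0 then 1 else 0)" if "i \<le> j" for i
  using that
  proof (induction c arbitrary: i)
    case 0
    then show ?case by simp
  next
    case (Suc c)
    have g: "fps_nth (geometric (Suc m) :: 'a fps) l = (if l = 0 then 1 else 0)" if "l \<le> m" for l
      using that by (auto simp: geometric_power_nth(1) dest: dvd_imp_le)
    have "fps_nth (geometric (Suc m) ^ Suc c :: 'a fps) i =
        (\<Sum>l=0..i. if l = 0 then fps_nth (geometric (Suc m) ^ c) i else 0)"
      unfolding power_Suc fps_mult_nth
      using Suc.prems assms(1) step.hyps by (intro sum.cong) (auto simp: g)
    then show ?case using Suc.IH[OF Suc.prems] by simp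
  qed
  have "fps_nth (eulerpow c (Suc m) :: 'a fps) j = (\<Sum>i=0..j. fps_nth (eulerpow c m) i * fps_nth (geometric (Suc m) ^ c) (j - i))"
    by (simp add: eulerpow_Suc fps_mult_nth)
  also have "\<dots> = (\<Sum>i=0..j. if i = j then fps_nth (eulerpow c m) j else 0)"
    by (intro sum.cong) (auto simp: geometric)
  also have "\<dots> = fps_nth (eulerpow c M) j" using step.IH by simp
  finally show ?case .
qed

text \<open>The logarithmic derivative: each factor \<open>(1 - q^k)^(-c)\<close> contributes
  \<open>c * k * q^k / (1 - q^k)\<close>.\<close>

lemma eulerpow_deriv:
  "fps_X * fps_deriv (eulerpow c M :: 'a::field_char_0 fps) =
     of_nat c * eulerpow c M * (\<Sum>k=1..M. of_nat k * (fps_X ^ k * geometric k))"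
proof (induction M)
  case 0
  then show ?case by (simp add: eulerpow_def)
next
  case (Suc M)
  let ?k = "Suc M"
  have d: "fps_X * fps_deriv (geometric ?k :: 'a fps) = of_nat ?k * (fps_X ^ ?k * geometric ?k) * geometric ?k"
  proof -
    have "fps_deriv (geometric ?k :: 'a fps) = - fps_deriv (1 - fps_X ^ ?k) * (geometric ?k)\<^sup>2"
      unfolding geometric_def by (rule fps_inverse_deriv) simp
    also have "fps_deriv (1 - fps_X ^ ?k :: 'a fps) = - (of_nat ?k * fps_X ^ M)"
      by (simp add: fps_deriv_power' del: power_Suc of_nat_Suc)
    finally show ?thesis by (simp add: power2_eq_square mult_ac del: of_nat_Suc)
  qed
  have dc: "fps_X * fps_deriv (geometric ?k ^ c :: 'a fps) = of_nat c * (of_nat ?k * (fps_X ^ ?k * geometric ?k)) * geometric ?k ^ c"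
  proof (cases c)
    case (Suc c')
    have "fps_X * fps_deriv (geometric ?k ^ c :: 'a fps) = of_nat c * geometric ?k ^ c' * (fps_X * fps_deriv (geometric ?k))"
      by (simp add: fps_deriv_power' Suc mult_ac del: of_nat_Suc power_Suc)
    also have "\<dots> = of_nat c * (of_nat ?k * (fps_X ^ ?k * geometric ?k)) * geometric ?k ^ c"
      unfolding d by (simp add: Suc mult_ac del: of_nat_Suc)
    finally show ?thesis .
  qed simp
  have "fps_X * fps_deriv (eulerpow c ?k :: 'a fps) =
      (fps_X * fps_deriv (eulerpow c M)) * geometric ?k ^ c + eulerpow c M * (fps_X * fps_deriv (geometric ?k ^ c))"
    by (simp add: eulerpow_Suc algebra_simps)
  also have "\<dots> = of_nat c * eulerpow c ?k * (\<Sum>k=1..?k. of_nat k * (fps_X ^ k * geometric k))"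
    unfolding Suc.IH dc by (simp add: eulerpow_Suc algebra_simps del: of_nat_Suc)
  finally show ?case .
qed

text \<open>Coefficients of the logarithmic derivative are compared; \<open>q^k / (1 - q^k)\<close>
  is the sum of \<open>q^(k * m)\<close> over \<open>m \<ge> 1\<close>.\<close>

lemma eulerpow_recursion:
  assumes "N \<le> M"
  shows "of_nat N * fps_nth (eulerpow c M) N = of_nat c *
     (\<Sum>k=1..N. \<Sum>m=1..N. if k * m \<le> N then of_nat k * fps_nth (eulerpow c M :: 'a::field_char_0 fps) (N - k * m) else 0)"
proof -
  let ?P = "eulerpow c M :: 'a fps"
  have X: "fps_nth (fps_X ^ k * geometric k * ?P) N = (\<Sum>m=1..N. if k * m \<le> N then fps_nth ?P (N - k * m) else 0)"
    if "k > 0" for k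
  proof -
    have "fps_X ^ k * geometric k = geometric k - (1 :: 'a fps)"
      using geometric_mult[OF that] unfolding left_diff_distrib mult_1 diff_eq_eq
      by (metis add_diff_cancel_left')
    then have "fps_nth (fps_X ^ k * geometric k * ?P) N = fps_nth (geometric k * ?P) N - fps_nth ?P N"
      by (simp add: left_diff_distrib)
    also have "fps_nth (geometric k * ?P) N = (\<Sum>i=0..N. if k dvd i then fps_nth ?P (N - i) else 0)"
      unfolding fps_mult_nth by (intro sum.cong) (auto simp: geometric_power_nth(1) that)
    also have "\<dots> = (\<Sum>m=0..N. if k * m \<le> N then fps_nth ?P (N - k * m) else 0)"
      by (rule sum_multiples[OF that])
    also have "\<dots> = fps_nth ?P N + (\<Sum>m=1..N. if k * m \<le> N then fps_nth ?P (N - k * m) else 0)"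
      by (subst sum.atLeast_Suc_atMost) auto
    finally show ?thesis by simp
  qed
  have "of_nat N * fps_nth ?P N = fps_nth (fps_X * fps_deriv ?P) N"
    by (cases N) simp_all
  also have "fps_X * fps_deriv ?P = of_nat c * (\<Sum>k=1..M. of_nat k * (fps_X ^ k * geometric k * ?P))"
    unfolding eulerpow_deriv by (simp add: sum_distrib_left sum_distrib_right mult_ac)
  also have "fps_nth \<dots> N = of_nat c * (\<Sum>k=1..M. of_nat k * fps_nth (fps_X ^ k * geometric k * ?P) N)"
    by (simp add: fps_sum_nth fps_of_nat[symmetric])
  also have "(\<Sum>k=1..M. of_nat k * fps_nth (fps_X ^ k * geometric k * ?P) N) =
      (\<Sum>k=1..M. \<Sum>m=1..N. if k * m \<le> N then of_nat k * fps_nth ?P (N - k * m) else 0)"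
    by (intro sum.cong refl, subst X) (auto simp: sum_distrib_left intro!: sum.cong)
  also have "\<dots> = (\<Sum>k=1..N. \<Sum>m=1..N. if k * m \<le> N then of_nat k * fps_nth ?P (N - k * m) else 0)"
  proof (rule sum.mono_neutral_right)
    show "\<forall>k\<in>{1..M} - {1..N}. (\<Sum>m=1..N. if k * m \<le> N then of_nat k * fps_nth ?P (N - k * m) else 0) = 0"
    proof
      fix k assume "k \<in> {1..M} - {1..N}"
      then have k: "N < k" by auto
      have "\<not> k * m \<le> N" if "m \<in> {1..N}" for m
      proof -
        have "k \<le> k * m" using that by simp
        then show ?thesis using k by linarith
      qed
      then show "(\<Sum>m=1..N. if k * m \<le> N then of_nat k * fps_nth ?P (N - k * m) else 0) = 0"
        by (intro sum.neutral) auto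
    qed
  qed (use assms in auto)
  finally show ?thesis .
qed

lemma partitions_of_0: "partitions_of 0 = {[]}"
proof (intro Set.set_eqI iffI)
  fix xs assume xs: "xs \<in> partitions_of 0"
  then show "xs \<in> {[]}" by (cases xs) (auto simp: partitions_of_def)
qed (auto simp: partitions_of_def)

lemma hook_sum_0: "hook_sum t 0 = 1"
proof -
  have "young_diagram [] = {}" by (auto simp: young_diagram_def)
  then show ?thesis by (simp add: hook_sum_def partitions_of_0 hook_lengths_def)
qed

text \<open>The Nekrasov-Okounkov formula at \<open>z = t\<^sup>2 = 1 - c\<close>.\<close>

theorem hook_sum_eq_eulerpow:
  fixes t :: "'a::field_char_0"
  assumes t: "t \<notin> \<int>" "1 - t\<^sup>2 = of_nat c" and "N \<le> M"
  shows "hook_sum t N = of_rat (fps_nth (eulerpow c M) N)"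
  using assms(3)
proof (induction N rule: less_induct)
  case (less N)
  let ?P = "\<lambda>i. fps_nth (eulerpow c M :: rat fps) i"
  show ?case
  proof (cases "N = 0")
    case True
    then show ?thesis by (simp add: hook_sum_0)
  next
    case False
    \<comment> \<open>With \<open>1 - t^2 = c\<close> both sequences obey the same recursion, in
      which the nonzero factor \<open>N\<close> can be cancelled.\<close>
    have "of_nat N * hook_sum t N = of_nat c * (\<Sum>k=1..N. \<Sum>m=1..N. if k * m \<le> N then of_nat k * hook_sum t (N - k * m) else 0)"
      using hook_sum_recursion[OF t(1), of N] t(2) by simp
    also have "\<dots> = of_nat c * (\<Sum>k=1..N. \<Sum>m=1..N. if k * m \<le> N then of_rat (of_nat k * ?P (N - k * m)) else 0)"
    proof (intro arg_cong2[of _ _ _ _ "(*)"] sum.cong refl)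
      fix k m assume "k \<in> {1..N}" "m \<in> {1..N}"
      then have "N - k * m < N" using False by simp
      then have "hook_sum t (N - k * m) = of_rat (?P (N - k * m))" using less by simp
      then show "(if k * m \<le> N then of_nat k * hook_sum t (N - k * m) else 0) =
         (if k * m \<le> N then of_rat (of_nat k * ?P (N - k * m)) else 0)"
        by (simp add: of_rat_mult)
    qed
    also have "\<dots> = of_rat (of_nat c * (\<Sum>k=1..N. \<Sum>m=1..N. if k * m \<le> N then of_nat k * ?P (N - k * m) else 0))"
      unfolding of_rat_mult of_rat_sum of_rat_of_nat_eq
      by (intro arg_cong2[of _ _ _ _ "(*)"] sum.cong refl) (simp add: of_rat_mult)
    also have "\<dots> = of_nat N * of_rat (?P N)"
      using eulerpow_recursion[OF less.prems, of c, where 'a = rat]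
      by (metis of_rat_mult of_rat_of_nat_eq)
    finally show ?thesis using False by simp
  qed
qed

section \<open>Partitions weighted by the multiplicities of their parts\<close>

text \<open>Bounding the parts separately from the size permits induction on the bound.\<close>

definition bounded_partitions :: "nat \<Rightarrow> nat \<Rightarrow> nat list set" where
  "bounded_partitions M N = {xs. sorted_wrt (\<ge>) xs \<and> set xs \<subseteq> {1..M} \<and> sum_list xs = N}"

lemma finite_bounded_partitions [simp]: "finite (bounded_partitions M N)"
proof (rule finite_subset)
  show "bounded_partitions M N \<subseteq> partitions_of (int N)"
    by (auto simp: bounded_partitions_def partitions_of_def)
qed simp

lemma partitions_of_eq_bounded: "partitions_of (int N) = bounded_partitions N N"
proof (rule subset_antisym; rule subsetI)
  fix xs assume xs: "xs \<in> partitions_of (int N)"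
  have "x \<le> sum_list xs" if "x \<in> set xs" for x
    by (rule member_le_sum_list[OF that]) simp
  then show "xs \<in> bounded_partitions N N"
    using xs by (auto simp: bounded_partitions_def partitions_of_def Suc_le_eq)
qed (auto simp: bounded_partitions_def partitions_of_def)

definition parts_weight :: "nat \<Rightarrow> nat list \<Rightarrow> 'a::field_char_0" where
  "parts_weight M xs = (\<Prod>s=1..M. of_nat ((2 + count_list xs s) choose 2))"

lemma sorted_desc_split:
  fixes xs :: "nat list"
  assumes "sorted_wrt (\<ge>) xs" "set xs \<subseteq> {1..Suc M}"
  shows "\<exists>m ys. xs = replicate m (Suc M) @ ys \<and> sorted_wrt (\<ge>) ys \<and> set ys \<subseteq> {1..M}"
  using assms
proof (induction xs)
  case Nil
  show ?case by (intro exI[of _ 0] exI[of _ "[]"]) simp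
next
  case (Cons x xs)
  show ?case
  proof (cases "x = Suc M")
    case True
    obtain m ys where "xs = replicate m (Suc M) @ ys" "sorted_wrt (\<ge>) ys" "set ys \<subseteq> {1..M}"
      using Cons by auto
    then show ?thesis using True by (intro exI[of _ "Suc m"] exI[of _ ys]) simp
  next
    case False
    then have "set (x # xs) \<subseteq> {1..M}" using Cons.prems by fastforce
    then show ?thesis using Cons.prems by (intro exI[of _ 0] exI[of _ "x # xs"]) simp
  qed
qed

lemma count_list_replicate: "count_list (replicate m x) y = (if x = y then m else 0)"
  by (induction m) auto

text \<open>The \<open>m\<close> copies of the part \<open>Suc M\<close> come first in the list;
  removing them leaves a partition with parts up to \<open>M\<close> and removes exactly the factor
  for \<open>Suc M\<close>.\<close>

lemma bounded_partitions_Suc: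
  "(\<Sum>xs\<in>bounded_partitions (Suc M) N. parts_weight (Suc M) xs) =
   (\<Sum>m=0..N. if Suc M * m \<le> N then of_nat ((2 + m) choose 2) *
      (\<Sum>ys\<in>bounded_partitions M (N - Suc M * m). parts_weight M ys) else (0::'a::field_char_0))"
proof -
  let ?I = "{0..N} \<inter> {m. Suc M * m \<le> N}"
  let ?S = "SIGMA m:?I. bounded_partitions M (N - Suc M * m)"
  let ?h = "\<lambda>(m, ys). replicate m (Suc M) @ ys"
  have notin: "count_list ys (Suc M) = 0" if "ys \<in> bounded_partitions M K" for ys K
    using that by (intro count_notin) (auto simp: bounded_partitions_def)
  have "(\<Sum>m=0..N. if Suc M * m \<le> N then of_nat ((2 + m) choose 2) *
      (\<Sum>ys\<in>bounded_partitions M (N - Suc M * m). parts_weight M ys) else (0::'a)) =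
    (\<Sum>m\<in>?I. \<Sum>ys\<in>bounded_partitions M (N - Suc M * m). of_nat ((2 + m) choose 2) * parts_weight M ys)"
    by (simp add: sum.If_cases sum_distrib_left)
  also have "\<dots> = (\<Sum>(m, ys)\<in>?S. of_nat ((2 + m) choose 2) * parts_weight M ys)"
    by (rule sum.Sigma) auto
  also have "\<dots> = (\<Sum>xs\<in>bounded_partitions (Suc M) N. parts_weight (Suc M) xs)"
  proof (rule sum.reindex_bij_betw[of ?h, THEN trans[rotated]])
    show "bij_betw ?h ?S (bounded_partitions (Suc M) N)"
      unfolding bij_betw_def
    proof (intro conjI)
      show "inj_on ?h ?S"
      proof (rule inj_onI, clarify)
        fix m ys m' ys'
        assume ys: "ys \<in> bounded_partitions M (N - Suc M * m)" "ys' \<in> bounded_partitions M (N - Suc M * m')"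
          and eq: "replicate m (Suc M) @ ys = replicate m' (Suc M) @ ys'"
        from arg_cong[OF eq, of "\<lambda>l. count_list l (Suc M)"] have "m = m'"
          using notin[OF ys(1)] notin[OF ys(2)] by (simp add: count_list_replicate)
        then show "m = m' \<and> ys = ys'" using eq by simp
      qed
      show "?h ` ?S = bounded_partitions (Suc M) N"
      proof (rule subset_antisym; rule subsetI)
        fix xs assume "xs \<in> ?h ` ?S"
        then obtain m ys where m: "Suc M * m \<le> N" "ys \<in> bounded_partitions M (N - Suc M * m)"
          and xs: "xs = replicate m (Suc M) @ ys" by auto
        then show "xs \<in> bounded_partitions (Suc M) N"
          by (auto simp: bounded_partitions_def sorted_wrt_append sum_list_replicate mult.commute
              intro: le_SucI) (auto simp: sorted_wrt_iff_nth_less)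
      next
        fix xs assume xs: "xs \<in> bounded_partitions (Suc M) N"
        then obtain m ys where m: "xs = replicate m (Suc M) @ ys" "sorted_wrt (\<ge>) ys" "set ys \<subseteq> {1..M}"
          using sorted_desc_split[of xs M] by (auto simp: bounded_partitions_def)
        have N: "N = Suc M * m + sum_list ys"
          using xs m(1) by (simp add: bounded_partitions_def sum_list_replicate mult.commute)
        then have "(m, ys) \<in> ?S" using m by (auto simp: bounded_partitions_def)
        then show "xs \<in> ?h ` ?S" using m(1) by force
      qed
    qed
    have "of_nat ((2 + m) choose 2) * parts_weight M ys = (parts_weight (Suc M) (replicate m (Suc M) @ ys) :: 'a)"
      if "ys \<in> bounded_partitions M K" for m ys K
    proof -
      have "(\<Prod>s=1..M. of_nat ((2 + count_list (replicate m (Suc M) @ ys) s) choose 2)) = (parts_weight M ys :: 'a)"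
        unfolding parts_weight_def by (intro prod.cong) (auto simp: count_list_replicate)
      then show ?thesis
        using notin[OF that] by (simp add: parts_weight_def count_list_replicate mult.commute)
    qed
    then show "(\<Sum>(m, ys)\<in>?S. of_nat ((2 + m) choose 2) * parts_weight M ys) =
       (\<Sum>x\<in>?S. parts_weight (Suc M) (?h x) :: 'a)"
      by (intro sum.cong) auto
  qed
  finally show ?thesis by simp
qed

text \<open>The coefficient of \<open>q^(s * m)\<close> in \<open>(1 - q^s)^(-3)\<close> is
  \<open>(2 + m) choose 2\<close>, so each further factor chooses the multiplicity of one further
  part.\<close>

lemma sum_parts_weight:
  "(\<Sum>xs\<in>bounded_partitions M N. parts_weight M xs) = fps_nth (eulerpow 3 M :: 'a::field_char_0 fps) N"
proof (induction M arbitrary: N)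
  case 0
  have "bounded_partitions 0 N = (if N = 0 then {[]} else {})"
    by (auto simp: bounded_partitions_def)
  then show ?case by (simp add: parts_weight_def eulerpow_def)
next
  case (Suc M)
  have "fps_nth (eulerpow 3 (Suc M) :: 'a fps) N = (\<Sum>i=0..N. if Suc M dvd i then
      of_nat ((2 + i div Suc M) choose 2) * fps_nth (eulerpow 3 M) (N - i) else 0)"
    unfolding eulerpow_Suc mult.commute[of _ "geometric _ ^ _"] fps_mult_nth
    by (intro sum.cong) (auto simp: geometric_power_nth(2))
  also have "\<dots> = (\<Sum>m=0..N. if Suc M * m \<le> N then
      of_nat ((2 + m) choose 2) * fps_nth (eulerpow 3 M) (N - Suc M * m) else 0)"
    by (subst sum_multiples) (auto intro!: sum.cong simp del: mult_Suc)
  also have "\<dots> = (\<Sum>xs\<in>bounded_partitions (Suc M) N. parts_weight (Suc M) xs)"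
    unfolding bounded_partitions_Suc Suc.IH ..
  finally show ?case by simp
qed

section \<open>Gaussian binomials and the Jacobi coefficients\<close>

definition qpoch :: "nat \<Rightarrow> 'a::field_char_0 fps" where
  "qpoch n = (\<Prod>k=1..n. 1 - fps_X ^ k)"

lemma qpoch_Suc: "qpoch (Suc n) = qpoch n * (1 - fps_X ^ Suc n)"
  by (simp add: qpoch_def)

lemma qpoch_mult_eulerpow: "qpoch n * eulerpow 1 n = 1"
  by (simp add: qpoch_def eulerpow_def prod.distrib[symmetric] geometric_mult del: One_nat_def)

lemma eulerpow_eq_power: "eulerpow c n = eulerpow 1 n ^ c"
  by (simp add: eulerpow_def prod_power_distrib)

text \<open>The Gaussian binomial \<open>[a + b, a]\<close>, with \<open>eulerpow 1\<close> as the
  inverse of \<open>qpoch\<close>; indexing by both lower entries makes it symmetric.\<close>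

definition qbin :: "nat \<Rightarrow> nat \<Rightarrow> 'a::field_char_0 fps" where
  "qbin a b = qpoch (a + b) * eulerpow 1 a * eulerpow 1 b"

lemma qbin_commute: "qbin a b = qbin b a"
  by (simp add: qbin_def add.commute mult_ac)

lemma eulerpow_0: "eulerpow c 0 = 1"
  by (simp add: eulerpow_def)

lemma qbin_0 [simp]: "qbin 0 b = (1 :: 'a::field_char_0 fps)" "qbin b 0 = (1 :: 'a fps)"
  using qpoch_mult_eulerpow[of b, where 'a = 'a] by (simp_all add: qbin_def eulerpow_0 del: One_nat_def)

lemma eulerpow_1_step: "(1 - fps_X ^ Suc a) * eulerpow 1 (Suc a) = eulerpow 1 a"
  using geometric_mult[of "Suc a", where 'a = 'a] by (simp add: eulerpow_Suc mult.left_commute)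

text \<open>All terms are multiples of \<open>?E\<close>. What remains is \<open>1 - q^(a + b + 2) =
  (1 - q^(a + 1)) + q^(a + 1) * (1 - q^(b + 1))\<close>.\<close>

lemma qbin_Pascal:
  "qbin (Suc a) (Suc b) = qbin a (Suc b) + fps_X ^ Suc a * (qbin (Suc a) b :: 'a::field_char_0 fps)"
proof -
  let ?E = "eulerpow 1 (Suc a) * eulerpow 1 (Suc b) * qpoch (Suc (a + b)) :: 'a fps"
  have 1: "qbin (Suc a) (Suc b) = ?E * (1 - fps_X ^ Suc (Suc (a + b)))"
    by (simp add: qbin_def qpoch_Suc mult_ac del: power_Suc)
  have 2: "qbin a (Suc b) = ?E * (1 - fps_X ^ Suc a)"
    unfolding qbin_def eulerpow_1_step[of a, symmetric] by (simp add: mult_ac del: power_Suc)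
  have 3: "qbin (Suc a) b = ?E * (1 - fps_X ^ Suc b)"
    unfolding qbin_def eulerpow_1_step[of b, symmetric] by (simp add: mult_ac del: power_Suc)
  show ?thesis unfolding 1 2 3 by (simp add: algebra_simps power_add)
qed

lemma qbin_Pascal':
  "qbin (Suc a) (Suc b) = qbin (Suc a) b + fps_X ^ Suc b * (qbin a (Suc b) :: 'a::field_char_0 fps)"
  using qbin_Pascal[of b a] by (simp add: qbin_commute)

text \<open>Both forms of the Pascal rule combined. The case \<open>a = 0\<close> is separate
  because \<open>a - 1\<close> is truncated.\<close>

lemma qbin_three_term:
  assumes "b > 0"
  shows "qbin (Suc a) (Suc b) = (1 + fps_X ^ (a + b + 1)) * qbin a b + fps_X ^ Suc a * qbin (Suc a) (b - 1)
     + (if a = 0 then 0 else fps_X ^ Suc b * (qbin (a - 1) (Suc b) :: 'a::field_char_0 fps))"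
proof -
  obtain b' where b: "b = Suc b'" using assms by (cases b) auto
  have 1: "qbin (Suc a) (Suc b) = qbin a (Suc b) + fps_X ^ Suc a * (qbin (Suc a) b :: 'a fps)"
    by (rule qbin_Pascal)
  have 2: "qbin (Suc a) b = qbin (Suc a) b' + fps_X ^ b * (qbin a b :: 'a fps)"
    unfolding b by (rule qbin_Pascal')
  have 3: "qbin a (Suc b) = qbin a b + (if a = 0 then 0 else fps_X ^ Suc b * (qbin (a - 1) (Suc b) :: 'a fps))"
    by (cases a) (simp_all add: qbin_Pascal' del: power_Suc)
  show ?thesis unfolding 1 2 3 by (simp add: b algebra_simps power_add)
qed

definition triangular :: "nat \<Rightarrow> nat" where "triangular n = n * (n + 1) div 2"

lemma triangular_Suc: "triangular (Suc n) = triangular n + Suc n"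
  by (simp add: triangular_def)

lemma triangular_0 [simp]: "triangular 0 = 0"
  by (simp add: triangular_def)

lemma triangular_mono: "m \<le> n \<Longrightarrow> triangular m \<le> triangular n"
  unfolding triangular_def by (intro div_le_mono mult_le_mono) auto

text \<open>The coefficient of the character \<open>\<zeta>^(-n) + ... + \<zeta>^n\<close> in the
  product of \<open>(1 - \<zeta> q^k) (1 - q^k / \<zeta>)\<close> over
  \<open>k \<le> m\<close>.\<close>

definition jacobi_coeff :: "nat \<Rightarrow> nat \<Rightarrow> 'a::field_char_0 fps" where
  "jacobi_coeff m n = (if n \<le> m then (- 1) ^ n * fps_X ^ triangular n * qbin (m - n) (m + n + 1) else 0)"

text \<open>Passing to \<open>m + 1\<close> multiplies the product by
  \<open>1 + Q^2 - Q (\<zeta> + 1/\<zeta>)\<close>, where \<open>Q = q^(m + 1)\<close>. Since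
  \<open>\<zeta> + 1/\<zeta>\<close> times \<open>\<chi>_0\<close> is
  \<open>\<chi>_1 - \<chi>_0\<close>, the term \<open>jacobi_coeff m 0\<close> enters twice.\<close>

lemma jacobi_coeff_Suc_0:
  "jacobi_coeff (Suc m) 0 = (1 + fps_X ^ (2 * Suc m)) * jacobi_coeff m 0 - fps_X ^ Suc m * (jacobi_coeff m 1 - (jacobi_coeff m 0 :: 'a::field_char_0 fps))"
proof -
  have "jacobi_coeff (Suc m) 0 = (qbin (Suc m) (Suc (m + 1)) :: 'a fps)"
    by (simp add: jacobi_coeff_def)
  also have "\<dots> = (1 + fps_X ^ (m + (m + 1) + 1)) * qbin m (m + 1) + fps_X ^ Suc m * qbin (Suc m) (m + 1 - 1)
     + (if m = 0 then 0 else fps_X ^ Suc (m + 1) * qbin (m - 1) (Suc (m + 1)))"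
    by (rule qbin_three_term) simp
  also have "qbin (Suc m) (m + 1 - 1) = (qbin m (m + 1) :: 'a fps)"
    by (simp add: qbin_commute)
  also have "m + (m + 1) + 1 = 2 * Suc m" by simp
  also have "(if m = 0 then 0 else fps_X ^ Suc (m + 1) * qbin (m - 1) (Suc (m + 1))) = - (fps_X ^ Suc m * jacobi_coeff m 1 :: 'a fps)"
    by (cases m) (simp_all add: jacobi_coeff_def triangular_def mult_ac)
  also have "qbin m (m + 1) = (jacobi_coeff m 0 :: 'a fps)" by (simp add: jacobi_coeff_def)
  finally show ?thesis by (simp add: algebra_simps)
qed

text \<open>The same factor for a nontrivial character, whose product with
  \<open>\<zeta> + 1/\<zeta>\<close> is the sum of its two neighbours.\<close>

lemma jacobi_coeff_Suc_Suc:
  "jacobi_coeff (Suc m) (Suc n) = (1 + fps_X ^ (2 * Suc m)) * jacobi_coeff m (Suc n) - fps_X ^ Suc m * (jacobi_coeff m n + (jacobi_coeff m (Suc (Suc n)) :: 'a::field_char_0 fps))"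
proof -
  consider "m < n" | "m = n" | "n < m" by linarith
  then show ?thesis
  proof cases
    case 1
    then show ?thesis by (simp add: jacobi_coeff_def)
  next
    case 2
    then show ?thesis by (simp add: jacobi_coeff_def triangular_Suc power_add mult_ac)
  next
    case 3
    \<comment> \<open>Up to a common sign and power of \<open>q\<close> the claim is
      \<open>qbin_three_term\<close> with \<open>a = m - n - 1\<close> and
      \<open>b = m + n + 2\<close>.\<close>
    define a where "a = m - Suc n"
    have m: "m = a + Suc n" using 3 by (simp add: a_def)
    define b where "b = m + Suc n + 1"
    have e1: "fps_X ^ Suc m * (jacobi_coeff m n :: 'a fps) = (- 1) ^ n * fps_X ^ triangular (Suc n) * (fps_X ^ Suc a * qbin (Suc a) (b - 1))"
    proof -
      have "m - n = Suc a" "m + n + 1 = b - 1" "n \<le> m" by (simp_all add: m b_def)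
      moreover have "Suc m + triangular n = triangular (Suc n) + Suc a" by (simp add: triangular_Suc m)
      then have "(fps_X ^ Suc m * fps_X ^ triangular n :: 'a fps) = fps_X ^ triangular (Suc n) * fps_X ^ Suc a"
        by (metis power_add)
      ultimately show ?thesis by (simp add: jacobi_coeff_def mult_ac del: power_Suc)
    qed
    have e2: "fps_X ^ Suc m * (jacobi_coeff m (Suc (Suc n)) :: 'a fps) =
       (- 1) ^ n * fps_X ^ triangular (Suc n) * (if a = 0 then 0 else fps_X ^ Suc b * qbin (a - 1) (Suc b))"
    proof (cases "a = 0")
      case True
      then show ?thesis by (simp add: jacobi_coeff_def m)
    next
      case False
      then have "m - Suc (Suc n) = a - 1" "m + Suc (Suc n) + 1 = Suc b" "Suc (Suc n) \<le> m" by (auto simp: m b_def)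
      moreover have "Suc m + triangular (Suc (Suc n)) = triangular (Suc n) + Suc b" by (simp add: triangular_Suc m b_def)
      then have "(fps_X ^ Suc m * fps_X ^ triangular (Suc (Suc n)) :: 'a fps) = fps_X ^ triangular (Suc n) * fps_X ^ Suc b"
        by (metis power_add)
      ultimately show ?thesis using False by (simp add: jacobi_coeff_def mult_ac del: power_Suc) simp
    qed
    have e0: "jacobi_coeff m (Suc n) = - ((- 1) ^ n * fps_X ^ triangular (Suc n) * (qbin a b :: 'a fps))"
    proof -
      have "m - Suc n = a" "m + Suc n + 1 = b" "Suc n \<le> m" by (simp_all add: m b_def)
      then show ?thesis by (simp add: jacobi_coeff_def)
    qed
    have l: "jacobi_coeff (Suc m) (Suc n) = - ((- 1) ^ n * fps_X ^ triangular (Suc n) * (qbin (Suc a) (Suc b) :: 'a fps))"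
    proof -
      have "Suc m - Suc n = Suc a" "Suc m + Suc n + 1 = Suc b" "Suc n \<le> Suc m" by (simp_all add: m b_def)
      then show ?thesis by (simp add: jacobi_coeff_def)
    qed
    have ab: "a + b + 1 = 2 * Suc m" by (simp add: m b_def)
    have "b > 0" by (simp add: b_def)
    from qbin_three_term[OF this, of a, where 'a = 'a] show ?thesis
      unfolding l distrib_left[of _ "jacobi_coeff m n"] e1 e2 e0 ab by (simp add: algebra_simps)
  qed
qed

text \<open>\<open>char_coeff n a\<close> is the coefficient of \<open>x\<^sup>a\<close> in the character \<open>\<Sum>j=-n..n. \<zeta>\<^sup>j\<close> written as a
  polynomial in \<open>x = 2 - \<zeta> - 1/\<zeta>\<close>.\<close>

fun char_coeff :: "nat \<Rightarrow> nat \<Rightarrow> 'a::comm_ring_1" where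
  "char_coeff 0 a = (if a = 0 then 1 else 0)"
| "char_coeff (Suc 0) a = (if a = 0 then 3 else if a = 1 then - 1 else 0)"
| "char_coeff (Suc (Suc n)) a = 2 * char_coeff (Suc n) a - (case a of 0 \<Rightarrow> 0 | Suc b \<Rightarrow> char_coeff (Suc n) b) - char_coeff n a"

text \<open>On coefficient sequences of polynomials this is multiplication by the variable.\<close>

definition shift_seq :: "(nat \<Rightarrow> 'a::zero) \<Rightarrow> nat \<Rightarrow> 'a" where
  "shift_seq f a = (case a of 0 \<Rightarrow> 0 | Suc b \<Rightarrow> f b)"

text \<open>From \<open>x = 2 - \<zeta> - 1/\<zeta>\<close>: multiplying a character by
  \<open>x\<close> gives twice that character minus its two neighbours. The next lemma follows the
  same pattern with \<open>\<chi>_(-1) = - \<chi>_0\<close>.\<close>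

lemma char_coeff_shift_Suc: "shift_seq (char_coeff (Suc n)) a = 2 * char_coeff (Suc n) a - char_coeff (Suc (Suc n)) a - char_coeff n a"
  by (simp add: shift_seq_def split: nat.split)

lemma char_coeff_shift_0: "shift_seq (char_coeff 0) a = 2 * char_coeff 0 a - char_coeff 1 a + char_coeff 0 a"
  by (auto simp: shift_seq_def split: nat.split)

lemma char_coeff_eq_0: "n < a \<Longrightarrow> char_coeff n a = 0"
  by (induction n a rule: char_coeff.induct) (auto split: nat.split)

lemma char_coeff_diagonal: "char_coeff n n = (- 1) ^ n"
proof (induction n rule: less_induct)
  case (less n)
  show ?case
  proof (cases "n \<le> 1")
    case True
    then show ?thesis by (cases n) auto
  next
    case False
    then obtain m where "n = Suc (Suc m)" by (cases n; cases "n - 1") auto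
    then show ?thesis using less[of "Suc m"] by (simp add: char_coeff_eq_0)
  qed
qed

section \<open>MacMahon's series\<close>

definition MO_part :: "nat \<Rightarrow> 'a::field_char_0 fps" where
  "MO_part k = fps_X ^ k * (geometric k)\<^sup>2"

definition MO_term :: "nat list \<Rightarrow> 'a::field_char_0 fps" where
  "MO_term ks = (\<Prod>k\<leftarrow>ks. MO_part k)"

definition MO_trunc_indices :: "nat \<Rightarrow> nat \<Rightarrow> nat list set" where
  "MO_trunc_indices m a = {ks \<in> MO_indices a. set ks \<subseteq> {..m}}"

text \<open>The elementary symmetric polynomial of degree \<open>a\<close> in
  \<open>MO_part 1, ..., MO_part m\<close>.\<close>

definition MO_trunc :: "nat \<Rightarrow> nat \<Rightarrow> 'a::field_char_0 fps" where
  "MO_trunc m a = (\<Sum>ks\<in>MO_trunc_indices m a. MO_term ks)"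

lemma finite_MO_trunc_indices [simp]: "finite (MO_trunc_indices m a)"
  by (rule finite_subset[OF _ finite_lists_length_eq[of "{..m}" a]])
     (auto simp: MO_trunc_indices_def MO_indices_def)

lemma MO_trunc_at_0: "MO_trunc m 0 = 1"
proof -
  have "MO_trunc_indices m 0 = {[]}" by (auto simp: MO_trunc_indices_def MO_indices_def)
  then show ?thesis by (simp add: MO_trunc_def MO_term_def)
qed

lemma MO_trunc_0: "MO_trunc 0 (Suc a) = 0"
proof -
  have "MO_trunc_indices 0 (Suc a) = {}"
  proof (rule ccontr)
    assume "MO_trunc_indices 0 (Suc a) \<noteq> {}"
    then obtain ks where "ks \<in> MO_trunc_indices 0 (Suc a)" by blast
    then have ks: "length ks = Suc a" "\<forall>k\<in>set ks. 0 < k" "set ks \<subseteq> {..0}"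
      by (auto simp: MO_trunc_indices_def MO_indices_def)
    then have "hd ks \<in> set ks" by (cases ks) auto
    then have "0 < hd ks" "hd ks \<in> {..0}" using ks by blast+
    then show False by simp
  qed
  then show ?thesis by (simp add: MO_trunc_def)
qed

lemma MO_trunc_indices_Suc:
  "MO_trunc_indices (Suc m) (Suc a) = MO_trunc_indices m (Suc a) \<union> (\<lambda>ks. ks @ [Suc m]) ` MO_trunc_indices m a"
proof (rule subset_antisym; rule subsetI)
  fix ks assume ks: "ks \<in> MO_trunc_indices (Suc m) (Suc a)"
  then have "ks \<noteq> []" by (auto simp: MO_trunc_indices_def MO_indices_def)
  then obtain ls k where l: "ks = ls @ [k]" by (metis rev_exhaust)
  have lt: "\<forall>x\<in>set ls. x < k" "k \<le> Suc m"
    using ks by (auto simp: l MO_trunc_indices_def MO_indices_def sorted_wrt_append)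
  show "ks \<in> MO_trunc_indices m (Suc a) \<union> (\<lambda>ks. ks @ [Suc m]) ` MO_trunc_indices m a"
  proof (cases "k = Suc m")
    case True
    then have "ls \<in> MO_trunc_indices m a"
      using ks lt by (auto simp: l MO_trunc_indices_def MO_indices_def sorted_wrt_append)
    then show ?thesis by (simp add: l True)
  next
    case False
    then have "set ks \<subseteq> {..m}" using lt by (fastforce simp: l)
    then show ?thesis using ks by (simp add: MO_trunc_indices_def)
  qed
next
  fix ks assume "ks \<in> MO_trunc_indices m (Suc a) \<union> (\<lambda>ks. ks @ [Suc m]) ` MO_trunc_indices m a"
  then show "ks \<in> MO_trunc_indices (Suc m) (Suc a)"
    by (fastforce simp: MO_trunc_indices_def MO_indices_def sorted_wrt_append)
qed

text \<open>Index lists are split by whether they end in \<open>Suc m\<close>. For the generating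
  polynomial in \<open>x\<close> this is multiplication by
  \<open>1 + x * MO_part (Suc m)\<close>.\<close>

lemma MO_trunc_Suc: "MO_trunc (Suc m) a = MO_trunc m a + MO_part (Suc m) * shift_seq (MO_trunc m) a"
proof (cases a)
  case 0
  then show ?thesis by (simp add: MO_trunc_at_0 shift_seq_def)
next
  case (Suc b)
  have "MO_trunc_indices m (Suc b) \<inter> (\<lambda>ks. ks @ [Suc m]) ` MO_trunc_indices m b = {}"
    by (auto simp: MO_trunc_indices_def)
  then have "MO_trunc (Suc m) (Suc b) = MO_trunc m (Suc b) +
      (\<Sum>ks\<in>(\<lambda>ks. ks @ [Suc m]) ` MO_trunc_indices m b. MO_term ks :: 'a fps)"
    unfolding MO_trunc_def MO_trunc_indices_Suc by (intro sum.union_disjoint) simp_all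
  also have "(\<Sum>ks\<in>(\<lambda>ks. ks @ [Suc m]) ` MO_trunc_indices m b. MO_term ks :: 'a fps) =
      MO_part (Suc m) * MO_trunc m b"
  proof (subst sum.reindex)
    have "MO_term (ks @ [Suc m]) = (MO_part (Suc m) * MO_term ks :: 'a fps)" for ks
      by (simp add: MO_term_def mult.commute)
    then show "sum (MO_term \<circ> (\<lambda>ks. ks @ [Suc m])) (MO_trunc_indices m b) = (MO_part (Suc m) * MO_trunc m b :: 'a fps)"
      by (simp add: MO_trunc_def sum_distrib_left)
  qed (simp add: inj_on_def)
  finally show ?thesis by (simp add: Suc shift_seq_def)
qed

lemma sum_atMost_shift_zero:
  fixes f :: "nat \<Rightarrow> 'a::comm_monoid_add"
  assumes "f (Suc m) = 0"
  shows "(\<Sum>n\<le>m. f n) = f 0 + (\<Sum>n\<le>m. f (Suc n))"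
proof -
  have "(\<Sum>n\<le>m. f n) = (\<Sum>n\<le>Suc m. f n)" using assms by simp
  then show ?thesis by (simp only: sum.atMost_Suc_shift)
qed

text \<open>A finite form of the Jacobi triple product identity.\<close>

lemma MO_trunc_jacobi_coeff:
  "MO_trunc m a * (qpoch m)\<^sup>2 = (\<Sum>n\<le>m. jacobi_coeff m n * (char_coeff n a :: 'a::field_char_0 fps))"
proof (induction m arbitrary: a)
  case 0
  show ?case by (cases a) (simp_all add: MO_trunc_at_0 MO_trunc_0 jacobi_coeff_def qpoch_def)
next
  case (Suc m)
  define Q where "Q = (fps_X ^ Suc m :: 'a fps)"
  define j where "j = (jacobi_coeff m :: nat \<Rightarrow> 'a fps)"
  define s where "s n = (char_coeff n a :: 'a fps)" for n
  have j0: "j n = 0" if "m < n" for n using that by (simp add: j_def jacobi_coeff_def)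
  have Q2: "fps_X ^ (2 * Suc m) = (Q\<^sup>2 :: 'a fps)" by (simp add: Q_def power_mult[symmetric] mult.commute del: power_Suc)
  \<comment> \<open>Hence \<open>(1 - Q)^2\<close> times the new factor
    \<open>1 + x * MO_part (Suc m)\<close> is the polynomial
    \<open>(1 - Q)^2 + x * Q\<close>.\<close>
  have part: "(1 - Q)\<^sup>2 * MO_part (Suc m) = Q"
  proof -
    have "(1 - Q)\<^sup>2 * MO_part (Suc m) = Q * ((1 - Q) * geometric (Suc m))\<^sup>2"
      by (simp add: MO_part_def Q_def power_mult_distrib mult_ac del: power_Suc)
    then show ?thesis using geometric_mult[of "Suc m", where 'a = 'a] by (simp add: Q_def del: power_Suc)
  qed
  have shift_seq: "shift_seq (MO_trunc m) a * (qpoch m)\<^sup>2 = (\<Sum>n\<le>m. j n * shift_seq (char_coeff n) a)"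
    by (cases a) (simp_all add: shift_seq_def Suc.IH j_def)
  have "MO_trunc (Suc m) a * (qpoch (Suc m))\<^sup>2 =
     (1 - Q)\<^sup>2 * (MO_trunc m a * (qpoch m)\<^sup>2) + ((1 - Q)\<^sup>2 * MO_part (Suc m)) * (shift_seq (MO_trunc m) a * (qpoch m)\<^sup>2)"
    unfolding MO_trunc_Suc qpoch_Suc power_mult_distrib Q_def[symmetric]
    by (simp only: distrib_right) (simp only: mult_ac)
  also have "\<dots> = (1 - Q)\<^sup>2 * (\<Sum>n\<le>m. j n * s n) + Q * (\<Sum>n\<le>m. j n * shift_seq (char_coeff n) a)"
    unfolding part shift_seq Suc.IH j_def s_def ..
  also have "\<dots> = (\<Sum>n\<le>m. j n * ((1 - Q)\<^sup>2 * s n + Q * shift_seq (char_coeff n) a))"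
    by (simp only: sum_distrib_left sum.distrib distrib_left mult.left_commute)
  also have "\<dots> = j 0 * ((1 - Q)\<^sup>2 * s 0 + Q * shift_seq (char_coeff 0) a)
     + (\<Sum>n\<le>m. j (Suc n) * ((1 - Q)\<^sup>2 * s (Suc n) + Q * shift_seq (char_coeff (Suc n)) a))"
    by (rule sum_atMost_shift_zero) (simp add: j0)
  \<comment> \<open>The relations for \<open>x\<close> times a character turn
    \<open>(1 - Q)^2 + x * Q\<close> into \<open>1 + Q^2 - Q (\<zeta> + 1/\<zeta>)\<close>. The sums
    are then regrouped by character.\<close>
  also have "\<dots> = (1 + Q\<^sup>2) * j 0 * s 0 - Q * j 0 * (s 1 - s 0) + (1 + Q\<^sup>2) * (\<Sum>n\<le>m. j (Suc n) * s (Suc n))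
     - Q * (\<Sum>n\<le>m. j (Suc n) * s (Suc (Suc n))) - Q * (\<Sum>n\<le>m. j (Suc n) * s n)"
  proof -
    have "j 0 * ((1 - Q)\<^sup>2 * s 0 + Q * shift_seq (char_coeff 0) a) = (1 + Q\<^sup>2) * j 0 * s 0 - Q * j 0 * (s 1 - s 0)"
      unfolding char_coeff_shift_0 s_def[symmetric] by (simp add: algebra_simps power2_eq_square)
    moreover have "j (Suc n) * ((1 - Q)\<^sup>2 * s (Suc n) + Q * shift_seq (char_coeff (Suc n)) a) =
        (1 + Q\<^sup>2) * (j (Suc n) * s (Suc n)) - Q * (j (Suc n) * s (Suc (Suc n))) - Q * (j (Suc n) * s n)" for n
      unfolding char_coeff_shift_Suc s_def[symmetric] by (simp add: algebra_simps power2_eq_square)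
    ultimately show ?thesis
      by (simp only: sum_subtractf sum_distrib_left add_diff_eq)
  qed
  also have "(\<Sum>n\<le>m. j (Suc n) * s n) = j 1 * s 0 + (\<Sum>n\<le>m. j (Suc (Suc n)) * s (Suc n))"
    using sum_atMost_shift_zero[of "\<lambda>n. j (Suc n) * s n" m] by (simp add: j0)
  also have "(1 + Q\<^sup>2) * j 0 * s 0 - Q * j 0 * (s 1 - s 0) + (1 + Q\<^sup>2) * (\<Sum>n\<le>m. j (Suc n) * s (Suc n))
     - Q * (\<Sum>n\<le>m. j (Suc n) * s (Suc (Suc n))) - Q * (j 1 * s 0 + (\<Sum>n\<le>m. j (Suc (Suc n)) * s (Suc n))) =
     ((1 + Q\<^sup>2) * j 0 - Q * (j 1 - j 0)) * s 0 + (1 + Q\<^sup>2) * (\<Sum>n\<le>m. j (Suc n) * s (Suc n))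
     - Q * (j 0 * s 1 + (\<Sum>n\<le>m. j (Suc n) * s (Suc (Suc n)))) - Q * (\<Sum>n\<le>m. j (Suc (Suc n)) * s (Suc n))"
    by (simp add: algebra_simps)
  also have "j 0 * s 1 + (\<Sum>n\<le>m. j (Suc n) * s (Suc (Suc n))) = (\<Sum>n\<le>m. j n * s (Suc n))"
    using sum_atMost_shift_zero[of "\<lambda>n. j n * s (Suc n)" m] by (simp add: j0)
  also have "((1 + Q\<^sup>2) * j 0 - Q * (j 1 - j 0)) * s 0 + (1 + Q\<^sup>2) * (\<Sum>n\<le>m. j (Suc n) * s (Suc n))
     - Q * (\<Sum>n\<le>m. j n * s (Suc n)) - Q * (\<Sum>n\<le>m. j (Suc (Suc n)) * s (Suc n)) =
     ((1 + Q\<^sup>2) * j 0 - Q * (j 1 - j 0)) * s 0 +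
     (\<Sum>n\<le>m. ((1 + Q\<^sup>2) * j (Suc n) - Q * (j n + j (Suc (Suc n)))) * s (Suc n))"
  proof -
    have "((1 + Q\<^sup>2) * j (Suc n) - Q * (j n + j (Suc (Suc n)))) * s (Suc n) =
        (1 + Q\<^sup>2) * (j (Suc n) * s (Suc n)) - Q * (j n * s (Suc n)) - Q * (j (Suc (Suc n)) * s (Suc n))" for n
      by (simp add: algebra_simps)
    then show ?thesis by (simp only: sum_subtractf sum_distrib_left add_diff_eq)
  qed
  also have "\<dots> = jacobi_coeff (Suc m) 0 * s 0 + (\<Sum>n\<le>m. jacobi_coeff (Suc m) (Suc n) * s (Suc n))"
    unfolding jacobi_coeff_Suc_0 jacobi_coeff_Suc_Suc Q2 unfolding j_def Q_def ..
  also have "\<dots> = (\<Sum>n\<le>Suc m. jacobi_coeff (Suc m) n * s n)"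
    by (simp only: sum.atMost_Suc_shift)
  finally show ?case by (simp only: s_def)
qed

section \<open>Low coefficients of the truncated series\<close>

text \<open>Congruence modulo \<open>q^(s + 1)\<close>.\<close>

definition agree :: "nat \<Rightarrow> 'a::zero fps \<Rightarrow> 'a fps \<Rightarrow> bool" where
  "agree s f g \<longleftrightarrow> (\<forall>j\<le>s. fps_nth f j = fps_nth g j)"

lemma agree_mult: "agree s f f' \<Longrightarrow> agree s g g' \<Longrightarrow> agree s (f * g) (f' * g')"
  for f :: "'a::semiring_0 fps"
  unfolding agree_def fps_mult_nth
  by (intro allI impI sum.cong refl arg_cong2[of _ _ _ _ "(*)"]) simp_all

lemma agree_refl [simp]: "agree s f f" by (simp add: agree_def)

lemma agree_sym: "agree s f g \<Longrightarrow> agree s g f" by (simp add: agree_def)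

lemma agree_eulerpow: "s \<le> M \<Longrightarrow> M \<le> M' \<Longrightarrow> agree s (eulerpow c M') (eulerpow c M)"
  unfolding agree_def by (intro allI impI eulerpow_nth_stable) simp_all

lemma agree_qpoch:
  assumes "s \<le> M" "M \<le> M'"
  shows "agree s (qpoch M') (qpoch M :: 'a::field_char_0 fps)"
proof -
  have "qpoch M' = qpoch M' * eulerpow 1 M * (qpoch M :: 'a fps)"
    using qpoch_mult_eulerpow[of M, where 'a = 'a] by (simp add: mult_ac)
  moreover have "qpoch M = qpoch M' * eulerpow 1 M' * (qpoch M :: 'a fps)"
    using qpoch_mult_eulerpow[of M', where 'a = 'a] by simp
  moreover have "agree s (qpoch M' * eulerpow 1 M * qpoch M) (qpoch M' * eulerpow 1 M' * (qpoch M :: 'a fps))"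
    by (intro agree_mult agree_refl agree_sym[OF agree_eulerpow] assms)
  ultimately show ?thesis by metis
qed

text \<open>Modulo \<open>q^(m - a + 1)\<close> all products involved may be cut at
  \<open>m\<close>. The Gaussian binomial then reduces to \<open>eulerpow 1 m\<close>, the third
  factor of the cube.\<close>

lemma agree_qbin:
  assumes "a \<le> m"
  shows "agree (m - a) (qbin (m - a) (m + a + 1) * (eulerpow 1 m)\<^sup>2) (eulerpow 3 m :: 'a::field_char_0 fps)"
proof -
  have "agree (m - a) (qpoch (m - a + (m + a + 1)) * eulerpow 1 (m - a) * eulerpow 1 (m + a + 1) * (eulerpow 1 m)\<^sup>2)
      (qpoch m * eulerpow 1 m * eulerpow 1 m * (eulerpow 1 m :: 'a fps)\<^sup>2)"
    by (intro agree_mult agree_refl agree_eulerpow agree_qpoch agree_sym[OF agree_eulerpow]) auto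
  moreover have "qpoch m * eulerpow 1 m * eulerpow 1 m * (eulerpow 1 m :: 'a fps)\<^sup>2 = eulerpow 3 m"
    unfolding qpoch_mult_eulerpow eulerpow_eq_power[of 3] by (simp add: power2_eq_square power3_eq_cube)
  ultimately show ?thesis unfolding qbin_def by metis
qed

text \<open>Terms with \<open>n < a\<close> vanish because \<open>char_coeff n a = 0\<close>, the
  signs cancel at \<open>n = a\<close>, and later terms carry at least
  \<open>q^(triangular (a + 1))\<close>, that is, \<open>a + 1\<close> further powers of
  \<open>q\<close>.\<close>

lemma MO_trunc_expansion:
  assumes "a \<le> m"
  obtains G where "MO_trunc m a = fps_X ^ triangular a *
      (qbin (m - a) (m + a + 1) * (eulerpow 1 m)\<^sup>2 + fps_X ^ Suc a * (G :: 'a::field_char_0 fps))"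
proof -
  define G where "G = (\<Sum>n\<in>{Suc a..m}. (- 1) ^ n * fps_X ^ (triangular n - triangular (Suc a)) *
      qbin (m - n) (m + n + 1) * char_coeff n a :: 'a fps)"
  have "(\<Sum>n\<le>m. jacobi_coeff m n * (char_coeff n a :: 'a fps)) = (\<Sum>n\<in>{a..m}. jacobi_coeff m n * char_coeff n a)"
    by (rule sum.mono_neutral_right) (auto simp: char_coeff_eq_0)
  also have "\<dots> = jacobi_coeff m a * char_coeff a a + (\<Sum>n\<in>{Suc a..m}. jacobi_coeff m n * char_coeff n a)"
    using assms by (rule sum.atLeast_Suc_atMost)
  also have "jacobi_coeff m a * char_coeff a a = fps_X ^ triangular a * (qbin (m - a) (m + a + 1) :: 'a fps)"
  proof -
    have "(- 1) ^ a * (- 1) ^ a = (1 :: 'a fps)" by (simp flip: power_mult_distrib)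
    then show ?thesis using assms by (simp add: jacobi_coeff_def char_coeff_diagonal mult_ac)
  qed
  also have "(\<Sum>n\<in>{Suc a..m}. jacobi_coeff m n * char_coeff n a) = fps_X ^ triangular (Suc a) * G"
    unfolding G_def sum_distrib_left
  proof (rule sum.cong[OF refl])
    fix n assume n: "n \<in> {Suc a..m}"
    then have "fps_X ^ triangular n = (fps_X ^ triangular (Suc a) * fps_X ^ (triangular n - triangular (Suc a)) :: 'a fps)"
      using triangular_mono[of "Suc a" n] by (simp add: power_add[symmetric])
    then show "jacobi_coeff m n * char_coeff n a = fps_X ^ triangular (Suc a) * ((- 1) ^ n * fps_X ^ (triangular n - triangular (Suc a)) *
      qbin (m - n) (m + n + 1) * char_coeff n a :: 'a fps)"
      using n by (simp add: jacobi_coeff_def mult_ac)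
  qed
  finally have "MO_trunc m a * (qpoch m)\<^sup>2 = fps_X ^ triangular a * (qbin (m - a) (m + a + 1) + fps_X ^ Suc a * G)"
    by (simp add: MO_trunc_jacobi_coeff triangular_Suc power_add algebra_simps)
  then have "MO_trunc m a * (qpoch m * eulerpow 1 m)\<^sup>2 =
      fps_X ^ triangular a * (qbin (m - a) (m + a + 1) + fps_X ^ Suc a * G) * (eulerpow 1 m)\<^sup>2"
    unfolding power_mult_distrib mult.assoc[symmetric] by simp
  then have "MO_trunc m a = fps_X ^ triangular a * (qbin (m - a) (m + a + 1) * (eulerpow 1 m)\<^sup>2 + fps_X ^ Suc a * (G * (eulerpow 1 m)\<^sup>2))"
    unfolding qpoch_mult_eulerpow by (simp add: algebra_simps)
  then show ?thesis by (rule that)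
qed

text \<open>The bound \<open>j \<le> a\<close> stays clear of the remainder \<open>G\<close>, and
  \<open>j \<le> m - a\<close> stays within the range of \<open>agree_qbin\<close>.\<close>

lemma MO_trunc_nth:
  assumes "a \<le> m"
  shows "i < triangular a \<Longrightarrow> fps_nth (MO_trunc m a :: 'a::field_char_0 fps) i = 0"
    and "j \<le> a \<Longrightarrow> j \<le> m - a \<Longrightarrow> fps_nth (MO_trunc m a :: 'a fps) (triangular a + j) = fps_nth (eulerpow 3 m) j"
proof -
  obtain G where G: "MO_trunc m a = fps_X ^ triangular a *
      (qbin (m - a) (m + a + 1) * (eulerpow 1 m)\<^sup>2 + fps_X ^ Suc a * (G :: 'a fps))"
    using MO_trunc_expansion[OF assms, where 'a = 'a] by blast
  show "fps_nth (MO_trunc m a :: 'a fps) i = 0" if "i < triangular a"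
    unfolding G fps_X_power_mult_nth using that by simp
  show "fps_nth (MO_trunc m a :: 'a fps) (triangular a + j) = fps_nth (eulerpow 3 m) j" if "j \<le> a" "j \<le> m - a"
    using agree_qbin[OF assms, where 'a = 'a] that
    unfolding G fps_X_power_mult_nth fps_add_nth agree_def by simp
qed

section \<open>Passage to the infinite sum and product\<close>

lemma MO_term_eq:
  assumes "\<forall>k\<in>set ks. 0 < k"
  shows "fps_X ^ sum_list ks / (\<Prod>k\<leftarrow>ks. (1 - fps_X ^ k)\<^sup>2) = (MO_term ks :: 'a::field_char_0 fps)"
proof -
  have "fps_nth (\<Prod>k\<leftarrow>ks. (1 - fps_X ^ k)\<^sup>2 :: 'a fps) 0 = 1"
    using assms by (induction ks) (simp_all add: fps_nth_power_0 zero_power)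
  then have "fps_X ^ sum_list ks / (\<Prod>k\<leftarrow>ks. (1 - fps_X ^ k)\<^sup>2) =
      (fps_X ^ sum_list ks * inverse (\<Prod>k\<leftarrow>ks. (1 - fps_X ^ k)\<^sup>2) :: 'a fps)"
    by (intro fps_divide_unit) simp
  also have "\<dots> = MO_term ks"
    by (induction ks)
       (simp_all add: MO_term_def MO_part_def geometric_def power_add fps_inverse_mult fps_inverse_power mult_ac)
  finally show ?thesis .
qed

lemma MO_term_factor: "\<exists>g. MO_term ks = fps_X ^ sum_list ks * g"
proof (induction ks)
  case Nil
  show ?case by (intro exI[of _ 1]) (simp add: MO_term_def)
next
  case (Cons k ks)
  then obtain g where "MO_term ks = fps_X ^ sum_list ks * (g :: 'a fps)" by blast
  then show ?case
    by (intro exI[of _ "(geometric k)\<^sup>2 * g"]) (simp add: MO_term_def MO_part_def power_add mult_ac)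
qed

lemma MO_term_nth_eq_0:
  "i < sum_list ks \<Longrightarrow> fps_nth (MO_term ks :: 'a::field_char_0 fps) i = 0"
  using MO_term_factor[of ks, where 'a = 'a] by (auto simp: fps_X_power_mult_nth)

text \<open>An index list with an entry \<open>k > n\<close> contributes only powers above
  \<open>q^n\<close>. Each coefficient of the finite partial sums is therefore eventually constant,
  which is convergence in the topology of formal power series.\<close>

lemma MO_series_nth:
  assumes "n \<le> m"
  shows "fps_nth (MO_series a) n = fps_nth (MO_trunc m a) n"
proof -
  define U where "U = Abs_fps (\<lambda>n. fps_nth (MO_trunc n a :: rat fps) n)"
  have small: "fps_nth (MO_term ks :: rat fps) n = 0" if "ks \<in> MO_indices a - MO_trunc_indices n a" for ks n
  proof -
    have "\<not> set ks \<subseteq> {..n}" using that by (simp add: MO_trunc_indices_def)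
    then obtain k where "k \<in> set ks" "n < k" by (meson atMost_iff not_le subsetI)
    then have "n < sum_list ks" using member_le_sum_list[of k ks] by simp
    then show ?thesis by (rule MO_term_nth_eq_0)
  qed
  have trunc: "fps_nth (sum MO_term F :: rat fps) n = fps_nth U n"
    if "finite F" "MO_trunc_indices n a \<subseteq> F" "F \<subseteq> MO_indices a" for F n
  proof -
    have "(\<Sum>ks\<in>F. fps_nth (MO_term ks :: rat fps) n) = (\<Sum>ks\<in>MO_trunc_indices n a. fps_nth (MO_term ks) n)"
      by (rule sum.mono_neutral_right) (use that small in auto)
    then show ?thesis by (simp add: U_def MO_trunc_def fps_sum_nth)
  qed
  have "(MO_term has_sum U) (MO_indices a)"
    unfolding has_sum_def
  proof (rule tendsto_fpsI)
    fix n
    show "\<forall>\<^sub>F F in finite_subsets_at_top (MO_indices a). fps_nth (sum MO_term F) n = fps_nth U n"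
    proof -
      have "MO_trunc_indices n a \<subseteq> MO_indices a" by (auto simp: MO_trunc_indices_def)
      then show ?thesis
        unfolding eventually_finite_subsets_at_top
        using trunc by (intro exI[of _ "MO_trunc_indices n a"]) simp
    qed
  qed
  moreover have "MO_series a = (\<Sum>\<^sub>\<infinity>ks\<in>MO_indices a. MO_term ks)"
    unfolding MO_series_def by (rule infsum_cong, rule MO_term_eq) (simp add: MO_indices_def)
  ultimately have "MO_series a = U" by (simp add: infsumI)
  moreover have "fps_nth (MO_trunc m a :: rat fps) n = fps_nth U n"
    unfolding MO_trunc_def
    by (rule trunc[OF finite_MO_trunc_indices]) (use assms in \<open>auto simp: MO_trunc_indices_def\<close>)
  ultimately show ?thesis by simp
qed

lemma MO_series_low: "i < triangular a \<Longrightarrow> fps_nth (MO_series a) i = 0"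
  using MO_series_nth[of i "i + a" a] MO_trunc_nth(1)[of a "i + a" i] by simp

lemma MO_series_stable:
  assumes "j \<le> a" "j \<le> M"
  shows "fps_nth (MO_series a) (triangular a + j) = fps_nth (eulerpow 3 M) j"
proof -
  let ?m = "triangular a + j + a"
  have "fps_nth (MO_series a) (triangular a + j) = fps_nth (MO_trunc ?m a) (triangular a + j)"
    by (rule MO_series_nth) simp
  also have "\<dots> = fps_nth (eulerpow 3 ?m) j" by (rule MO_trunc_nth(2)) (use assms in auto)
  also have "\<dots> = fps_nth (eulerpow 3 j) j" by (rule eulerpow_nth_stable) auto
  also have "\<dots> = fps_nth (eulerpow 3 M) j" by (rule eulerpow_nth_stable[symmetric]) (use assms in auto)
  finally show ?thesis .
qed

lemma prodinf_cubes_nth: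
  "fps_nth (prodinf (\<lambda>n. 1 / (1 - fps_X ^ Suc n) ^ 3) :: 'a::field_char_0 fps) j = fps_nth (eulerpow 3 j) j"
proof -
  define L where "L = Abs_fps (\<lambda>j. fps_nth (eulerpow 3 j :: 'a fps) j)"
  have f: "1 / (1 - fps_X ^ Suc n) ^ 3 = (geometric (Suc n) ^ 3 :: 'a fps)" for n
  proof -
    have "1 / (1 - fps_X ^ Suc n) ^ 3 = 1 * inverse ((1 - fps_X ^ Suc n) ^ 3 :: 'a fps)"
      by (rule fps_divide_unit) (simp add: fps_nth_power_0 del: power_Suc)
    then show ?thesis by (simp add: geometric_def fps_inverse_power)
  qed
  have prod: "(\<Prod>i\<le>n. geometric (Suc i) ^ 3 :: 'a fps) = eulerpow 3 (Suc n)" for n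
    unfolding eulerpow_def
    by (rule prod.reindex_bij_witness[of _ "\<lambda>k. k - 1" Suc]) auto
  have "raw_has_prod (\<lambda>n. geometric (Suc n) ^ 3 :: 'a fps) 0 L"
    unfolding raw_has_prod_def
  proof
    show "(\<lambda>n. \<Prod>i\<le>n. geometric (Suc (i + 0)) ^ 3) \<longlonglongrightarrow> L"
    proof (rule tendsto_fpsI)
      fix j
      show "\<forall>\<^sub>F n in sequentially. fps_nth (\<Prod>i\<le>n. geometric (Suc (i + 0)) ^ 3) j = fps_nth L j"
        using eventually_ge_at_top[of j]
      proof eventually_elim
        case (elim n)
        then show ?case using eulerpow_nth_stable[of j j "Suc n" 3, where 'a = 'a] by (simp add: prod L_def)
      qed
    qed
    \<comment> \<open>Convergence of an infinite product includes a nonzero limit; the constant term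
      shows it.\<close>
    have "fps_nth L 0 = 1" by (simp add: L_def)
    then show "L \<noteq> 0" by auto
  qed
  then have "(\<lambda>n. geometric (Suc n) ^ 3 :: 'a fps) has_prod L" by (auto simp: has_prod_def)
  then have "prodinf (\<lambda>n. geometric (Suc n) ^ 3 :: 'a fps) = L" by (rule has_prod_unique[symmetric])
  then show ?thesis unfolding f by (simp add: L_def)
qed

text \<open>The vanishing low coefficients ensure that the shift discards nothing, so the Laurent
  series is again a power series.\<close>

lemma fls_X_intpow_mult_fps_to_fls:
  fixes f :: "'a::semiring_1 fps"
  assumes "\<And>i. i < m \<Longrightarrow> fps_nth f i = 0"
  shows "fls_X_intpow (- int m) * fps_to_fls f = fps_to_fls (fps_shift m f)"
proof (rule fls_eqI)
  fix n
  show "fls_nth (fls_X_intpow (- int m) * fps_to_fls f) n = fls_nth (fps_to_fls (fps_shift m f)) n"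
    unfolding fls_X_intpow_times_conv_shift using assms by (auto simp: nat_add_distrib add.commute)
qed

lemma triangular_choose: "triangular a = (a + 1) choose 2"
  by (simp add: triangular_def choose_two mult.commute)

text \<open>The value \<open>t^2 = - 2\<close> turns the hook weight into \<open>2 / h^2 + 1\<close>
  and makes the exponent \<open>1 - t^2 = 3\<close>. Such a \<open>t\<close> is taken in the complex
  numbers, where it is not real and hence not an integer; injectivity of \<open>of_rat\<close>
  returns the identity to the rationals.\<close>

lemma hook_product_sum_eq_eulerpow:
  assumes "N \<le> M"
  shows "(\<Sum>xs\<in>partitions_of (int N). \<Prod>h\<in>#hook_lengths xs. (2 / (of_int h)\<^sup>2 + 1)) = fps_nth (eulerpow 3 M :: rat fps) N"
proof -
  let ?t = "\<i> * of_real (sqrt 2) :: complex"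
  have t2: "?t\<^sup>2 = - 2" by (simp add: power_mult_distrib flip: of_real_power)
  have tZ: "?t \<notin> \<int>"
  proof
    assume "?t \<in> \<int>"
    then have "Im ?t = 0" by (auto elim!: Ints_cases)
    then show False by simp
  qed
  have w: "hook_weight ?t h = of_rat (2 / (of_int h)\<^sup>2 + 1)" for h
    by (simp add: hook_weight_def t2 of_rat_add of_rat_divide of_rat_power)
  have prod: "(\<Prod>h\<in>#H. hook_weight ?t h) = of_rat (\<Prod>h\<in>#H. (2 / (of_int h)\<^sup>2 + 1))" for H
    by (induction H) (simp_all add: w of_rat_mult)
  have "(of_rat (\<Sum>xs\<in>partitions_of (int N). \<Prod>h\<in>#hook_lengths xs. (2 / (of_int h)\<^sup>2 + 1)) :: complex) = hook_sum ?t N"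
    by (simp add: hook_sum_def prod of_rat_sum)
  also have "\<dots> = of_rat (fps_nth (eulerpow 3 M) N)"
    by (rule hook_sum_eq_eulerpow[OF tZ _ assms]) (simp add: t2)
  finally show ?thesis by simp
qed

theorem theorem1p1:
  fixes a :: nat
  assumes "a > 0"
  shows "(\<exists>R \<in> fps_big_O (a + 1).
            fls_X_intpow (- int (a * (a + 1) div 2)) * fps_to_fls (MO_series a)
              = fps_to_fls (prodinf (\<lambda>n. 1 / (1 - fps_X ^ Suc n) ^ 3) + R))
    \<and> (\<forall>(n::nat) (N::int).
          n \<le> a + ((a + 1) choose 2) \<and> N = int n - int ((a + 1) choose 2) \<longrightarrow>
            MO a n = (\<Sum>xs\<in>partitions_of N. \<Prod>h\<in>#hook_lengths xs. (2 / (of_int h)\<^sup>2 + 1)) \<and>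
            (\<Sum>xs\<in>partitions_of N. \<Prod>h\<in>#hook_lengths xs. (2 / (of_int h)\<^sup>2 + 1))
              = (\<Sum>xs\<in>partitions_of N. \<Prod>s=1..nat N. (of_nat ((2 + count_list xs s) choose 2) :: rat)))"
proof (intro conjI allI impI)
  let ?P = "prodinf (\<lambda>n. 1 / (1 - fps_X ^ Suc n) ^ 3) :: rat fps"
  \<comment> \<open>The error term is the full difference, so only its coefficients up to
    \<open>q^a\<close> have to be examined.\<close>
  let ?R = "fps_shift (triangular a) (MO_series a) - ?P"
  have "fps_nth (fps_shift (triangular a) (MO_series a)) j = fps_nth ?P j" if "j < a + 1" for j
    using MO_series_stable[of j a j] that by (simp add: prodinf_cubes_nth add.commute del: power_Suc)
  then have "?R \<in> fps_big_O (a + 1)" by (simp add: fps_big_O_def del: power_Suc)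
  moreover have "fls_X_intpow (- int (a * (a + 1) div 2)) * fps_to_fls (MO_series a) = fps_to_fls (?P + ?R)"
    unfolding triangular_def[symmetric]
    by (subst fls_X_intpow_mult_fps_to_fls) (simp_all add: MO_series_low)
  ultimately show "\<exists>R \<in> fps_big_O (a + 1).
            fls_X_intpow (- int (a * (a + 1) div 2)) * fps_to_fls (MO_series a) = fps_to_fls (?P + R)"
    by blast
next
  fix n :: nat and N :: int
  assume N: "n \<le> a + ((a + 1) choose 2) \<and> N = int n - int ((a + 1) choose 2)"
  show "MO a n = (\<Sum>xs\<in>partitions_of N. \<Prod>h\<in>#hook_lengths xs. (2 / (of_int h)\<^sup>2 + 1))"
  proof (cases "n < triangular a")
    case True
    \<comment> \<open>Both sides are zero here: there are no partitions, and the series starts no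
      earlier than \<open>q^(triangular a)\<close>.\<close>
    then have "N < 0" using N by (simp add: triangular_choose)
    then have "partitions_of N = {}" by (auto simp: partitions_of_def)
    then show ?thesis using True by (simp add: MO_def MO_series_low)
  next
    case False
    define j where "j = n - triangular a"
    have j: "n = triangular a + j" "N = int j" "j \<le> a" using False N by (auto simp: j_def triangular_choose)
    show ?thesis using MO_series_stable[of j a j] hook_product_sum_eq_eulerpow[of j j] j by (simp add: MO_def)
  qed
  show "(\<Sum>xs\<in>partitions_of N. \<Prod>h\<in>#hook_lengths xs. (2 / (of_int h)\<^sup>2 + 1))
      = (\<Sum>xs\<in>partitions_of N. \<Prod>s=1..nat N. (of_nat ((2 + count_list xs s) choose 2) :: rat))"
  proof (cases "N < 0")
    case True
    then have "partitions_of N = {}" by (auto simp: partitions_of_def)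
    then show ?thesis by simp
  next
    case False
    define j where "j = nat N"
    have j: "N = int j" using False by (simp add: j_def)
    \<comment> \<open>Both sums are the coefficient of \<open>q^j\<close> in the cube of the Euler
      product, the parts being bounded by \<open>j\<close> automatically.\<close>
    show ?thesis
      using hook_product_sum_eq_eulerpow[of j j] sum_parts_weight[of j j, where 'a = rat]
      by (simp add: j partitions_of_eq_bounded parts_weight_def)
  qed
qed

end
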